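(* Let $n\ge 1$ be an integer and let $l$ be a real number satisfying $l\ge 2$ if $n\in\{1,2,3,4,5\}$, and $l\ge\frac n2-1$ if $n\ge 6$. Suppose $(u_0,u_1)\in (H^{l+1}(\mathbf{R}^n)\cap L^{1,1}(\mathbf{R}^n))\times(H^{l}(\mathbf{R}^n)\cap L^{1,1}(\mathbf{R}^n))$, and let $u\in X_2$ be the solution of the Cauchy problem $$u_{tt}-\Delta u_{tt}+\Delta^2u-\Delta u+u_t=0 \ \text{ in } (0,\infty)\times\mathbf{R}^n,\qquad u(0,x)=u_0(x),\quad u_t(0,x)=u_1(x).$$ Then $$\|u(t,\cdot)\|_2\le C I_0\, t^{-\frac n4}\qquad (t\ge 1),$$ where $C>0$ is a constant independent of $t$ and of $u_0,u_1$.
   Context: The Fourier transform (in $x$) is $\hat f(\xi)=\int_{\mathbf{R}^n}f(x)e^{-i\xi\cdot x}\,dx$. $\|\cdot\|_p$ is the $L^p(\mathbf{R}^n)$ norm. For real $l\ge 0$, $\|f\|_{H^l}=\left(\int_{\mathbf{R}^n}(1+|\xi|^2)^l|\hat f(\xi)|^2d\xi\right)^{1/2}$. $L^{1,1}(\mathbf{R}^n)$ is the set of $f\in L^1(\mathbf{R}^n)$ with $\|f\|_{1,1}:=\int_{\mathbf{R}^n}(1+|x|)|f(x)|dx<\infty$. The solution class is $X_2:=C^2([0,\infty);H^1(\mathbf{R}^n))\cap C^1([0,\infty);H^2(\mathbf{R}^n))\cap C([0,\infty);H^3(\mathbf{R}^n))$. It is known that for $(u_0,u_1)\in H^3(\mathbf{R}^n)\times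 H^2(\mathbf{R}^n)$ the Cauchy problem has a unique solution in $X_2$. Put $I_0:=\|u_1\|_{H^l}+\|u_0\|_{H^{l+1}}+\|u_1\|_{1,1}+\|u_0\|_{1,1}$. *)

theory Defs
  imports "HOL-Analysis.Analysis"
begin

text \<open>
  Elements of the spaces \<open>L\<^sup>2(\<real>\<^sup>n)\<close>, \<open>H\<^sup>s(\<real>\<^sup>n)\<close> and \<open>L\<^sup>1\<^sup>,\<^sup>1(\<real>\<^sup>n)\<close> are represented by Borel functions; every
  a.e.-class of Lebesgue measurable functions has such a representative. Functions are
  complex valued, which covers real-valued solutions.
\<close>

definition L2 :: "(real ^ 'n \<Rightarrow> complex) set" where
  "L2 = {f. f \<in> borel_measurable lborel \<and> integrable lborel (\<lambda>x. (norm (f x))\<^sup>2)}"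

definition L2_norm :: "(real ^ 'n \<Rightarrow> complex) \<Rightarrow> real" where
  "L2_norm f = sqrt (LINT x|lborel. (norm (f x))\<^sup>2)"

definition L11 :: "(real ^ 'n \<Rightarrow> complex) set" where
  "L11 = {f. integrable lborel f \<and> integrable lborel (\<lambda>x. (1 + norm x) * norm (f x))}"

definition L11_norm :: "(real ^ 'n \<Rightarrow> complex) \<Rightarrow> real" where
  "L11_norm f = (LINT x|lborel. (1 + norm x) * norm (f x))"

definition fourier_integral :: "(real ^ 'n \<Rightarrow> complex) \<Rightarrow> real ^ 'n \<Rightarrow> complex" where
  "fourier_integral f \<xi> = (LINT x|lborel. f x * exp (- \<i> * complex_of_real (\<xi> \<bullet> x)))"

text \<open>
  The Fourier transform of an \<open>L\<^sup>2\<close> function need not be given by a convergent integral. It is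
  the \<open>L\<^sup>2\<close> limit of the Fourier integrals over growing balls, which exists and is unique up to
  null sets by Plancherel's theorem. For functions in \<open>L\<^sup>1 \<inter> L\<^sup>2\<close> it agrees a.e. with the
  Fourier integral.
\<close>

definition fourier :: "(real ^ 'n \<Rightarrow> complex) \<Rightarrow> real ^ 'n \<Rightarrow> complex" where
  "fourier f = (SOME g. g \<in> L2 \<and>
     ((\<lambda>R. L2_norm (\<lambda>\<xi>. fourier_integral (\<lambda>x. indicator (cball 0 R) x * f x) \<xi> - g \<xi>)) \<longlongrightarrow> 0) at_top)"

definition sobolev :: "real \<Rightarrow> (real ^ 'n \<Rightarrow> complex) set" where
  "sobolev s = {f \<in> L2. integrable lborel (\<lambda>\<xi>. (1 + (norm \<xi>)\<^sup>2) powr s * (norm (fourier f \<xi>))\<^sup>2)}"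

definition sobolev_norm :: "real \<Rightarrow> (real ^ 'n \<Rightarrow> complex) \<Rightarrow> real" where
  "sobolev_norm s f = sqrt (LINT \<xi>|lborel. (1 + (norm \<xi>)\<^sup>2) powr s * (norm (fourier f \<xi>))\<^sup>2)"

text \<open>
  Curves \<open>[0,\<infinity>) \<rightarrow> H\<^sup>s\<close>: continuity and strong differentiability with respect to the
  \<open>H\<^sup>s\<close> norm (one-sided at \<open>t = 0\<close>). Values at negative times are irrelevant.
\<close>

definition sobolev_continuous :: "real \<Rightarrow> (real \<Rightarrow> real ^ 'n \<Rightarrow> complex) \<Rightarrow> bool" where
  "sobolev_continuous s v \<longleftrightarrow>
     (\<forall>t\<ge>0. v t \<in> sobolev s \<and>
        ((\<lambda>\<tau>. sobolev_norm s (\<lambda>x. v \<tau> x - v t x)) \<longlongrightarrow> 0) (at t within {0..}))"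

definition sobolev_deriv ::
  "real \<Rightarrow> (real \<Rightarrow> real ^ 'n \<Rightarrow> complex) \<Rightarrow> (real \<Rightarrow> real ^ 'n \<Rightarrow> complex) \<Rightarrow> bool" where
  "sobolev_deriv s v w \<longleftrightarrow>
     (\<forall>t\<ge>0. v t \<in> sobolev s \<and> w t \<in> sobolev s \<and>
        ((\<lambda>\<tau>. sobolev_norm s (\<lambda>x. (v \<tau> x - v t x) / complex_of_real (\<tau> - t) - w t x)) \<longlongrightarrow> 0)
          (at t within {0..}))"

primrec C_sobolev :: "nat \<Rightarrow> real \<Rightarrow> (real \<Rightarrow> real ^ 'n \<Rightarrow> complex) set" where
  "C_sobolev 0 s = {v. sobolev_continuous s v}"
| "C_sobolev (Suc k) s = {v. \<exists>w. sobolev_deriv s v w \<and> w \<in> C_sobolev k s}"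

definition X2 :: "(real \<Rightarrow> real ^ 'n \<Rightarrow> complex) set" where
  "X2 = C_sobolev 2 1 \<inter> C_sobolev 1 2 \<inter> C_sobolev 0 3"

definition partial_deriv :: "'n \<Rightarrow> (real ^ 'n \<Rightarrow> complex) \<Rightarrow> real ^ 'n \<Rightarrow> complex" where
  "partial_deriv i f x = frechet_derivative f (at x) (axis i 1)"

definition laplacian :: "(real ^ 'n \<Rightarrow> complex) \<Rightarrow> real ^ 'n \<Rightarrow> complex" where
  "laplacian f x = (\<Sum>i\<in>UNIV. partial_deriv i (partial_deriv i f) x)"

primrec Ck :: "nat \<Rightarrow> (real ^ 'n \<Rightarrow> complex) \<Rightarrow> bool" where
  "Ck 0 f \<longleftrightarrow> continuous_on UNIV f"
| "Ck (Suc k) f \<longleftrightarrow> f differentiable_on UNIV \<and> (\<forall>i. Ck k (partial_deriv i f))"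

definition test_functions :: "(real ^ 'n \<Rightarrow> complex) set" where
  "test_functions = {\<phi>. (\<forall>k. Ck k \<phi>) \<and> compact (closure {x. \<phi> x \<noteq> 0})}"

text \<open>
  For \<open>u \<in> X\<^sub>2\<close> the terms \<open>\<Delta>u\<^sub>t\<^sub>t\<close> and \<open>\<Delta>\<^sup>2u\<close> only lie in \<open>H\<^sup>-\<^sup>1\<close>, so for each \<open>t > 0\<close> the equation
  is read as an identity of distributions on \<open>\<real>\<^sup>n\<close>.
\<close>

definition distribution_of :: "(real ^ 'n \<Rightarrow> complex) \<Rightarrow> (real ^ 'n \<Rightarrow> complex) \<Rightarrow> complex" where
  "distribution_of f \<phi> = (LINT x|lborel. f x * \<phi> x)"

definition dist_laplacian ::
  "((real ^ 'n \<Rightarrow> complex) \<Rightarrow> complex) \<Rightarrow> (real ^ 'n \<Rightarrow> complex) \<Rightarrow> complex" where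
  "dist_laplacian T \<phi> = T (laplacian \<phi>)"

definition satisfies_equation ::
  "(real ^ 'n \<Rightarrow> complex) \<Rightarrow> (real ^ 'n \<Rightarrow> complex) \<Rightarrow> (real ^ 'n \<Rightarrow> complex) \<Rightarrow> bool" where
  "satisfies_equation v v\<^sub>t v\<^sub>t\<^sub>t \<longleftrightarrow>
     (\<forall>\<phi>\<in>test_functions.
        distribution_of v\<^sub>t\<^sub>t \<phi>
        - dist_laplacian (distribution_of v\<^sub>t\<^sub>t) \<phi>
        + dist_laplacian (dist_laplacian (distribution_of v)) \<phi>
        - dist_laplacian (distribution_of v) \<phi>
        + distribution_of v\<^sub>t \<phi> = 0)"

text \<open>
  The time derivatives \<open>u\<^sub>t\<close>, \<open>u\<^sub>t\<^sub>t\<close> are those in \<open>H\<^sup>1\<close>; for \<open>u \<in> X\<^sub>2\<close> they exist and are unique up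
  to null sets at each time.
\<close>

definition solves_cauchy_problem ::
  "(real ^ 'n \<Rightarrow> complex) \<Rightarrow> (real ^ 'n \<Rightarrow> complex) \<Rightarrow> (real \<Rightarrow> real ^ 'n \<Rightarrow> complex) \<Rightarrow> bool" where
  "solves_cauchy_problem u\<^sub>0 u\<^sub>1 u \<longleftrightarrow>
     (\<exists>u\<^sub>t u\<^sub>t\<^sub>t. sobolev_deriv 1 u u\<^sub>t \<and> sobolev_deriv 1 u\<^sub>t u\<^sub>t\<^sub>t \<and>
        (\<forall>t>0. satisfies_equation (u t) (u\<^sub>t t) (u\<^sub>t\<^sub>t t)) \<and>
        (AE x in lborel. u 0 x = u\<^sub>0 x) \<and>
        (AE x in lborel. u\<^sub>t 0 x = u\<^sub>1 x))"

definition I0 :: "real \<Rightarrow> (real ^ 'n \<Rightarrow> complex) \<Rightarrow> (real ^ 'n \<Rightarrow> complex) \<Rightarrow> real" where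
  "I0 l u\<^sub>0 u\<^sub>1 = sobolev_norm l u\<^sub>1 + sobolev_norm (l + 1) u\<^sub>0 + L11_norm u\<^sub>1 + L11_norm u\<^sub>0"

end

theory Submission
  imports Defs "HOL-Probability.Characteristic_Functions"
begin

text \<open>
  After a Fourier transform in space the equation becomes, at each frequency \<open>\<xi>\<close>, the damped
  oscillator \<open>v'' + a v' + |\<xi>|\<^sup>2 v = 0\<close> with friction \<open>a = 1 / (1 + |\<xi>|\<^sup>2)\<close>. The modified energy
  \<open>|v' + a v / 2|\<^sup>2 + (|\<xi>|\<^sup>2 + a\<^sup>2 / 4) |v|\<^sup>2\<close> has derivative \<open>- a (|v'|\<^sup>2 + |\<xi>|\<^sup>2 |v|\<^sup>2)\<close> and therefore
  decays at the rate \<open>\<rho> = |\<xi>|\<^sup>2 a\<^sup>2 / 2\<close> (\<open>energy_dissipation\<close>, \<open>energy_decay\<close>), which gives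
  \<open>|v(t)|\<^sup>2 \<le> 48 exp (- \<rho> t) (|v(0)|\<^sup>2 + a |v'(0)|\<^sup>2)\<close> without solving the oscillator.

  Where \<open>|\<xi>| \<le> 1\<close> the rate is at least \<open>|\<xi>|\<^sup>2 / 8\<close>, the transforms of the data are bounded by
  their \<open>L\<^sup>1\<close> norms, and integrating the Gaussian yields \<open>t\<^sup>-\<^sup>n\<^sup>/\<^sup>2\<close> for the square of the norm. Where \<open>|\<xi>| \<ge> 1\<close> the rate
  is only of order \<open>1 / (1 + |\<xi>|\<^sup>2)\<close>; there decay is bought with regularity,
  \<open>exp (- \<rho> t) \<le> C (t / (1 + |\<xi>|\<^sup>2))\<^sup>-\<^sup>(\<^sup>l\<^sup>+\<^sup>1\<^sup>)\<close>, and the Sobolev norms of the data absorb the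
  weights (\<open>fourier_solution_bound\<close>). The hypothesis on \<open>l\<close> guarantees \<open>l + 1 \<ge> n / 2\<close>, so the low
  frequencies dictate the rate.

  Two things have to be supplied. The first is Plancherel's theory for the \<open>L\<^sup>2\<close> Fourier transform:
  a Gaussian regularisation of Parseval's identity gives the upper bound
  (\<open>plancherel_upper_L1_L2\<close>), hence the existence of the transform, and by duality the lower bound
  (\<open>plancherel_lower\<close>). The second is the passage from the distributional equation for curves in
  Sobolev spaces to the oscillator: testing with translates of bumps gives the equation at almost
  every frequency (\<open>satisfies_equation_fourier\<close>), and since the transform at a given time is
  only defined up to null sets, the energy argument is carried out for the energy contained in
  arbitrary sets of frequencies (\<open>energy_decay_on_set\<close>).
\<close>

section \<open>Gaussians on Euclidean space\<close>

lemma integral_lborel_prod: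
  fixes f :: "'a::euclidean_space \<Rightarrow> real \<Rightarrow> complex"
  assumes "\<And>b. b \<in> Basis \<Longrightarrow> integrable lborel (f b)"
  shows "integrable lborel (\<lambda>x::'a. \<Prod>b\<in>Basis. f b (x \<bullet> b))"
    and "(LINT x|lborel. (\<Prod>b\<in>Basis. f b ((x::'a) \<bullet> b))) = (\<Prod>b\<in>Basis. (LINT s|lborel. f b s))"
proof -
  interpret product_sigma_finite "\<lambda>b::'a. lborel :: real measure" by standard
  let ?T = "\<lambda>g. \<Sum>b\<in>Basis. g b *\<^sub>R (b::'a)"
  have T [measurable]: "?T \<in> measurable (\<Pi>\<^sub>M b\<in>Basis. lborel) borel"
    by measurable
  have [measurable]: "\<And>b. b \<in> Basis \<Longrightarrow> f b \<in> borel_measurable borel"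
    using assms by (auto dest!: borel_measurable_integrable)
  have m: "(\<lambda>x::'a. \<Prod>b\<in>Basis. f b (x \<bullet> b)) \<in> borel_measurable borel"
    by measurable
  have eq: "(\<Prod>b\<in>Basis. f b (?T g \<bullet> b)) = (\<Prod>b\<in>Basis. f b (g b))" for g
    by (intro prod.cong) auto
  show "integrable lborel (\<lambda>x::'a. \<Prod>b\<in>Basis. f b (x \<bullet> b))"
    unfolding lborel_eq[where 'a='a] using product_integrable_prod[of Basis f] assms
    by (subst integrable_distr_eq[OF T m]) (simp add: eq)
  show "(LINT x|lborel. (\<Prod>b\<in>Basis. f b ((x::'a) \<bullet> b))) = (\<Prod>b\<in>Basis. (LINT s|lborel. f b s))"
    unfolding lborel_eq[where 'a='a] using product_integral_prod[of Basis f] assms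
    by (subst integral_distr[OF T m]) (simp add: eq)
qed

lemma lborel_reflect_eq: "distr lborel borel (\<lambda>x. c - x) = (lborel :: 'a::euclidean_space measure)"
  using lborel_affine[of "-1" c] by (simp add: density_1)

lemma lborel_translate_eq: "distr lborel borel (\<lambda>x. x + c) = (lborel :: 'a::euclidean_space measure)"
  using lborel_affine[of 1 c] by (simp add: density_1 add.commute)

lemma
  fixes f :: "'a::euclidean_space \<Rightarrow> 'b::{banach, second_countable_topology}"
  assumes [measurable]: "f \<in> borel_measurable borel"
  shows lborel_integral_translate: "(LINT x|lborel. f (x + c)) = (LINT x|lborel. f x)"
    and lborel_integral_reflect: "(LINT x|lborel. f (c - x)) = (LINT x|lborel. f x)"
    and lborel_integral_uminus: "(LINT x|lborel. f (- x)) = (LINT x|lborel. f x)"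
    and lborel_integrable_uminus: "integrable lborel (\<lambda>x. f (- x)) \<longleftrightarrow> integrable lborel f"
proof -
  show "(LINT x|lborel. f (x + c)) = (LINT x|lborel. f x)"
    using integral_distr[of "\<lambda>x. x + c" lborel borel f] by (simp add: lborel_translate_eq)
  have 1: "(LINT x|lborel. f (c - x)) = (LINT x|lborel. f x)" for c
    using integral_distr[of "\<lambda>x. c - x" lborel borel f] by (simp add: lborel_reflect_eq)
  have 2: "integrable lborel (\<lambda>x. f (c - x)) \<longleftrightarrow> integrable lborel f" for c
    using integrable_distr_eq[of "\<lambda>x. c - x" lborel borel f] by (simp add: lborel_reflect_eq)
  show "(LINT x|lborel. f (c - x)) = (LINT x|lborel. f x)" by (rule 1)
  show "(LINT x|lborel. f (- x)) = (LINT x|lborel. f x)"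
    "integrable lborel (\<lambda>x. f (- x)) \<longleftrightarrow> integrable lborel f" using 1[of 0] 2[of 0] by auto
qed

lemma lborel_integral_scale:
  fixes f :: "'a::euclidean_space \<Rightarrow> 'b::{banach, second_countable_topology}"
  assumes [measurable]: "f \<in> borel_measurable borel" and "0 < c"
  shows "(LINT x|lborel. f x) = c ^ DIM('a) *\<^sub>R (LINT x|lborel. f (c *\<^sub>R x))"
proof -
  have "(LINT x|lborel. f x) = (LINT x|density (distr lborel borel (\<lambda>x. 0 + c *\<^sub>R x)) (\<lambda>_. ennreal (\<bar>c\<bar> ^ DIM('a))). f x)"
    using lborel_affine[of c "0::'a"] \<open>0 < c\<close> by simp
  also have "\<dots> = (LINT x|distr lborel borel (\<lambda>x. c *\<^sub>R x). c ^ DIM('a) *\<^sub>R f x)"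
    using \<open>0 < c\<close> by (subst integral_density) auto
  also have "\<dots> = c ^ DIM('a) *\<^sub>R (LINT x|lborel. f (c *\<^sub>R x))"
    by (subst integral_distr) auto
  finally show ?thesis .
qed

definition gauss_weight :: "real \<Rightarrow> 'a::euclidean_space \<Rightarrow> real" where
  "gauss_weight e x = exp (- e * (norm x)\<^sup>2 / 2)"

text \<open>
  The Fourier transform of \<^term>\<open>gauss_weight e\<close>. Its total mass is \<open>(2 \<pi>)\<^sup>d\<close> for every \<open>e\<close>, and
  it concentrates at the origin as \<open>e\<close> tends to \<open>0\<close>.
\<close>

definition gauss_kernel :: "real \<Rightarrow> 'a::euclidean_space \<Rightarrow> real" where
  "gauss_kernel e z = sqrt (2 * pi / e) ^ DIM('a) * gauss_weight (1 / e) z"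

lemma gauss_weight_measurable [measurable]: "gauss_weight e \<in> borel_measurable borel"
  unfolding gauss_weight_def[abs_def] by measurable

lemma gauss_kernel_measurable [measurable]: "gauss_kernel e \<in> borel_measurable borel"
  unfolding gauss_kernel_def[abs_def] by measurable

lemma gauss_weight_nonneg [simp]: "0 \<le> gauss_weight e x"
  by (simp add: gauss_weight_def)

lemma gauss_kernel_nonneg [simp]: "0 < e \<Longrightarrow> 0 \<le> gauss_kernel e x"
  by (simp add: gauss_kernel_def)

lemma gauss_weight_le_1: "0 < e \<Longrightarrow> gauss_weight e x \<le> 1"
  by (simp add: gauss_weight_def)

text \<open>
  Up to the dilation \<open>x = sqrt e * s\<close> this is the characteristic function of the standard normal
  distribution.
\<close>

lemma gaussian_fourier_1d:
  assumes e: "0 < e"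
  shows "integrable lborel (\<lambda>s::real. complex_of_real (exp (- e * s\<^sup>2 / 2)) * exp (\<i> * complex_of_real (a * s)))"
    and "(LINT s|lborel. complex_of_real (exp (- e * s\<^sup>2 / 2)) * exp (\<i> * complex_of_real (a * s)))
      = complex_of_real (sqrt (2 * pi / e) * exp (- a\<^sup>2 / (2 * e)))"
proof -
  define g where "g x = std_normal_density x *\<^sub>R exp (\<i> * complex_of_real (a / sqrt e * x))" for x :: real
  have gm [measurable]: "g \<in> borel_measurable borel" unfolding g_def[abs_def] by measurable
  have gi: "integrable lborel g"
    by (rule Bochner_Integration.integrable_bound[of _ std_normal_density])
      (auto simp: g_def normal_density_nonneg)
  have "(LINT x|lborel. g x) = char std_normal_distribution (a / sqrt e)"
    unfolding char_def g_def by (subst integral_density) (auto simp: normal_density_nonneg)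
  also have "\<dots> = complex_of_real (exp (- a\<^sup>2 / (2 * e)))"
    using e by (simp add: char_std_normal_distribution power_divide)
  finally have gI: "(LINT x|lborel. g x) = complex_of_real (exp (- a\<^sup>2 / (2 * e)))" .
  have gs: "complex_of_real (exp (- e * s\<^sup>2 / 2)) * exp (\<i> * complex_of_real (a * s))
      = complex_of_real (sqrt (2 * pi)) * g (0 + sqrt e * s)" for s
    using e by (simp add: g_def normal_density_def scaleR_conv_of_real power_mult_distrib)
  have gi2: "integrable lborel (\<lambda>s. g (0 + sqrt e * s))"
    using gi e lborel_integrable_real_affine_iff[of "sqrt e" g 0] by simp
  then show "integrable lborel (\<lambda>s::real. complex_of_real (exp (- e * s\<^sup>2 / 2)) * exp (\<i> * complex_of_real (a * s)))"
    unfolding gs by (intro integrable_mult_right)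
  have "(LINT x|lborel. g x) = sqrt e *\<^sub>R (LINT s|lborel. g (0 + sqrt e * s))"
    using lborel_integral_real_affine[of "sqrt e" g 0] e by simp
  then have "(LINT s|lborel. g (0 + sqrt e * s)) = complex_of_real (exp (- a\<^sup>2 / (2 * e)) / sqrt e)"
    using gI e by (simp add: scaleR_conv_of_real field_simps)
  then show "(LINT s|lborel. complex_of_real (exp (- e * s\<^sup>2 / 2)) * exp (\<i> * complex_of_real (a * s)))
      = complex_of_real (sqrt (2 * pi / e) * exp (- a\<^sup>2 / (2 * e)))"
    unfolding gs by (simp add: real_sqrt_divide)
qed

lemma
  fixes z :: "'a::euclidean_space"
  assumes e: "0 < e"
  shows gauss_weight_integrable: "integrable lborel (gauss_weight e :: 'a \<Rightarrow> real)"
    and gauss_weight_fourier: "(LINT x|lborel. complex_of_real (gauss_weight e x) * exp (\<i> * complex_of_real (z \<bullet> x)))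
       = complex_of_real (gauss_kernel e z)"
proof -
  have nrm: "(norm x)\<^sup>2 = (\<Sum>b\<in>Basis. (x \<bullet> b)\<^sup>2)" for x :: 'a
    unfolding power2_norm_eq_inner by (subst euclidean_inner) (simp add: power2_eq_square)
  have gw: "gauss_weight d x = (\<Prod>b\<in>Basis. exp (- d * (x \<bullet> b)\<^sup>2 / 2))" for d and x :: 'a
    unfolding gauss_weight_def nrm
    by (subst exp_sum [symmetric]) (auto simp: sum_distrib_left sum_divide_distrib)
  have ew: "exp (\<i> * complex_of_real (z \<bullet> x)) = (\<Prod>b\<in>Basis. exp (\<i> * complex_of_real ((z \<bullet> b) * (x \<bullet> b))))" for z x :: 'a
    by (subst euclidean_inner, subst exp_sum [symmetric]) (auto simp: sum_distrib_left)
  have eq: "complex_of_real (gauss_weight e x) * exp (\<i> * complex_of_real (z \<bullet> x)) =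
     (\<Prod>b\<in>Basis. complex_of_real (exp (- e * (x \<bullet> b)\<^sup>2 / 2)) * exp (\<i> * complex_of_real ((z \<bullet> b) * (x \<bullet> b))))" for z x :: 'a
    unfolding ew gw prod.distrib of_real_prod ..
  note G = integral_lborel_prod[of "\<lambda>b s. complex_of_real (exp (- e * s\<^sup>2 / 2)) * exp (\<i> * complex_of_real ((z \<bullet> b) * s))" for z :: 'a,
      OF gaussian_fourier_1d(1)[OF e]]
  have "integrable lborel (\<lambda>x::'a. complex_of_real (gauss_weight e x) * exp (\<i> * complex_of_real (0 \<bullet> x)))"
    unfolding eq by (rule G(1))
  then show "integrable lborel (gauss_weight e :: 'a \<Rightarrow> real)"
    by (simp add: complex_of_real_integrable_eq)
  have "(LINT x|lborel. complex_of_real (gauss_weight e x) * exp (\<i> * complex_of_real (z \<bullet> x))) =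
      (\<Prod>b\<in>Basis. complex_of_real (sqrt (2 * pi / e) * exp (- (z \<bullet> b)\<^sup>2 / (2 * e))))"
    unfolding eq G(2) gaussian_fourier_1d(2)[OF e] ..
  also have "\<dots> = complex_of_real (gauss_kernel e z)"
    unfolding gauss_kernel_def gw of_real_mult of_real_prod of_real_power prod.distrib prod_constant
    by (simp add: field_simps)
  finally show "(LINT x|lborel. complex_of_real (gauss_weight e x) * exp (\<i> * complex_of_real (z \<bullet> x)))
       = complex_of_real (gauss_kernel e z)" .
qed

lemma gauss_weight_integral:
  assumes "0 < e"
  shows "(LINT x|lborel. gauss_weight e (x::'a::euclidean_space)) = sqrt (2 * pi / e) ^ DIM('a)"
proof -
  have "complex_of_real (LINT x|lborel. gauss_weight e (x::'a)) = complex_of_real (gauss_kernel e (0::'a))"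
    using gauss_weight_fourier[OF assms, of "0::'a"] by simp
  then have "(LINT x|lborel. gauss_weight e (x::'a)) = gauss_kernel e (0::'a)"
    by (simp only: of_real_eq_iff)
  then show ?thesis by (simp add: gauss_kernel_def gauss_weight_def)
qed

lemma
  assumes "0 < e"
  shows gauss_kernel_integrable: "integrable lborel (gauss_kernel e :: 'a::euclidean_space \<Rightarrow> real)"
    and gauss_kernel_integral: "(LINT x|lborel. gauss_kernel e (x::'a)) = (2 * pi) ^ DIM('a)"
proof -
  show "integrable lborel (gauss_kernel e :: 'a \<Rightarrow> real)"
    unfolding gauss_kernel_def[abs_def] using assms by (intro integrable_mult_right gauss_weight_integrable) auto
  have "sqrt (2 * pi / e) * sqrt (2 * pi * e) = 2 * pi"
    using assms real_sqrt_abs[of "2 * pi"]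
    by (simp add: power2_eq_square del: real_sqrt_abs flip: real_sqrt_mult)
  then have "(sqrt (2 * pi / e) * sqrt (2 * pi * e)) ^ DIM('a) = (2 * pi) ^ DIM('a)"
    by (rule arg_cong)
  then show "(LINT x|lborel. gauss_kernel e (x::'a)) = (2 * pi) ^ DIM('a)"
    unfolding gauss_kernel_def using gauss_weight_integral[of "1/e", where 'a='a] assms
    by (simp only: integral_mult_right_zero power_mult_distrib) simp
qed

section \<open>Square-integrable functions\<close>

lemma L2_measurable [measurable_dest]: "f \<in> L2 \<Longrightarrow> f \<in> borel_measurable borel"
  by (simp add: L2_def)

lemma L2_integrable_square: "f \<in> L2 \<Longrightarrow> integrable lborel (\<lambda>x. (norm (f x))\<^sup>2)"
  by (simp add: L2_def)

lemma L2_norm_nonneg [simp]: "0 \<le> L2_norm f"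
  by (simp add: L2_norm_def)

lemma L2_norm_square: "(L2_norm f)\<^sup>2 = (LINT x|lborel. (norm (f x))\<^sup>2)"
  by (simp add: L2_norm_def)

lemma L2_dominated:
  fixes f :: "real ^ 'n \<Rightarrow> complex"
  assumes "g \<in> L2" "f \<in> borel_measurable borel" "AE x in lborel. norm (f x) \<le> C * norm (g x)" "0 \<le> C"
  shows "f \<in> L2" "L2_norm f \<le> C * L2_norm g"
proof -
  have le: "AE x in lborel. (norm (f x))\<^sup>2 \<le> C\<^sup>2 * (norm (g x))\<^sup>2"
    using assms(3)
  proof eventually_elim
    case (elim x)
    show ?case using power_mono[OF elim, of 2] by (simp add: power_mult_distrib)
  qed
  have "integrable lborel (\<lambda>x. (norm (f x))\<^sup>2)"
    by (rule Bochner_Integration.integrable_bound[OF integrable_mult_right[OF L2_integrable_square[OF assms(1)], of "C\<^sup>2"]])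
      (use le assms(2) in \<open>auto simp: abs_mult\<close>)
  then show f: "f \<in> L2" using assms(2) by (simp add: L2_def)
  have "(LINT x|lborel. (norm (f x))\<^sup>2) \<le> (LINT x|lborel. C\<^sup>2 * (norm (g x))\<^sup>2)"
    by (intro integral_mono_AE L2_integrable_square integrable_mult_right f assms(1) le)
  then have "(L2_norm f)\<^sup>2 \<le> (C * L2_norm g)\<^sup>2"
    by (simp add: L2_norm_square power_mult_distrib)
  then show "L2_norm f \<le> C * L2_norm g"
    by (rule power2_le_imp_le) (simp add: assms(4))
qed

lemma L2_mult_bounded:
  assumes "f \<in> L2" "m \<in> borel_measurable borel" "\<And>x. norm (m x) \<le> C"
  shows "(\<lambda>x. m x * f x) \<in> L2" "L2_norm (\<lambda>x. m x * f x) \<le> C * L2_norm f"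
proof -
  have C: "0 \<le> C" using norm_ge_zero assms(3) by (rule order_trans)
  have 1: "AE x in lborel. norm (m x * f x) \<le> C * norm (f x)"
    by (auto simp: norm_mult intro!: mult_right_mono assms)
  have 2: "(\<lambda>x. m x * f x) \<in> borel_measurable borel"
    using assms by measurable
  show "(\<lambda>x. m x * f x) \<in> L2" "L2_norm (\<lambda>x. m x * f x) \<le> C * L2_norm f"
    by (rule L2_dominated[OF assms(1) 2 1 C])+
qed

lemma L2_scale: "f \<in> L2 \<Longrightarrow> (\<lambda>x. c * f x) \<in> L2"
  by (rule L2_mult_bounded(1)[where C="norm c"]) auto

lemma L2_norm_scale: "L2_norm (\<lambda>x. c * f x) = norm c * L2_norm f"
  by (simp add: L2_norm_def norm_mult power_mult_distrib real_sqrt_mult)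

lemma L2_cnj:
  assumes "f \<in> L2"
  shows "(\<lambda>x. cnj (f x)) \<in> L2"
proof -
  have "(\<lambda>x. cnj (f x)) \<in> borel_measurable borel"
    by (rule borel_measurable_continuous_on[OF _ L2_measurable[OF assms]]) (intro continuous_intros)
  then show ?thesis by (rule L2_dominated(1)[OF assms, where C=1]) auto
qed

lemma L2_norm_mult_integrable:
  assumes "f \<in> L2" "g \<in> L2"
  shows "integrable lborel (\<lambda>x. norm (f x) * norm (g x))"
proof (rule Bochner_Integration.integrable_bound)
  show "integrable lborel (\<lambda>x. (norm (f x))\<^sup>2 + (norm (g x))\<^sup>2)"
    using assms by (intro Bochner_Integration.integrable_add L2_integrable_square)
  have "norm (f x) * norm (g x) \<le> (norm (f x))\<^sup>2 + (norm (g x))\<^sup>2" for x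
    using sum_squares_bound[of "norm (f x)" "norm (g x)"] zero_le_power2[of "norm (f x)"] zero_le_power2[of "norm (g x)"]
     mult_nonneg_nonneg[OF norm_ge_zero[of "f x"] norm_ge_zero[of "g x"]] by linarith
  then show "AE x in lborel. norm (norm (f x) * norm (g x)) \<le> norm ((norm (f x))\<^sup>2 + (norm (g x))\<^sup>2)"
    by (auto simp: abs_mult)
qed (use assms in measurable)

lemma L2_mult_integrable:
  assumes "f \<in> L2" "g \<in> L2"
  shows "integrable lborel (\<lambda>x. f x * g x)"
  by (rule Bochner_Integration.integrable_bound[OF L2_norm_mult_integrable[OF assms]])
    (use assms in \<open>auto simp: norm_mult\<close>)

lemma L2_Cauchy_Schwarz:
  assumes "f \<in> L2" "g \<in> L2"
  shows "(LINT x|lborel. norm (f x) * norm (g x)) \<le> L2_norm f * L2_norm g"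
proof -
  define A B P where "A = (LINT x|lborel. (norm (f x))\<^sup>2)" and "B = (LINT x|lborel. (norm (g x))\<^sup>2)"
    and "P = (LINT x|lborel. norm (f x) * norm (g x))"
  have ge0: "0 \<le> A" "0 \<le> B" by (simp_all add: A_def B_def)
  note I = assms[THEN L2_integrable_square] L2_norm_mult_integrable[OF assms]
  have quad: "0 \<le> s\<^sup>2 * A - 2 * s * P + B" for s
  proof -
    have "0 \<le> (LINT x|lborel. (s * norm (f x) - norm (g x))\<^sup>2)" by simp
    also have "\<dots> = (LINT x|lborel. s\<^sup>2 * (norm (f x))\<^sup>2 - (2 * s) * (norm (f x) * norm (g x)) + (norm (g x))\<^sup>2)"
      by (intro Bochner_Integration.integral_cong refl) (simp add: power2_diff power_mult_distrib)
    also have "\<dots> = s\<^sup>2 * A - 2 * s * P + B"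
      unfolding A_def B_def P_def using I
      by (subst Bochner_Integration.integral_add Bochner_Integration.integral_diff; simp)+
    finally show ?thesis .
  qed
  have "P\<^sup>2 \<le> A * B"
  proof (cases "A = 0")
    case True
    \<comment> \<open>The quadratic degenerates to an affine function of \<open>s\<close>, which is bounded below only if its slope vanishes.\<close>
    have "P = 0"
    proof (rule ccontr)
      assume "P \<noteq> 0"
      then show False using quad[of "(B + 1) / (2 * P)"] True by simp
    qed
    then show ?thesis using True by simp
  next
    case False
    then have "A > 0" using ge0 by simp
    then show ?thesis using quad[of "P / A"] by (simp add: power2_eq_square field_simps)
  qed
  then have "P \<le> sqrt (A * B)" by (rule real_le_rsqrt)
  then show ?thesis by (simp add: A_def B_def P_def L2_norm_def real_sqrt_mult)
qed

lemma L2_norm_integral_mult_le: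
  assumes "f \<in> L2" "g \<in> L2"
  shows "norm (LINT x|lborel. f x * g x) \<le> L2_norm f * L2_norm g"
proof -
  have "norm (LINT x|lborel. f x * g x) \<le> (LINT x|lborel. norm (f x * g x))"
    by (rule integral_norm_bound)
  then show ?thesis using L2_Cauchy_Schwarz[OF assms] by (simp add: norm_mult)
qed

lemma
  assumes "f \<in> L2" "g \<in> L2"
  shows L2_add: "(\<lambda>x. f x + g x) \<in> L2"
    and L2_norm_triangle: "L2_norm (\<lambda>x. f x + g x) \<le> L2_norm f + L2_norm g"
proof -
  note I = assms[THEN L2_integrable_square] L2_norm_mult_integrable[OF assms]
  let ?b = "\<lambda>x. (norm (f x))\<^sup>2 + 2 * (norm (f x) * norm (g x)) + (norm (g x))\<^sup>2"
  have Ib: "integrable lborel ?b" using I by auto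
  have le: "(norm (f x + g x))\<^sup>2 \<le> ?b x" for x
    using power_mono[OF norm_triangle_ineq[of "f x" "g x"], of 2] by (simp add: power2_sum algebra_simps)
  have I2: "integrable lborel (\<lambda>x. (norm (f x + g x))\<^sup>2)"
    by (rule Bochner_Integration.integrable_bound[OF Ib])
      (use assms le in \<open>auto intro: order_trans[OF le]\<close>)
  then show "(\<lambda>x. f x + g x) \<in> L2" using assms by (auto simp: L2_def)
  have "(L2_norm (\<lambda>x. f x + g x))\<^sup>2 \<le> (LINT x|lborel. ?b x)"
    unfolding L2_norm_square by (intro integral_mono I2 Ib le)
  also have "\<dots> = (L2_norm f)\<^sup>2 + 2 * (LINT x|lborel. norm (f x) * norm (g x)) + (L2_norm g)\<^sup>2"
    unfolding L2_norm_square using I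
    by (subst Bochner_Integration.integral_add; simp)+
  also have "\<dots> \<le> (L2_norm f + L2_norm g)\<^sup>2"
    using L2_Cauchy_Schwarz[OF assms] by (simp add: power2_sum)
  finally show "L2_norm (\<lambda>x. f x + g x) \<le> L2_norm f + L2_norm g"
    by (rule power2_le_imp_le) simp
qed

lemma L2_diff:
  assumes "f \<in> L2" "g \<in> L2"
  shows "(\<lambda>x. f x - g x) \<in> L2"
  using L2_add[OF assms(1) L2_scale[OF assms(2), of "-1"]] by simp

lemma L2_norm_minus_commute: "L2_norm (\<lambda>x. f x - g x) = L2_norm (\<lambda>x. g x - f x)"
  by (simp add: L2_norm_def norm_minus_commute)

lemma L2_norm_triangle_diff:
  assumes "f \<in> L2" "g \<in> L2" "h \<in> L2"
  shows "L2_norm (\<lambda>x. f x - h x) \<le> L2_norm (\<lambda>x. f x - g x) + L2_norm (\<lambda>x. g x - h x)"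
  using L2_norm_triangle[OF L2_diff[OF assms(1,2)] L2_diff[OF assms(2,3)]] by simp

lemma L2_norm_cong_AE:
  assumes "f \<in> borel_measurable borel" "g \<in> borel_measurable borel" "AE x in lborel. f x = g x"
  shows "L2_norm f = L2_norm g"
  unfolding L2_norm_def using assms
  by (intro arg_cong[where f=sqrt] integral_cong_AE) auto

lemma L2_norm_eq_0_AE:
  assumes "f \<in> L2" "L2_norm f = 0"
  shows "AE x in lborel. f x = 0"
proof -
  have "(LINT x|lborel. (norm (f x))\<^sup>2) = 0" using assms(2) by (simp add: L2_norm_def)
  then show ?thesis
    using integral_nonneg_eq_0_iff_AE[OF L2_integrable_square[OF assms(1)]] by auto
qed

lemma L2_limit_unique:
  assumes "\<And>i. f i \<in> L2" "g \<in> L2" "h \<in> L2" "F \<noteq> bot"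
    and g: "((\<lambda>i. L2_norm (\<lambda>x. f i x - g x)) \<longlongrightarrow> 0) F"
    and h: "((\<lambda>i. L2_norm (\<lambda>x. f i x - h x)) \<longlongrightarrow> 0) F"
  shows "AE x in lborel. g x = h x"
proof -
  have "L2_norm (\<lambda>x. g x - h x) \<le> 0 + 0"
  proof (rule tendsto_lowerbound[OF tendsto_add[OF g h] _ assms(4)])
    show "\<forall>\<^sub>F i in F. L2_norm (\<lambda>x. g x - h x) \<le> L2_norm (\<lambda>x. f i x - g x) + L2_norm (\<lambda>x. f i x - h x)"
      using L2_norm_triangle_diff[OF assms(2) assms(1) assms(3)]
      by (simp add: L2_norm_minus_commute[of g])
  qed
  then have "L2_norm (\<lambda>x. g x - h x) = 0" using L2_norm_nonneg by (intro antisym) auto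
  from L2_norm_eq_0_AE[OF L2_diff[OF assms(2,3)] this] show ?thesis by simp
qed

lemma L2_pairing_tendsto:
  assumes f: "\<And>i. f i \<in> L2" "f' \<in> L2" and g: "g \<in> L2"
    and lim: "((\<lambda>i. L2_norm (\<lambda>x. f i x - f' x)) \<longlongrightarrow> 0) F"
  shows "((\<lambda>i. LINT x|lborel. f i x * g x) \<longlongrightarrow> (LINT x|lborel. f' x * g x)) F"
proof (rule Lim_transform2[OF _ ])
  show "((\<lambda>i. LINT x|lborel. f' x * g x) \<longlongrightarrow> (LINT x|lborel. f' x * g x)) F" by simp
  have "((\<lambda>i. L2_norm (\<lambda>x. f i x - f' x) * L2_norm g) \<longlongrightarrow> 0) F"
    using tendsto_mult_right[OF lim, of "L2_norm g"] by simp
  then have "((\<lambda>i. LINT x|lborel. (f i x - f' x) * g x) \<longlongrightarrow> 0) F"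
    by (rule Lim_null_comparison[rotated]) (auto intro!: always_eventually L2_norm_integral_mult_le L2_diff f g)
  moreover have "(LINT x|lborel. (f i x - f' x) * g x) = (LINT x|lborel. f i x * g x) - (LINT x|lborel. f' x * g x)" for i
    unfolding left_diff_distrib by (intro Bochner_Integration.integral_diff L2_mult_integrable f g)
  ultimately have "((\<lambda>i. (LINT x|lborel. f i x * g x) - (LINT x|lborel. f' x * g x)) \<longlongrightarrow> 0) F" by simp
  from tendsto_minus[OF this]
  show "((\<lambda>i. (LINT x|lborel. f' x * g x) - (LINT x|lborel. f i x * g x)) \<longlongrightarrow> 0) F" by simp
qed

text \<open>
  This is how norm bounds are carried through pointwise limits when convergence in norm is not
  known: in the removal of a Gaussian damping factor, in completeness, and in the removal of
  truncations.
\<close>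

lemma L2_Fatou:
  fixes f :: "nat \<Rightarrow> real ^ 'n \<Rightarrow> complex"
  assumes f: "\<And>k. f k \<in> L2" and [measurable]: "g \<in> borel_measurable borel"
    and bd: "\<And>k. L2_norm (f k) \<le> B"
    and lim: "AE x in lborel. (\<lambda>k. f k x) \<longlonglongrightarrow> g x"
  shows "g \<in> L2" "L2_norm g \<le> B"
proof -
  note [measurable] = f[THEN L2_measurable]
  have B: "0 \<le> B" using L2_norm_nonneg bd by (rule order_trans)
  have 1: "(\<integral>\<^sup>+x. ennreal ((norm (f k x))\<^sup>2) \<partial>lborel) \<le> ennreal (B\<^sup>2)" for k
  proof -
    have "(L2_norm (f k))\<^sup>2 \<le> B\<^sup>2" using bd by (intro power_mono) auto
    then show ?thesis
      by (subst nn_integral_eq_integral) (auto simp: L2_norm_square intro!: L2_integrable_square f ennreal_leI)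
  qed
  have "AE x in lborel. ennreal ((norm (g x))\<^sup>2) = liminf (\<lambda>k. ennreal ((norm (f k x))\<^sup>2))"
    using lim
  proof eventually_elim
    case (elim x)
    have "(\<lambda>k. ennreal ((norm (f k x))\<^sup>2)) \<longlonglongrightarrow> ennreal ((norm (g x))\<^sup>2)"
      by (intro tendsto_ennrealI tendsto_power tendsto_norm elim)
    then show ?case by (rule lim_imp_Liminf[symmetric, rotated]) simp
  qed
  then have "(\<integral>\<^sup>+x. ennreal ((norm (g x))\<^sup>2) \<partial>lborel) = (\<integral>\<^sup>+x. liminf (\<lambda>k. ennreal ((norm (f k x))\<^sup>2)) \<partial>lborel)"
    by (rule nn_integral_cong_AE)
  also have "\<dots> \<le> liminf (\<lambda>k. \<integral>\<^sup>+x. ennreal ((norm (f k x))\<^sup>2) \<partial>lborel)"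
    by (rule nn_integral_liminf) measurable
  also have "\<dots> \<le> limsup (\<lambda>k. \<integral>\<^sup>+x. ennreal ((norm (f k x))\<^sup>2) \<partial>lborel)"
    by (rule Liminf_le_Limsup) simp
  also have "\<dots> \<le> ennreal (B\<^sup>2)"
    by (rule Limsup_bounded) (simp add: 1)
  finally have fin: "(\<integral>\<^sup>+x. ennreal ((norm (g x))\<^sup>2) \<partial>lborel) \<le> ennreal (B\<^sup>2)" .
  then have I: "integrable lborel (\<lambda>x. (norm (g x))\<^sup>2)"
    by (intro integrableI_bounded) (auto intro: order_le_less_trans)
  then show g: "g \<in> L2" by (simp add: L2_def)
  have "(L2_norm g)\<^sup>2 \<le> B\<^sup>2"
    using fin I B by (simp add: nn_integral_eq_integral L2_norm_square)
  then show "L2_norm g \<le> B" using B by (rule power2_le_imp_le)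
qed

text \<open>
  The weight \<open>2\<^sup>k\<close> makes the series of squares dominate the series of increments: at almost
  every point the increments decay geometrically, so the sequence converges there, and Fatou's
  lemma upgrades this to convergence in norm.
\<close>

lemma L2_complete:
  fixes G :: "nat \<Rightarrow> real ^ 'n \<Rightarrow> complex"
  assumes G: "\<And>k. G k \<in> L2" and step: "\<And>k. L2_norm (\<lambda>x. G k x - G (Suc k) x) \<le> C * (1 / 2) ^ k"
  obtains g where "g \<in> L2" "(\<lambda>k. L2_norm (\<lambda>x. G k x - g x)) \<longlonglongrightarrow> 0"
proof -
  note [measurable] = G[THEN L2_measurable]
  define g where "g x = lim (\<lambda>k. G k x)" for x
  have C: "0 \<le> C" using order_trans[OF L2_norm_nonneg step[of 0]] by simp
  have gm [measurable]: "g \<in> borel_measurable borel"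
    unfolding g_def[abs_def] by measurable
  define D where "D k x = 2 ^ k * (norm (G k x - G (Suc k) x))\<^sup>2" for k x
  have Dm [measurable]: "D k \<in> borel_measurable borel" for k
    unfolding D_def[abs_def] by measurable
  have D_int: "(\<integral>\<^sup>+x. ennreal (D k x) \<partial>lborel) \<le> ennreal (C\<^sup>2 * (1 / 2) ^ k)" for k
  proof -
    have "(\<integral>\<^sup>+x. ennreal (D k x) \<partial>lborel) = ennreal (LINT x|lborel. D k x)"
      unfolding D_def by (intro nn_integral_eq_integral integrable_mult_right L2_integrable_square L2_diff G) auto
    also have "(LINT x|lborel. D k x) = 2 ^ k * (L2_norm (\<lambda>x. G k x - G (Suc k) x))\<^sup>2"
      unfolding D_def L2_norm_square by simp
    also have "\<dots> \<le> 2 ^ k * (C * (1 / 2) ^ k)\<^sup>2"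
      using step by (intro mult_left_mono power_mono) auto
    also have "\<dots> = C\<^sup>2 * (1 / 2) ^ k"
      by (simp add: power2_eq_square field_simps)
    finally show ?thesis by (simp add: ennreal_leI)
  qed
  have "(\<integral>\<^sup>+x. (\<Sum>k. ennreal (D k x)) \<partial>lborel) = (\<Sum>k. \<integral>\<^sup>+x. ennreal (D k x) \<partial>lborel)"
    by (rule nn_integral_suminf) measurable
  also have "\<dots> \<le> (\<Sum>k. ennreal (C\<^sup>2 * (1 / 2) ^ k))"
    by (intro suminf_le D_int) auto
  also have "\<dots> < \<infinity>"
    by (subst suminf_ennreal2) (auto intro!: summable_mult summable_geometric)
  finally have "AE x in lborel. (\<Sum>k. ennreal (D k x)) \<noteq> \<infinity>"
    by (intro nn_integral_PInf_AE) auto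
  then have conv: "AE x in lborel. (\<lambda>k. G k x) \<longlonglongrightarrow> g x"
  proof eventually_elim
    case (elim x)
    have D0: "0 \<le> D k x" for k by (simp add: D_def)
    have "summable (\<lambda>k. D k x)"
      using elim by (intro summable_suminf_not_top D0) (auto simp: infinity_ennreal_def)
    then obtain b where b: "\<And>k. norm (D k x) \<le> b"
      using summable_imp_Bseq unfolding Bseq_def by blast
    have geom: "norm (G (Suc k) x - G k x) \<le> sqrt b * (sqrt (1 / 2)) ^ k" for k
    proof -
      have "(norm (G k x - G (Suc k) x))\<^sup>2 \<le> b * (1 / 2) ^ k"
        using b[of k] by (simp add: D_def field_simps)
      then have "norm (G k x - G (Suc k) x) \<le> sqrt (b * (1 / 2) ^ k)"
        by (rule real_le_rsqrt)
      then show ?thesis by (simp add: real_sqrt_mult real_sqrt_power norm_minus_commute)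
    qed
    have "summable (\<lambda>k. G (Suc k) x - G k x)"
    proof (rule summable_comparison_test'[OF _ geom])
      have "norm (sqrt (1 / 2)) < 1" by (simp add: real_sqrt_lt_1_iff)
      then show "summable (\<lambda>k. sqrt b * (sqrt (1 / 2)) ^ k)"
        by (intro summable_mult summable_geometric)
    qed
    then have "convergent (\<lambda>k. G k x)"
      unfolding summable_iff_convergent sum_lessThan_telescope[of "\<lambda>k. G k x"]
      using convergent_diff_const_right_iff[of "\<lambda>k. G k x" "G 0 x"] by simp
    then show ?case by (simp add: g_def convergent_LIMSEQ_iff)
  qed
  \<comment> \<open>The factor \<open>1 - (1/2)\<^sup>m\<close> is the partial geometric sum; it makes the induction close.\<close>
  have tail: "L2_norm (\<lambda>x. G k x - G (k + m) x) \<le> C * 2 * (1 / 2) ^ k * (1 - (1 / 2) ^ m)" for k m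
  proof (induction m)
    case 0
    then show ?case by (simp add: L2_norm_def)
  next
    case (Suc m)
    have "L2_norm (\<lambda>x. G k x - G (k + Suc m) x) \<le>
       L2_norm (\<lambda>x. G k x - G (k + m) x) + L2_norm (\<lambda>x. G (k + m) x - G (Suc (k + m)) x)"
      using L2_norm_triangle_diff[OF G G G] by simp
    also have "\<dots> \<le> C * 2 * (1 / 2) ^ k * (1 - (1 / 2) ^ m) + C * (1 / 2) ^ (k + m)"
      by (intro add_mono Suc step)
    finally show ?case by (simp add: power_add algebra_simps)
  qed
  have tail': "L2_norm (\<lambda>x. G k x - G (k + m) x) \<le> C * 2 * (1 / 2) ^ k" for k m
  proof -
    have "C * 2 * (1 / 2) ^ k * (1 - (1 / 2) ^ m) \<le> C * 2 * (1 / 2) ^ k * 1"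
      using C by (intro mult_left_mono) auto
    then show ?thesis using tail[of k m] by simp
  qed
  have fat: "(\<lambda>x. G k x - g x) \<in> L2 \<and> L2_norm (\<lambda>x. G k x - g x) \<le> C * 2 * (1 / 2) ^ k" for k
  proof -
    have "AE x in lborel. (\<lambda>m. G k x - G (k + m) x) \<longlonglongrightarrow> G k x - g x"
      using conv
    proof eventually_elim
      case (elim x)
      have "(\<lambda>m. G (m + k) x) \<longlonglongrightarrow> g x" using elim by (rule LIMSEQ_ignore_initial_segment)
      then show ?case by (intro tendsto_diff tendsto_const) (simp add: add.commute)
    qed
    then show ?thesis
      using L2_Fatou[of "\<lambda>m x. G k x - G (k + m) x" "\<lambda>x. G k x - g x" "C * 2 * (1 / 2) ^ k"] tail' L2_diff[OF G G]
      by auto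
  qed
  have "g \<in> L2" using L2_diff[OF G[of 0] conjunct1[OF fat[of 0]]] by simp
  moreover have "(\<lambda>k. L2_norm (\<lambda>x. G k x - g x)) \<longlonglongrightarrow> 0"
  proof (rule Lim_null_comparison)
    show "\<forall>\<^sub>F k in sequentially. norm (L2_norm (\<lambda>x. G k x - g x)) \<le> C * 2 * (1 / 2) ^ k"
      using fat by simp
    show "(\<lambda>k. C * 2 * (1 / 2) ^ k) \<longlonglongrightarrow> (0::real)"
      by (intro tendsto_mult_right_zero LIMSEQ_realpow_zero) auto
  qed
  ultimately show ?thesis by (rule that)
qed

lemma truncation_L2: "f \<in> L2 \<Longrightarrow> (\<lambda>x. indicator (cball 0 R) x * f x) \<in> L2"
  by (rule L2_mult_bounded(1)[where C=1]) (auto simp: indicator_def)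

lemma truncation_integrable:
  fixes f :: "real ^ 'n \<Rightarrow> complex"
  assumes "f \<in> L2"
  shows "integrable lborel (\<lambda>x. indicator (cball 0 R) x * f x)"
proof -
  have "integrable lborel (indicator (cball 0 R) :: real ^ 'n \<Rightarrow> real)"
    using emeasure_lborel_cball_finite[of 0 R] by (intro integrable_real_indicator) auto
  moreover have "(norm (indicator (cball 0 R) x :: complex))\<^sup>2 = indicator (cball 0 R) x" for x :: "real ^ 'n"
    by (simp add: indicator_def)
  ultimately have "(indicator (cball 0 R) :: real ^ 'n \<Rightarrow> complex) \<in> L2"
    unfolding L2_def by (simp only: mem_Collect_eq) (intro conjI borel_measurable_indicator; simp)
  from L2_mult_integrable[OF this assms] show ?thesis .
qed

lemma truncation_tendsto:
  fixes f :: "real ^ 'n \<Rightarrow> complex"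
  assumes f: "f \<in> L2"
  shows "((\<lambda>R. L2_norm (\<lambda>x. indicator (cball 0 R) x * f x - f x)) \<longlongrightarrow> 0) at_top"
proof -
  have [measurable]: "(\<lambda>x. indicator (cball 0 R) x * f x - f x) \<in> borel_measurable borel" for R
    using L2_diff[OF truncation_L2[OF f] f] by (rule L2_measurable)
  have "((\<lambda>R. LINT x|lborel. (norm (indicator (cball 0 R) x * f x - f x))\<^sup>2) \<longlongrightarrow> integral\<^sup>L lborel (\<lambda>x::real ^ 'n. 0::real)) at_top"
  proof (rule tendsto_at_topI_sequentially, rule integral_dominated_convergence[where w="\<lambda>x. (norm (f x))\<^sup>2"])
    fix X :: "nat \<Rightarrow> real" assume X: "filterlim X at_top sequentially"
    show "integrable lborel (\<lambda>x. (norm (f x))\<^sup>2)" by (rule L2_integrable_square[OF f])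
    show "AE x in lborel. (\<lambda>k. (norm (indicator (cball 0 (X k)) x * f x - f x))\<^sup>2) \<longlonglongrightarrow> 0"
    proof (intro AE_I2 tendsto_eventually)
      fix x :: "real ^ 'n"
      have "\<forall>\<^sub>F k in sequentially. norm x \<le> X k"
        using X by (simp add: filterlim_at_top)
      then show "\<forall>\<^sub>F k in sequentially. (norm (indicator (cball 0 (X k)) x * f x - f x))\<^sup>2 = 0"
        by eventually_elim (auto simp: indicator_def)
    qed
    show "AE x in lborel. norm ((norm (indicator (cball 0 (X k)) x * f x - f x))\<^sup>2) \<le> (norm (f x))\<^sup>2" for k
      by (intro AE_I2) (auto simp: indicator_def)
  qed auto
  from tendsto_real_sqrt[OF this] show ?thesis by (simp add: L2_norm_def)
qed

section \<open>Plancherel's theorem\<close>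

lemma fourier_integral_measurable [measurable]:
  fixes f :: "real ^ 'n \<Rightarrow> complex"
  assumes [measurable]: "f \<in> borel_measurable borel"
  shows "fourier_integral f \<in> borel_measurable borel"
  unfolding fourier_integral_def[abs_def]
  by (rule lborel.borel_measurable_lebesgue_integral) measurable

lemma norm_exp_i_real [simp]: "norm (exp (- \<i> * complex_of_real t)) = 1" "norm (exp (\<i> * complex_of_real t)) = 1"
  by (simp_all add: norm_exp_eq_Re)

lemma fourier_integrand_integrable:
  fixes f :: "real ^ 'n \<Rightarrow> complex"
  assumes "integrable lborel f"
  shows "integrable lborel (\<lambda>x. f x * exp (- \<i> * complex_of_real (\<xi> \<bullet> x)))"
  by (rule Bochner_Integration.integrable_bound[OF assms])
    (use borel_measurable_integrable[OF assms] in \<open>auto simp: norm_mult\<close>)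

lemma fourier_integral_bound:
  fixes f :: "real ^ 'n \<Rightarrow> complex"
  shows "norm (fourier_integral f \<xi>) \<le> (LINT x|lborel. norm (f x))"
proof -
  have "norm (fourier_integral f \<xi>) \<le> (LINT x|lborel. norm (f x * exp (- \<i> * complex_of_real (\<xi> \<bullet> x))))"
    unfolding fourier_integral_def by (rule integral_norm_bound)
  then show ?thesis by (simp add: norm_mult)
qed

lemma fourier_integral_linear:
  fixes f g :: "real ^ 'n \<Rightarrow> complex"
  assumes "integrable lborel f" "integrable lborel g"
  shows "fourier_integral (\<lambda>x. a * f x + b * g x) \<xi> = a * fourier_integral f \<xi> + b * fourier_integral g \<xi>"
proof -
  have "fourier_integral (\<lambda>x. a * f x + b * g x) \<xi> =
    (LINT x|lborel. a * (f x * exp (- \<i> * complex_of_real (\<xi> \<bullet> x))) + b * (g x * exp (- \<i> * complex_of_real (\<xi> \<bullet> x))))"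
    unfolding fourier_integral_def by (simp add: algebra_simps)
  also have "\<dots> = a * fourier_integral f \<xi> + b * fourier_integral g \<xi>"
    unfolding fourier_integral_def using assms[THEN fourier_integrand_integrable, of \<xi>]
    by (subst Bochner_Integration.integral_add) auto
  finally show ?thesis .
qed

lemma fourier_integral_add:
  fixes f g :: "real ^ 'n \<Rightarrow> complex"
  assumes "integrable lborel f" "integrable lborel g"
  shows "fourier_integral (\<lambda>x. f x + g x) \<xi> = fourier_integral f \<xi> + fourier_integral g \<xi>"
  using fourier_integral_linear[OF assms, of 1 1] by simp

lemma fourier_integral_diff:
  fixes f g :: "real ^ 'n \<Rightarrow> complex"
  assumes "integrable lborel f" "integrable lborel g"
  shows "fourier_integral (\<lambda>x. f x - g x) \<xi> = fourier_integral f \<xi> - fourier_integral g \<xi>"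
  using fourier_integral_linear[OF assms, of 1 "-1"] by simp

lemma fourier_integral_cnj:
  fixes f :: "real ^ 'n \<Rightarrow> complex"
  shows "fourier_integral (\<lambda>x. cnj (f x)) (- \<xi>) = cnj (fourier_integral f \<xi>)"
proof -
  have "(LINT x|lborel. cnj (f x * exp (- \<i> * complex_of_real (\<xi> \<bullet> x)))) = cnj (fourier_integral f \<xi>)"
    unfolding fourier_integral_def by (rule Bochner_Integration.integral_cnj)
  then show ?thesis by (simp add: fourier_integral_def exp_cnj del: Bochner_Integration.integral_cnj)
qed

lemma bounded_times_integrable:
  fixes f h :: "'a \<Rightarrow> complex"
  assumes "integrable M f" "h \<in> borel_measurable M" "\<And>x. norm (h x) \<le> B"
  shows "integrable M (\<lambda>x. h x * f x)"
proof (rule Bochner_Integration.integrable_bound)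
  show "integrable M (\<lambda>x. B *\<^sub>R f x)" using assms(1) by simp
  have "0 \<le> B" using norm_ge_zero assms(3) by (rule order_trans)
  then show "AE x in M. norm (h x * f x) \<le> norm (B *\<^sub>R f x)"
    by (auto simp: norm_mult intro!: mult_right_mono assms(3))
qed (use assms in measurable)

text \<open>
  Fubini's theorem. Since the transform of a Gaussian is explicit, this serves as a substitute for
  an inversion formula.
\<close>

lemma fourier_integral_multiplication:
  fixes f h :: "real ^ 'n \<Rightarrow> complex"
  assumes f: "integrable lborel f" and h: "integrable lborel h"
  shows "(LINT \<xi>|lborel. fourier_integral f \<xi> * h \<xi>) = (LINT x|lborel. f x * fourier_integral h x)"
proof -
  have [measurable]: "f \<in> borel_measurable borel" "h \<in> borel_measurable borel"
    using f h by auto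
  define P where "P \<xi> x = f x * h \<xi> * exp (- \<i> * complex_of_real (\<xi> \<bullet> x))" for \<xi> x
  have Pn: "norm (P \<xi> x) = norm (f x) * norm (h \<xi>)" for \<xi> x
    by (simp add: P_def norm_mult)
  have Pm: "case_prod P \<in> borel_measurable (lborel \<Otimes>\<^sub>M lborel)"
    unfolding P_def[abs_def] by measurable
  have "integrable (lborel \<Otimes>\<^sub>M lborel) (case_prod P)"
  proof (rule lborel_pair.Fubini_integrable[OF Pm])
    show "integrable lborel (\<lambda>\<xi>. LINT x|lborel. norm (case (\<xi>, x) of (\<xi>, x) \<Rightarrow> P \<xi> x))"
      using h by (simp add: Pn)
    show "AE \<xi> in lborel. integrable lborel (\<lambda>x. case (\<xi>, x) of (\<xi>, x) \<Rightarrow> P \<xi> x)"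
    proof (rule AE_I2)
      fix \<xi>
      show "integrable lborel (\<lambda>x. case (\<xi>, x) of (\<xi>, x) \<Rightarrow> P \<xi> x)"
        using integrable_mult_right[OF fourier_integrand_integrable[OF f, of \<xi>], of "h \<xi>"]
        by (simp add: P_def mult.assoc mult.left_commute)
    qed
  qed
  from lborel_pair.Fubini_integral[OF this]
  have "(LINT x|lborel. (LINT \<xi>|lborel. P \<xi> x)) = (LINT \<xi>|lborel. (LINT x|lborel. P \<xi> x))" .
  moreover have "(LINT x|lborel. P \<xi> x) = fourier_integral f \<xi> * h \<xi>" for \<xi>
    unfolding fourier_integral_def P_def
    by (subst integral_mult_left_zero[symmetric]) (simp add: mult.assoc mult.commute mult.left_commute)
  moreover have "(LINT \<xi>|lborel. P \<xi> x) = f x * fourier_integral h x" for x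
    unfolding fourier_integral_def P_def
    by (subst integral_mult_right_zero[symmetric]) (simp add: mult.assoc inner_commute)
  ultimately show ?thesis by simp
qed

text \<open>
  Apply the multiplication formula twice. The Gaussian factor makes the product with the
  transform of \<open>g\<close> integrable, which permits moving the transform off \<open>f\<close>; moving it off \<open>g\<close> in
  turn leaves it on the Gaussian times a phase, which produces the translated kernel.
\<close>

lemma gaussian_parseval:
  fixes f g :: "real ^ 'n \<Rightarrow> complex"
  assumes e: "0 < e" and f: "integrable lborel f" and g: "integrable lborel g"
  shows "(LINT \<xi>|lborel. fourier_integral f \<xi> * (fourier_integral g (- \<xi>) * complex_of_real (gauss_weight e \<xi>)))
    = (LINT x|lborel. f x * (LINT y|lborel. complex_of_real (gauss_kernel e (x - y)) * g y))"
proof -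
  have [measurable]: "f \<in> borel_measurable borel" "g \<in> borel_measurable borel"
    using f g by auto
  have w: "integrable lborel (\<lambda>\<xi>::real ^ 'n. complex_of_real (gauss_weight e \<xi>))"
    using gauss_weight_integrable[OF e] by (rule integrable_of_real)
  define h where "h \<xi> = fourier_integral g (- \<xi>) * complex_of_real (gauss_weight e \<xi>)" for \<xi>
  have h: "integrable lborel h"
    unfolding h_def by (rule bounded_times_integrable[OF w]) (auto intro: fourier_integral_bound)
  have "fourier_integral h x = (LINT y|lborel. complex_of_real (gauss_kernel e (x - y)) * g y)" for x
  proof -
    define v where "v \<xi> = exp (\<i> * complex_of_real (x \<bullet> \<xi>)) * complex_of_real (gauss_weight e \<xi>)" for \<xi>
    have v: "integrable lborel v"
      unfolding v_def by (rule bounded_times_integrable[OF w]) auto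
    have "fourier_integral v y = complex_of_real (gauss_kernel e (x - y))" for y
    proof -
      have "fourier_integral v y =
         (LINT \<xi>|lborel. complex_of_real (gauss_weight e \<xi>) * exp (\<i> * complex_of_real ((x - y) \<bullet> \<xi>)))"
        unfolding fourier_integral_def v_def
        by (intro Bochner_Integration.integral_cong refl)
          (simp add: algebra_simps inner_diff_left flip: exp_add)
      then show ?thesis by (simp add: gauss_weight_fourier[OF e])
    qed
    moreover have "fourier_integral h x = (LINT \<xi>|lborel. fourier_integral g \<xi> * v \<xi>)"
      unfolding fourier_integral_def[of h] h_def
      by (subst lborel_integral_uminus[symmetric])
        (auto simp: v_def gauss_weight_def algebra_simps)
    ultimately show ?thesis
      using fourier_integral_multiplication[OF g v] by (simp add: mult.commute)
  qed
  then show ?thesis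
    using fourier_integral_multiplication[OF f h] by (simp add: h_def)
qed

lemma norm_integral_le_nn_integral:
  fixes f :: "'a \<Rightarrow> 'b::{banach, second_countable_topology}"
  shows "ennreal (norm (integral\<^sup>L M f)) \<le> (\<integral>\<^sup>+x. norm (f x) \<partial>M)"
  by (cases "integrable M f") (simp_all add: integral_norm_bound_ennreal not_integrable_integral_eq)

text \<open>
  Schur's test: replace \<open>|f(x)| |f(y)|\<close> by the mean of the squares, after which one of the two
  integrations only sees the kernel and contributes its mass \<open>(2 \<pi>)\<^sup>n\<close>.
\<close>

lemma gaussian_quadratic_form_bound:
  fixes f :: "real ^ 'n \<Rightarrow> complex"
  assumes e: "0 < e" and f: "f \<in> L2"
  shows "norm (LINT x|lborel. f x * (LINT y|lborel. complex_of_real (gauss_kernel e (x - y)) * cnj (f y)))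
    \<le> (2 * pi) ^ CARD('n) * (L2_norm f)\<^sup>2"
proof -
  have fm [measurable]: "f \<in> borel_measurable borel" using f by (rule L2_measurable)
  define K where "K = (gauss_kernel e :: real ^ 'n \<Rightarrow> real)"
  have Km [measurable]: "K \<in> borel_measurable borel" unfolding K_def by measurable
  have K0: "0 \<le> K z" for z unfolding K_def using e by simp
  define c :: real where "c = (2 * pi) ^ CARD('n)"
  define A where "A = (LINT x|lborel. (norm (f x))\<^sup>2)"
  have c0: "0 \<le> c" and A0: "0 \<le> A" by (simp_all add: c_def A_def)
  have Kn: "(\<integral>\<^sup>+y. ennreal (K y) \<partial>lborel) = ennreal c"
    using nn_integral_eq_integral[OF gauss_kernel_integrable[OF e, where 'a="real ^ 'n"]]
      gauss_kernel_integral[OF e, where 'a="real ^ 'n"] e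
    by (simp add: K_def c_def)
  have Kx: "(\<integral>\<^sup>+y. ennreal (K (x - y)) \<partial>lborel) = ennreal c" for x
    using nn_integral_distr[of "\<lambda>y. x - y" lborel borel "\<lambda>y. ennreal (K y)"] Kn
    by (simp add: lborel_reflect_eq)
  have Ky: "(\<integral>\<^sup>+x. ennreal (K (x - y)) \<partial>lborel) = ennreal c" for y
    using nn_integral_distr[of "\<lambda>x. x + (- y)" lborel borel "\<lambda>y. ennreal (K y)"] Kn
    unfolding lborel_translate_eq by simp
  have Kxs: "(\<integral>\<^sup>+y. ennreal (K (x - y) * s\<^sup>2 / 2) \<partial>lborel) = ennreal c * ennreal (s\<^sup>2 / 2)" for x s
    unfolding Kx[of x, symmetric]
    by (subst nn_integral_multc[symmetric]) (auto intro!: nn_integral_cong simp: ennreal_mult''[symmetric])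
  have Kys: "(\<integral>\<^sup>+x. ennreal (K (x - y) * s\<^sup>2 / 2) \<partial>lborel) = ennreal c * ennreal (s\<^sup>2 / 2)" for y s
    unfolding Ky[of y, symmetric]
    by (subst nn_integral_multc[symmetric]) (auto intro!: nn_integral_cong simp: ennreal_mult''[symmetric])
  have fA: "(\<integral>\<^sup>+x. ennreal ((norm (f x))\<^sup>2 / 2) \<partial>lborel) = ennreal (A / 2)"
    by (subst nn_integral_eq_integral) (auto simp: A_def intro!: L2_integrable_square f)
  define Q where "Q = (LINT x|lborel. f x * (LINT y|lborel. complex_of_real (K (x - y)) * cnj (f y)))"
  have "ennreal (norm Q) \<le> (\<integral>\<^sup>+x. norm (f x * (LINT y|lborel. complex_of_real (K (x - y)) * cnj (f y))) \<partial>lborel)"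
    unfolding Q_def by (rule norm_integral_le_nn_integral)
  also have "\<dots> \<le> (\<integral>\<^sup>+x. \<integral>\<^sup>+y. ennreal (K (x - y) * (norm (f x))\<^sup>2 / 2) + ennreal (K (x - y) * (norm (f y))\<^sup>2 / 2) \<partial>lborel \<partial>lborel)"
  proof (rule nn_integral_mono)
    fix x
    have "ennreal (norm (f x * (LINT y|lborel. complex_of_real (K (x - y)) * cnj (f y))))
      \<le> ennreal (norm (f x)) * (\<integral>\<^sup>+y. norm (complex_of_real (K (x - y)) * cnj (f y)) \<partial>lborel)"
      unfolding norm_mult[of "f x"] ennreal_mult'[OF norm_ge_zero]
      by (intro mult_left_mono norm_integral_le_nn_integral) auto
    also have "\<dots> = (\<integral>\<^sup>+y. ennreal (norm (f x)) * norm (complex_of_real (K (x - y)) * cnj (f y)) \<partial>lborel)"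
      by (rule nn_integral_cmult[symmetric]) (simp add: norm_mult)
    also have "\<dots> \<le> (\<integral>\<^sup>+y. ennreal (K (x - y) * (norm (f x))\<^sup>2 / 2) + ennreal (K (x - y) * (norm (f y))\<^sup>2 / 2) \<partial>lborel)"
    proof (rule nn_integral_mono)
      fix y
      have "K (x - y) * (2 * norm (f x) * norm (f y)) \<le> K (x - y) * ((norm (f x))\<^sup>2 + (norm (f y))\<^sup>2)"
        by (intro mult_left_mono K0 sum_squares_bound)
      then have "norm (f x) * (K (x - y) * norm (f y)) \<le> K (x - y) * (norm (f x))\<^sup>2 / 2 + K (x - y) * (norm (f y))\<^sup>2 / 2"
        by (simp add: algebra_simps)
      then show "ennreal (norm (f x)) * ennreal (norm (complex_of_real (K (x - y)) * cnj (f y)))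
         \<le> ennreal (K (x - y) * (norm (f x))\<^sup>2 / 2) + ennreal (K (x - y) * (norm (f y))\<^sup>2 / 2)"
        using K0[of "x - y"]
        by (simp add: norm_mult ennreal_mult'[symmetric] ennreal_plus[symmetric] ennreal_leI del: ennreal_plus)
    qed
    finally show "ennreal (norm (f x * (LINT y|lborel. complex_of_real (K (x - y)) * cnj (f y))))
      \<le> (\<integral>\<^sup>+y. ennreal (K (x - y) * (norm (f x))\<^sup>2 / 2) + ennreal (K (x - y) * (norm (f y))\<^sup>2 / 2) \<partial>lborel)" .
  qed
  also have "\<dots> = (\<integral>\<^sup>+x. \<integral>\<^sup>+y. ennreal (K (x - y) * (norm (f x))\<^sup>2 / 2) \<partial>lborel \<partial>lborel)
     + (\<integral>\<^sup>+x. \<integral>\<^sup>+y. ennreal (K (x - y) * (norm (f y))\<^sup>2 / 2) \<partial>lborel \<partial>lborel)"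
    by (subst nn_integral_add[symmetric]) (auto intro!: nn_integral_cong nn_integral_add)
  also have "(\<integral>\<^sup>+x. \<integral>\<^sup>+y. ennreal (K (x - y) * (norm (f x))\<^sup>2 / 2) \<partial>lborel \<partial>lborel)
    = (\<integral>\<^sup>+x. ennreal c * ennreal ((norm (f x))\<^sup>2 / 2) \<partial>lborel)"
    by (simp add: Kxs)
  also have "\<dots> = ennreal (c * (A / 2))"
    by (subst nn_integral_cmult) (simp, simp only: fA ennreal_mult'[OF c0])
  also have "(\<integral>\<^sup>+x. \<integral>\<^sup>+y. ennreal (K (x - y) * (norm (f y))\<^sup>2 / 2) \<partial>lborel \<partial>lborel)
     = (\<integral>\<^sup>+y. \<integral>\<^sup>+x. ennreal (K (x - y) * (norm (f y))\<^sup>2 / 2) \<partial>lborel \<partial>lborel)"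
    by (rule lborel_pair.Fubini'[symmetric]) measurable
  also have "\<dots> = (\<integral>\<^sup>+y. ennreal c * ennreal ((norm (f y))\<^sup>2 / 2) \<partial>lborel)"
    by (simp add: Kys)
  also have "\<dots> = ennreal (c * (A / 2))"
    by (subst nn_integral_cmult) (simp, simp only: fA ennreal_mult'[OF c0])
  also have "ennreal (c * (A / 2)) + ennreal (c * (A / 2)) = ennreal (c * A)"
    using c0 A0 by (subst ennreal_plus[symmetric]) auto
  finally have "norm Q \<le> c * A" using c0 A0 by simp
  then show ?thesis by (simp add: Q_def K_def c_def A_def L2_norm_square)
qed

text \<open>
  With \<open>g = cnj f\<close> the damped Parseval identity computes the norm of the transform times a
  Gaussian, and Schur's test bounds it uniformly in the damping; Fatou's lemma removes the damping.
\<close>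

lemma plancherel_upper_L1_L2:
  fixes f :: "real ^ 'n \<Rightarrow> complex"
  assumes f: "f \<in> L2" and fi: "integrable lborel f"
  shows "fourier_integral f \<in> L2" "L2_norm (fourier_integral f) \<le> sqrt ((2 * pi) ^ CARD('n)) * L2_norm f"
proof -
  have [measurable]: "f \<in> borel_measurable borel" using f by (rule L2_measurable)
  define e where "e k = inverse (real (Suc k))" for k
  have e0: "0 < e k" for k by (simp add: e_def)
  have el: "e \<longlonglongrightarrow> 0" unfolding e_def[abs_def] by (rule LIMSEQ_inverse_real_of_nat)
  define F where "F = fourier_integral f"
  have Fm [measurable]: "F \<in> borel_measurable borel" unfolding F_def by measurable
  define g where "g k \<xi> = complex_of_real (gauss_weight (e k) \<xi>) * F \<xi>" for k \<xi>
  have gm [measurable]: "g k \<in> borel_measurable borel" for k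
    unfolding g_def[abs_def] by measurable
  \<comment> \<open>Squaring \<open>g k\<close> doubles the Gaussian parameter, which is why \<open>2 * e k\<close> appears below.\<close>
  have sq: "(norm (g k \<xi>))\<^sup>2 = (norm (F \<xi>))\<^sup>2 * gauss_weight (2 * e k) \<xi>" for k \<xi>
    by (simp add: g_def norm_mult power_mult_distrib gauss_weight_def flip: exp_double)
  have Fb: "norm (F \<xi>) \<le> (LINT x|lborel. norm (f x))" for \<xi>
    unfolding F_def by (rule fourier_integral_bound)
  have int: "integrable lborel (\<lambda>\<xi>. (norm (g k \<xi>))\<^sup>2)" for k
  proof (rule Bochner_Integration.integrable_bound)
    show "integrable lborel (\<lambda>\<xi>::real ^ 'n. (LINT x|lborel. norm (f x))\<^sup>2 * gauss_weight (2 * e k) \<xi>)"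
      using e0 by (intro integrable_mult_right gauss_weight_integrable) auto
    show "AE \<xi> in lborel. norm ((norm (g k \<xi>))\<^sup>2) \<le> norm ((LINT x|lborel. norm (f x))\<^sup>2 * gauss_weight (2 * e k) \<xi>)"
      unfolding sq by (auto simp: abs_mult intro!: mult_right_mono power_mono Fb)
  qed measurable
  have gL: "g k \<in> L2" for k
    using int gm by (simp add: L2_def)
  have gb: "L2_norm (g k) \<le> sqrt ((2 * pi) ^ CARD('n)) * L2_norm f" for k
  proof -
    have "complex_of_real (LINT \<xi>|lborel. (norm (g k \<xi>))\<^sup>2)
      = (LINT \<xi>|lborel. F \<xi> * (fourier_integral (\<lambda>x. cnj (f x)) (- \<xi>) * complex_of_real (gauss_weight (2 * e k) \<xi>)))"
      unfolding sq fourier_integral_cnj F_def[symmetric] integral_complex_of_real[symmetric]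
      by (intro Bochner_Integration.integral_cong refl)
        (simp only: of_real_mult complex_norm_square mult.assoc)
    also have "\<dots> = (LINT x|lborel. f x * (LINT y|lborel. complex_of_real (gauss_kernel (2 * e k) (x - y)) * cnj (f y)))"
      unfolding F_def using e0 fi by (intro gaussian_parseval) auto
    finally have "norm (complex_of_real (LINT \<xi>|lborel. (norm (g k \<xi>))\<^sup>2)) \<le> (2 * pi) ^ CARD('n) * (L2_norm f)\<^sup>2"
      using gaussian_quadratic_form_bound[of "2 * e k" f] e0[of k] f by simp
    then have "(L2_norm (g k))\<^sup>2 \<le> (2 * pi) ^ CARD('n) * (L2_norm f)\<^sup>2"
      by (simp add: L2_norm_square)
    then have "(L2_norm (g k))\<^sup>2 \<le> (sqrt ((2 * pi) ^ CARD('n)) * L2_norm f)\<^sup>2"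
      by (simp add: power_mult_distrib)
    then show ?thesis by (rule power2_le_imp_le) simp
  qed
  have "(\<lambda>k. g k \<xi>) \<longlonglongrightarrow> F \<xi>" for \<xi>
  proof -
    have "(\<lambda>k. complex_of_real (exp (- e k * (norm \<xi>)\<^sup>2 / 2)) * F \<xi>) \<longlonglongrightarrow> complex_of_real (exp (- 0 * (norm \<xi>)\<^sup>2 / 2)) * F \<xi>"
      by (intro tendsto_intros el) auto
    then show ?thesis by (simp add: g_def gauss_weight_def)
  qed
  then have lim: "AE \<xi> in lborel. (\<lambda>k. g k \<xi>) \<longlonglongrightarrow> F \<xi>" by simp
  show "fourier_integral f \<in> L2" "L2_norm (fourier_integral f) \<le> sqrt ((2 * pi) ^ CARD('n)) * L2_norm f"
    using L2_Fatou[OF gL Fm gb lim] by (simp_all add: F_def)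
qed


lemma L2_uminus:
  fixes f :: "real ^ 'n \<Rightarrow> complex"
  assumes "f \<in> L2"
  shows "(\<lambda>x. f (- x)) \<in> L2"
  using L2_measurable[OF assms] lborel_integrable_uminus[of "\<lambda>x. (norm (f x))\<^sup>2"] L2_integrable_square[OF assms]
  by (simp add: L2_def)

lemma bounded_integrable_L2:
  fixes f :: "real ^ 'n \<Rightarrow> complex"
  assumes "integrable lborel f" "\<And>x. norm (f x) \<le> B"
  shows "f \<in> L2"
proof -
  have [measurable]: "f \<in> borel_measurable borel" using assms(1) by auto
  have "integrable lborel (\<lambda>x. cnj (f x) * f x)"
    using assms borel_measurable_integrable[OF integrable_cnj[OF assms(1)]]
    by (intro bounded_times_integrable[where B=B]) auto
  then have "integrable lborel (\<lambda>x. norm (cnj (f x) * f x))" by (rule integrable_norm)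
  then show ?thesis by (simp add: L2_def norm_mult power2_eq_square)
qed

text \<open>
  After the dilation \<open>x - y = sqrt e * z\<close> the kernel no longer depends on \<open>e\<close>, so continuity of \<open>g\<close>
  and dominated convergence give the limit.
\<close>

lemma gaussian_convolution_tendsto:
  fixes g :: "real ^ 'n \<Rightarrow> complex"
  assumes g: "continuous_on UNIV g" "\<And>x. norm (g x) \<le> B"
    and e: "\<And>k. 0 < e k" "e \<longlonglongrightarrow> 0"
  shows "(\<lambda>k::nat. LINT y|lborel. complex_of_real (gauss_kernel (e k) (x - y)) * g y) \<longlonglongrightarrow> (2 * pi) ^ CARD('n) * g x"
    and "norm (LINT y|lborel. complex_of_real (gauss_kernel (e k) (x - y)) * g y) \<le> (2 * pi) ^ CARD('n) * B"
proof -
  have [measurable]: "g \<in> borel_measurable borel" using g(1) by (rule borel_measurable_continuous_onI)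
  define K where "K = (gauss_kernel 1 :: real ^ 'n \<Rightarrow> real)"
  have [measurable]: "K \<in> borel_measurable borel" unfolding K_def by measurable
  have K0: "0 \<le> K z" for z by (simp add: K_def)
  have Ki: "integrable lborel K" unfolding K_def by (rule gauss_kernel_integrable) simp
  have KI: "(LINT z|lborel. K z) = (2 * pi) ^ CARD('n)"
    using gauss_kernel_integral[of 1, where 'a="real ^ 'n"] by (simp add: K_def)
  have eq: "(LINT y|lborel. complex_of_real (gauss_kernel d (x - y)) * g y)
    = (LINT z|lborel. complex_of_real (K z) * g (x - sqrt d *\<^sub>R z))" if d: "0 < d" for d
  proof -
    have sc: "sqrt d ^ CARD('n) * gauss_kernel d (sqrt d *\<^sub>R z) = K z" for z :: "real ^ 'n"
      using d by (simp add: K_def gauss_kernel_def gauss_weight_def power_mult_distrib real_sqrt_divide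
          power_divide)
    have "(LINT y|lborel. complex_of_real (gauss_kernel d (x - y)) * g y)
      = (LINT z|lborel. complex_of_real (gauss_kernel d z) * g (x - z))"
      by (subst lborel_integral_reflect[of _ x, symmetric]) auto
    also have "\<dots> = sqrt d ^ CARD('n) *\<^sub>R (LINT z|lborel. complex_of_real (gauss_kernel d (sqrt d *\<^sub>R z)) * g (x - sqrt d *\<^sub>R z))"
      using d by (subst lborel_integral_scale[of _ "sqrt d"]) auto
    also have "\<dots> = (LINT z|lborel. complex_of_real (sqrt d ^ CARD('n) * gauss_kernel d (sqrt d *\<^sub>R z)) * g (x - sqrt d *\<^sub>R z))"
      by (simp add: scaleR_conv_of_real mult.assoc flip: integral_mult_right_zero)
    finally show ?thesis unfolding sc .
  qed
  have bd: "norm (complex_of_real (K z) * g (x - c *\<^sub>R z)) \<le> K z * B" for z c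
    using K0[of z] g(2) by (simp add: norm_mult mult_left_mono)
  have KB: "integrable lborel (\<lambda>z. K z * B)" using Ki by simp
  have "(\<lambda>k. LINT z|lborel. complex_of_real (K z) * g (x - sqrt (e k) *\<^sub>R z)) \<longlonglongrightarrow> (LINT z|lborel. complex_of_real (K z) * g x)"
  proof (rule integral_dominated_convergence[where w="\<lambda>z. K z * B"])
    show "AE z in lborel. (\<lambda>k. complex_of_real (K z) * g (x - sqrt (e k) *\<^sub>R z)) \<longlonglongrightarrow> complex_of_real (K z) * g x"
    proof (intro AE_I2 tendsto_mult tendsto_const)
      fix z
      have "(\<lambda>k. x - sqrt (e k) *\<^sub>R z) \<longlonglongrightarrow> x - sqrt 0 *\<^sub>R z"
        by (intro tendsto_intros e(2))
      then show "(\<lambda>k. g (x - sqrt (e k) *\<^sub>R z)) \<longlonglongrightarrow> g x"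
        using g(1) by (intro continuous_on_tendsto_compose[of UNIV g]) auto
    qed
  qed (use KB bd in auto)
  also have "(LINT z|lborel. complex_of_real (K z) * g x) = (2 * pi) ^ CARD('n) * g x"
    by (simp only: integral_mult_left_zero integral_complex_of_real KI)
  finally show "(\<lambda>k::nat. LINT y|lborel. complex_of_real (gauss_kernel (e k) (x - y)) * g y) \<longlonglongrightarrow> (2 * pi) ^ CARD('n) * g x"
    using e(1) by (simp add: eq)
  have "norm (LINT z|lborel. complex_of_real (K z) * g (x - sqrt (e k) *\<^sub>R z)) \<le> (LINT z|lborel. K z * B)"
    by (rule order_trans[OF integral_norm_bound integral_mono'[OF KB bd]]) (rule order_trans[OF norm_ge_zero bd])
  then show "norm (LINT y|lborel. complex_of_real (gauss_kernel (e k) (x - y)) * g y) \<le> (2 * pi) ^ CARD('n) * B"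
    using e(1) KI by (simp add: eq)
qed

text \<open>
  Let the damping tend to zero in the damped Parseval identity: the frequency side is dominated because
  both transforms are square-integrable by the upper bound, the space side because the
  convolutions of the bounded function \<open>g\<close> are uniformly bounded and \<open>f\<close> is integrable.
\<close>

lemma parseval_L1_L2:
  fixes f g :: "real ^ 'n \<Rightarrow> complex"
  assumes f: "f \<in> L2" "integrable lborel f"
    and g: "continuous_on UNIV g" "\<And>x. norm (g x) \<le> B" "integrable lborel g"
  shows "(LINT \<xi>|lborel. fourier_integral f \<xi> * fourier_integral g (- \<xi>)) = (2 * pi) ^ CARD('n) * (LINT x|lborel. f x * g x)"
proof -
  have [measurable]: "f \<in> borel_measurable borel" "g \<in> borel_measurable borel" using f g by auto
  have gL: "g \<in> L2" by (rule bounded_integrable_L2[OF g(3,2)])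
  define e where "e k = inverse (real (Suc k))" for k
  have e0: "0 < e k" for k by (simp add: e_def)
  have el: "e \<longlonglongrightarrow> 0" unfolding e_def[abs_def] by (rule LIMSEQ_inverse_real_of_nat)
  define P where "P \<xi> = fourier_integral f \<xi> * fourier_integral g (- \<xi>)" for \<xi>
  have Pi: "integrable lborel P"
    unfolding P_def
    by (intro L2_mult_integrable L2_uminus plancherel_upper_L1_L2 f gL g(3))
  then have [measurable]: "P \<in> borel_measurable borel" by auto
  define J where "J k x = (LINT y|lborel. complex_of_real (gauss_kernel (e k) (x - y)) * g y)" for k x
  have Jm [measurable]: "J k \<in> borel_measurable borel" for k
    unfolding J_def[abs_def] by (rule lborel.borel_measurable_lebesgue_integral) measurable
  have "(\<lambda>k. LINT \<xi>|lborel. P \<xi> * complex_of_real (gauss_weight (e k) \<xi>)) \<longlonglongrightarrow> (LINT \<xi>|lborel. P \<xi>)"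
  proof (rule integral_dominated_convergence[where w="\<lambda>\<xi>. norm (P \<xi>)"])
    show "AE \<xi> in lborel. (\<lambda>k. P \<xi> * complex_of_real (gauss_weight (e k) \<xi>)) \<longlonglongrightarrow> P \<xi>"
    proof (rule AE_I2)
      fix \<xi> :: "real ^ 'n"
      have "(\<lambda>k. P \<xi> * complex_of_real (exp (- e k * (norm \<xi>)\<^sup>2 / 2))) \<longlonglongrightarrow> P \<xi> * complex_of_real (exp (- 0 * (norm \<xi>)\<^sup>2 / 2))"
        by (intro tendsto_intros el) auto
      then show "(\<lambda>k. P \<xi> * complex_of_real (gauss_weight (e k) \<xi>)) \<longlonglongrightarrow> P \<xi>" by (simp add: gauss_weight_def)
    qed
    show "AE \<xi> in lborel. norm (P \<xi> * complex_of_real (gauss_weight (e k) \<xi>)) \<le> norm (P \<xi>)" for k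
      by (intro AE_I2) (simp add: norm_mult mult_left_le gauss_weight_le_1[OF e0])
  qed (use Pi in auto)
  moreover have "(LINT \<xi>|lborel. P \<xi> * complex_of_real (gauss_weight (e k) \<xi>)) = (LINT x|lborel. f x * J k x)" for k
    using gaussian_parseval[OF e0 f(2) g(3), of k] by (simp add: P_def J_def mult.assoc)
  moreover have "(\<lambda>k. LINT x|lborel. f x * J k x) \<longlonglongrightarrow> (LINT x|lborel. f x * ((2 * pi) ^ CARD('n) * g x))"
  proof (rule integral_dominated_convergence[where w="\<lambda>x. norm (f x) * ((2 * pi) ^ CARD('n) * B)"])
    show "AE x in lborel. (\<lambda>k. f x * J k x) \<longlonglongrightarrow> f x * ((2 * pi) ^ CARD('n) * g x)"
      unfolding J_def using gaussian_convolution_tendsto(1)[OF g(1,2) e0 el]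
      by (intro AE_I2 tendsto_mult tendsto_const)
    show "AE x in lborel. norm (f x * J k x) \<le> norm (f x) * ((2 * pi) ^ CARD('n) * B)" for k
      unfolding J_def norm_mult
      by (intro AE_I2 mult_left_mono gaussian_convolution_tendsto(2)[OF g(1,2) e0 el]) auto
  qed (use f in auto)
  ultimately have "(LINT \<xi>|lborel. P \<xi>) = (LINT x|lborel. f x * ((2 * pi) ^ CARD('n) * g x))"
    using LIMSEQ_unique by simp
  also have "\<dots> = (LINT x|lborel. (2 * pi) ^ CARD('n) * (f x * g x))"
    by (simp add: algebra_simps)
  finally show ?thesis by (simp add: P_def)
qed


lemma truncated_fourier_contraction:
  fixes f g :: "real ^ 'n \<Rightarrow> complex"
  assumes "f \<in> L2" "integrable lborel f" "g \<in> L2" "integrable lborel g"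
  shows "L2_norm (\<lambda>\<xi>. fourier_integral f \<xi> - fourier_integral g \<xi>)
    \<le> sqrt ((2 * pi) ^ CARD('n)) * L2_norm (\<lambda>x. f x - g x)"
proof -
  have "(\<lambda>\<xi>. fourier_integral f \<xi> - fourier_integral g \<xi>) = fourier_integral (\<lambda>x. f x - g x)"
    using fourier_integral_linear[OF assms(2,4), of 1 "-1"] by auto
  then show ?thesis
    using plancherel_upper_L1_L2(2)[OF L2_diff[OF assms(1,3)]] assms(2,4) by simp
qed

text \<open>
  The truncations converge in \<open>L\<^sup>2\<close> and the transform is Lipschitz on \<open>L\<^sup>1 \<inter> L\<^sup>2\<close>, so the truncated
  transforms form a Cauchy family. Completeness is applied to a sequence of radii along which the
  increments are geometrically small.
\<close>

lemma fourier_exists: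
  fixes f :: "real ^ 'n \<Rightarrow> complex"
  assumes f: "f \<in> L2"
  shows "\<exists>g. g \<in> L2 \<and>
     ((\<lambda>R. L2_norm (\<lambda>\<xi>. fourier_integral (\<lambda>x. indicator (cball 0 R) x * f x) \<xi> - g \<xi>)) \<longlongrightarrow> 0) at_top"
proof -
  define c where "c = sqrt ((2 * pi) ^ CARD('n))"
  have c0: "0 < c" by (simp add: c_def)
  define T where "T R x = indicator (cball 0 R) x * f x" for R x
  define D where "D R = L2_norm (\<lambda>x. T R x - f x)" for R
  have T: "T R \<in> L2" "integrable lborel (T R)" for R
    unfolding T_def[abs_def] by (rule truncation_L2[OF f], rule truncation_integrable[OF f])
  have FT: "fourier_integral (T R) \<in> L2" for R using T by (rule plancherel_upper_L1_L2)
  have D: "(D \<longlongrightarrow> 0) at_top" unfolding D_def[abs_def] T_def by (rule truncation_tendsto[OF f])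
  have diff: "L2_norm (\<lambda>\<xi>. fourier_integral (T R) \<xi> - fourier_integral (T S) \<xi>) \<le> c * (D R + D S)" for R S
  proof -
    have "L2_norm (\<lambda>x. T R x - T S x) \<le> D R + D S"
      using L2_norm_triangle_diff[OF T(1) f T(1), of R S] L2_norm_minus_commute[of f "T S"] by (simp add: D_def)
    then have "c * L2_norm (\<lambda>x. T R x - T S x) \<le> c * (D R + D S)" using c0 by simp
    with truncated_fourier_contraction[OF T T, of R S, folded c_def] show ?thesis by (rule order_trans)
  qed
  have "\<exists>r. \<forall>R\<ge>r. D R < (1 / 2) ^ k" for k :: nat
    using order_tendstoD(2)[OF D, of "(1 / 2) ^ k"] by (simp add: eventually_at_top_linorder)
  then obtain r where r: "\<And>k R. R \<ge> r k \<Longrightarrow> D R < (1 / 2) ^ k" by metis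
  define G where "G k = fourier_integral (T (r k))" for k
  have G: "G k \<in> L2" for k unfolding G_def by (rule FT)
  have step: "L2_norm (\<lambda>\<xi>. G k \<xi> - G (Suc k) \<xi>) \<le> (c * 2) * (1 / 2) ^ k" for k
  proof -
    have "(1 / 2) ^ Suc k \<le> (1 / 2 :: real) ^ k" by (rule power_decreasing) auto
    then have "D (r k) + D (r (Suc k)) \<le> 2 * (1 / 2) ^ k"
      using r[of k, OF order_refl] r[of "Suc k", OF order_refl] by linarith
    then have "c * (D (r k) + D (r (Suc k))) \<le> c * (2 * (1 / 2) ^ k)" using c0 by (intro mult_left_mono) auto
    then show ?thesis using diff[of "r k" "r (Suc k)"] by (simp add: G_def)
  qed
  obtain g where g: "g \<in> L2" and lim: "(\<lambda>k. L2_norm (\<lambda>x. G k x - g x)) \<longlonglongrightarrow> 0"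
    by (rule L2_complete[OF G step])
  have "((\<lambda>R. L2_norm (\<lambda>\<xi>. fourier_integral (T R) \<xi> - g \<xi>)) \<longlongrightarrow> 0) at_top"
  proof (rule tendstoI)
    fix d :: real assume d: "0 < d"
    have "(\<lambda>k. c * (2 * (1 / 2) ^ k) + L2_norm (\<lambda>x. G k x - g x)) \<longlonglongrightarrow> c * (2 * 0) + 0"
      by (intro tendsto_intros lim LIMSEQ_realpow_zero) auto
    then have "\<forall>\<^sub>F k in sequentially. c * (2 * (1 / 2) ^ k) + L2_norm (\<lambda>x. G k x - g x) < d"
      using d by (auto dest!: order_tendstoD(2))
    then obtain k where k: "c * (2 * (1 / 2) ^ k) + L2_norm (\<lambda>x. G k x - g x) < d"
      by (auto simp: eventually_sequentially)
    show "\<forall>\<^sub>F R in at_top. dist (L2_norm (\<lambda>\<xi>. fourier_integral (T R) \<xi> - g \<xi>)) 0 < d"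
      using eventually_ge_at_top[of "r k"]
    proof eventually_elim
      case (elim R)
      have "D R + D (r k) \<le> 2 * (1 / 2) ^ k" using r[OF elim] r[of k "r k"] by simp
      then have "c * (D R + D (r k)) \<le> c * (2 * (1 / 2) ^ k)" using c0 by (intro mult_left_mono) auto
      then show ?case
        using L2_norm_triangle_diff[OF FT[of R] G[of k] g] diff[of R "r k"] k by (simp add: G_def)
    qed
  qed
  then show ?thesis using g unfolding T_def by blast
qed

lemma
  fixes f :: "real ^ 'n \<Rightarrow> complex"
  assumes f: "f \<in> L2"
  shows fourier_L2: "fourier f \<in> L2"
    and fourier_limit: "((\<lambda>R. L2_norm (\<lambda>\<xi>. fourier_integral (\<lambda>x. indicator (cball 0 R) x * f x) \<xi> - fourier f \<xi>)) \<longlongrightarrow> 0) at_top"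
  using someI_ex[OF fourier_exists[OF f]] unfolding fourier_def by auto

lemma fourier_truncation_L2: "f \<in> L2 \<Longrightarrow> fourier_integral (\<lambda>x. indicator (cball 0 R) x * f x) \<in> L2"
  by (intro plancherel_upper_L1_L2 truncation_L2 truncation_integrable)

lemma fourier_eqI_AE:
  fixes f :: "real ^ 'n \<Rightarrow> complex"
  assumes f: "f \<in> L2" and g: "g \<in> L2"
    and "((\<lambda>R. L2_norm (\<lambda>\<xi>. fourier_integral (\<lambda>x. indicator (cball 0 R) x * f x) \<xi> - g \<xi>)) \<longlongrightarrow> 0) at_top"
  shows "AE \<xi> in lborel. fourier f \<xi> = g \<xi>"
  by (rule L2_limit_unique[OF fourier_truncation_L2[OF f] fourier_L2[OF f] g _ fourier_limit[OF f] assms(3)]) simp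

lemma fourier_eq_fourier_integral:
  fixes f :: "real ^ 'n \<Rightarrow> complex"
  assumes f: "f \<in> L2" "integrable lborel f"
  shows "AE \<xi> in lborel. fourier f \<xi> = fourier_integral f \<xi>"
proof (rule fourier_eqI_AE[OF f(1) plancherel_upper_L1_L2(1)[OF f]])
  show "((\<lambda>R. L2_norm (\<lambda>\<xi>. fourier_integral (\<lambda>x. indicator (cball 0 R) x * f x) \<xi> - fourier_integral f \<xi>)) \<longlongrightarrow> 0) at_top"
  proof (rule Lim_null_comparison)
    show "((\<lambda>R. sqrt ((2 * pi) ^ CARD('n)) * L2_norm (\<lambda>x. indicator (cball 0 R) x * f x - f x)) \<longlongrightarrow> 0) at_top"
      using tendsto_mult_left[OF truncation_tendsto[OF f(1)]] by fastforce
    show "\<forall>\<^sub>F R in at_top. norm (L2_norm (\<lambda>\<xi>. fourier_integral (\<lambda>x. indicator (cball 0 R) x * f x) \<xi> - fourier_integral f \<xi>))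
      \<le> sqrt ((2 * pi) ^ CARD('n)) * L2_norm (\<lambda>x. indicator (cball 0 R) x * f x - f x)"
      using truncated_fourier_contraction[OF truncation_L2[OF f(1)] truncation_integrable[OF f(1)] f]
      by (intro always_eventually allI) simp
  qed
qed

lemma fourier_linear:
  fixes f g :: "real ^ 'n \<Rightarrow> complex"
  assumes f: "f \<in> L2" and g: "g \<in> L2"
  shows "AE \<xi> in lborel. fourier (\<lambda>x. a * f x + b * g x) \<xi> = a * fourier f \<xi> + b * fourier g \<xi>"
proof (rule fourier_eqI_AE)
  show fg: "(\<lambda>x. a * f x + b * g x) \<in> L2" by (intro L2_add L2_scale f g)
  show "(\<lambda>\<xi>. a * fourier f \<xi> + b * fourier g \<xi>) \<in> L2" by (intro L2_add L2_scale fourier_L2 f g)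
  define A where "A R \<xi> = fourier_integral (\<lambda>x. indicator (cball 0 R) x * f x) \<xi> - fourier f \<xi>" for R \<xi>
  define B where "B R \<xi> = fourier_integral (\<lambda>x. indicator (cball 0 R) x * g x) \<xi> - fourier g \<xi>" for R \<xi>
  have AL: "A R \<in> L2" and BL: "B R \<in> L2" for R
    unfolding A_def[abs_def] B_def[abs_def] by (intro L2_diff fourier_truncation_L2 fourier_L2 f g)+
  have eq: "fourier_integral (\<lambda>x. indicator (cball 0 R) x * (a * f x + b * g x)) \<xi> - (a * fourier f \<xi> + b * fourier g \<xi>)
     = a * A R \<xi> + b * B R \<xi>" for R \<xi>
  proof -
    have "(\<lambda>x. indicator (cball 0 R) x * (a * f x + b * g x)) =
       (\<lambda>x. a * (indicator (cball 0 R) x * f x) + b * (indicator (cball 0 R) x * g x))"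
      by (simp add: algebra_simps)
    then show ?thesis
      by (simp only: fourier_integral_linear[OF truncation_integrable[OF f] truncation_integrable[OF g]])
        (simp add: A_def B_def algebra_simps)
  qed
  show "((\<lambda>R. L2_norm (\<lambda>\<xi>. fourier_integral (\<lambda>x. indicator (cball 0 R) x * (a * f x + b * g x)) \<xi>
      - (a * fourier f \<xi> + b * fourier g \<xi>))) \<longlongrightarrow> 0) at_top"
    unfolding eq
  proof (rule Lim_null_comparison)
    show "\<forall>\<^sub>F R in at_top. norm (L2_norm (\<lambda>\<xi>. a * A R \<xi> + b * B R \<xi>)) \<le> norm a * L2_norm (A R) + norm b * L2_norm (B R)"
      using L2_norm_triangle[OF L2_scale[OF AL] L2_scale[OF BL]]
      by (intro always_eventually allI) (simp add: L2_norm_scale)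
    have "((\<lambda>R. norm a * L2_norm (A R) + norm b * L2_norm (B R)) \<longlongrightarrow> norm a * 0 + norm b * 0) at_top"
      unfolding A_def B_def by (intro tendsto_intros fourier_limit f g)
    then show "((\<lambda>R. norm a * L2_norm (A R) + norm b * L2_norm (B R)) \<longlongrightarrow> 0) at_top" by simp
  qed
qed

lemma fourier_cong_AE:
  fixes f g :: "real ^ 'n \<Rightarrow> complex"
  assumes [measurable]: "f \<in> borel_measurable borel" "g \<in> borel_measurable borel"
    and "AE x in lborel. f x = g x"
  shows "fourier f = fourier g"
proof -
  have "fourier_integral (\<lambda>x. indicator (cball 0 R) x * f x) = fourier_integral (\<lambda>x. indicator (cball 0 R) x * g x)" for R
    unfolding fourier_integral_def using assms(3)
    by (intro ext integral_cong_AE) (auto intro!: borel_measurable_times borel_measurable_indicator)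
  then show ?thesis unfolding fourier_def by simp
qed

lemma parseval:
  fixes f g :: "real ^ 'n \<Rightarrow> complex"
  assumes f: "f \<in> L2" and g: "continuous_on UNIV g" "\<And>x. norm (g x) \<le> B" "integrable lborel g"
  shows "(LINT \<xi>|lborel. fourier f \<xi> * fourier_integral g (- \<xi>)) = (2 * pi) ^ CARD('n) * (LINT x|lborel. f x * g x)"
proof -
  define T where "T R x = indicator (cball 0 R) x * f x" for R x
  have T: "T R \<in> L2" "integrable lborel (T R)" for R
    unfolding T_def[abs_def] by (rule truncation_L2[OF f], rule truncation_integrable[OF f])
  have gL: "g \<in> L2" by (rule bounded_integrable_L2[OF g(3,2)])
  have "((\<lambda>R. LINT \<xi>|lborel. fourier_integral (T R) \<xi> * fourier_integral g (- \<xi>)) \<longlongrightarrow>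
      (LINT \<xi>|lborel. fourier f \<xi> * fourier_integral g (- \<xi>))) at_top"
    unfolding T_def
    by (intro L2_pairing_tendsto fourier_truncation_L2 fourier_limit fourier_L2 L2_uminus plancherel_upper_L1_L2 f gL g)
  moreover have "((\<lambda>R. (2 * pi) ^ CARD('n) * (LINT x|lborel. T R x * g x)) \<longlongrightarrow> (2 * pi) ^ CARD('n) * (LINT x|lborel. f x * g x)) at_top"
    by (intro tendsto_mult_left L2_pairing_tendsto T f gL) (simp add: T_def truncation_tendsto f)
  ultimately show ?thesis
    unfolding parseval_L1_L2[OF T g] by (intro tendsto_unique[OF trivial_limit_at_top_linorder])
qed

text \<open>
  Measurability alone provides continuous functions converging almost everywhere. Clipping their
  values to modulus \<open>M\<close> and multiplying with a tent that equals \<open>1\<close> on the ball of radius \<open>M\<close>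
  changes nothing in the limit and makes the sequence dominated.
\<close>

lemma bounded_measurable_approximation:
  fixes h :: "real ^ 'n \<Rightarrow> complex"
  assumes [measurable]: "h \<in> borel_measurable borel" and M: "0 < M"
    and h: "\<And>x. norm (h x) \<le> M" "\<And>x. norm x > M \<Longrightarrow> h x = 0"
  obtains g :: "nat \<Rightarrow> real ^ 'n \<Rightarrow> complex" where
    "\<And>k. continuous_on UNIV (g k)" "\<And>k x. norm (g k x) \<le> M * indicator (cball 0 (M + 1)) x"
    "AE x in lborel. (\<lambda>k. g k x) \<longlonglongrightarrow> h x"
proof -
  have "h \<in> borel_measurable lebesgue" by (rule measurable_completion) simp
  then have "h measurable_on UNIV"
    using lebesgue_measurable_imp_measurable_on[of h UNIV] by simp
  then obtain N g where N: "negligible N" and gc: "\<And>k. continuous_on UNIV (g k)"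
    and gl: "\<And>x. x \<notin> N \<Longrightarrow> (\<lambda>k. g k x) \<longlonglongrightarrow> h x"
    unfolding measurable_on_def by auto
  define cut where "cut x = max 0 (min 1 (M + 1 - norm x))" for x :: "real ^ 'n"
  define G where "G k x = complex_of_real (cut x * (M / max M (norm (g k x)))) * g k x" for k x
  have nz: "max M r \<noteq> 0" for r using M by (simp add: max_def)
  have "continuous_on UNIV (G k)" for k
    unfolding G_def[abs_def] cut_def by (intro continuous_intros gc) (use nz in auto)
  moreover have "norm (G k x) \<le> M * indicator (cball 0 (M + 1)) x" for k x
  proof -
    have cut1: "0 \<le> cut x" "cut x \<le> indicator (cball 0 (M + 1)) x" by (auto simp: cut_def indicator_def)
    have "norm (g k x) / max M (norm (g k x)) \<le> 1" using M by (simp add: divide_le_eq)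
    then have "norm (g k x) / max M (norm (g k x)) * M \<le> 1 * M"
      using M by (intro mult_right_mono) auto
    then have "cut x * (norm (g k x) / max M (norm (g k x)) * M) \<le> indicator (cball 0 (M + 1)) x * M"
      using cut1 M by (intro mult_mono) auto
    then show ?thesis using cut1 M
      by (simp add: G_def norm_mult norm_divide abs_mult mult_ac)
  qed
  moreover have "AE x in lborel. (\<lambda>k. G k x) \<longlonglongrightarrow> h x"
  proof -
    have "AE x in lebesgue. x \<notin> N" using N
      by (auto simp: negligible_iff_null_sets intro: AE_not_in)
    then have "AE x in lborel. x \<notin> N" by (simp add: AE_completion_iff)
    then show ?thesis
    proof eventually_elim
      case (elim x)
      have "(\<lambda>k. G k x) \<longlonglongrightarrow> complex_of_real (cut x * (M / max M (norm (h x)))) * h x"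
        unfolding G_def by (intro tendsto_intros gl elim nz)
      moreover have "complex_of_real (cut x * (M / max M (norm (h x)))) * h x = h x"
      proof (cases "norm x > M")
        case False
        then show ?thesis using h(1)[of x] M by (simp add: cut_def max_def min_def)
      qed (simp add: h(2))
      ultimately show ?case by simp
    qed
  qed
  ultimately show ?thesis by (rule that)
qed

lemma L2_norm_uminus:
  fixes f :: "real ^ 'n \<Rightarrow> complex"
  assumes "f \<in> L2"
  shows "L2_norm (\<lambda>x. f (- x)) = L2_norm f"
  using L2_measurable[OF assms] lborel_integral_uminus[of "\<lambda>x. (norm (f x))\<^sup>2"] by (simp add: L2_norm_def)

text \<open>
  Duality: pairing \<open>f\<close> with a function close to the conjugate of a bounded truncation \<open>T m\<close> of
  \<open>f\<close> gives nearly the square of the norm of \<open>T m\<close>, while Parseval's identity and the upper bound control the same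
  pairing, up to powers of \<open>2 \<pi>\<close>, by the norm of \<open>fourier f\<close> times the norm of \<open>T m\<close>.
  Parseval's identity applies to continuous functions on the other side, hence the approximation.
\<close>

lemma plancherel_lower:
  fixes f :: "real ^ 'n \<Rightarrow> complex"
  assumes f: "f \<in> L2"
  shows "sqrt ((2 * pi) ^ CARD('n)) * L2_norm f \<le> L2_norm (fourier f)"
proof -
  define c where "c = sqrt ((2 * pi) ^ CARD('n))"
  have c0: "0 < c" and c2: "c\<^sup>2 = (2 * pi) ^ CARD('n)" by (simp_all add: c_def)
  have [measurable]: "f \<in> borel_measurable borel" using f by (rule L2_measurable)
  define T where "T m x = (if norm x \<le> real (Suc m) \<and> norm (f x) \<le> real (Suc m) then f x else 0)" for m x
  have Tm [measurable]: "T m \<in> borel_measurable borel" for m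
    unfolding T_def[abs_def] by measurable
  have TL: "T m \<in> L2" for m
    by (rule L2_dominated(1)[OF f Tm, of _ 1]) (auto simp: T_def)
  have main: "c * L2_norm (T m) \<le> L2_norm (fourier f)" for m
  proof -
    define M where "M = real (Suc m)"
    have M: "0 < M" by (simp add: M_def)
    have cT [measurable]: "(\<lambda>x. cnj (T m x)) \<in> borel_measurable borel"
      by (rule L2_measurable[OF L2_cnj[OF TL]])
    obtain g where gc: "\<And>k. continuous_on UNIV (g k)"
      and gb: "\<And>k x. norm (g k x) \<le> M * indicator (cball 0 (M + 1)) x"
      and gl: "AE x in lborel. (\<lambda>k. g k x) \<longlonglongrightarrow> cnj (T m x)"
      by (rule bounded_measurable_approximation[OF cT M]) (auto simp: T_def M_def)
    have gm [measurable]: "g k \<in> borel_measurable borel" for k using gc by (rule borel_measurable_continuous_onI)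
    have ball: "integrable lborel (indicator (cball 0 (M + 1)) :: real ^ 'n \<Rightarrow> real)"
      using emeasure_lborel_cball_finite[of 0 "M + 1"] by (intro integrable_real_indicator) auto
    have gi: "integrable lborel (g k)" for k
      by (rule Bochner_Integration.integrable_bound[OF integrable_mult_right[OF ball, of M]]) (use gb M in \<open>auto intro: order_trans\<close>)
    have gb': "norm (g k x) \<le> M" for k x
      using gb[of k x] M by (cases "norm x \<le> M + 1") (auto simp: indicator_def)
    have gL: "g k \<in> L2" for k by (rule bounded_integrable_L2[OF gi gb'])
    have ballL: "(\<lambda>x::real ^ 'n. complex_of_real (M * indicator (cball 0 (M + 1)) x)) \<in> L2"
    proof (rule bounded_integrable_L2[where B=M])
      show "integrable lborel (\<lambda>x::real ^ 'n. complex_of_real (M * indicator (cball 0 (M + 1)) x))"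
        unfolding complex_of_real_integrable_eq using ball by (rule integrable_mult_right)
      show "norm (complex_of_real (M * indicator (cball 0 (M + 1)) x)) \<le> M" for x :: "real ^ 'n"
        using M by (simp add: norm_mult indicator_def)
    qed
    have bound: "c\<^sup>2 * norm (LINT x|lborel. f x * g k x) \<le> L2_norm (fourier f) * (c * L2_norm (g k))" for k
    proof -
      have F: "(\<lambda>\<xi>. fourier_integral (g k) (- \<xi>)) \<in> L2"
        by (intro L2_uminus plancherel_upper_L1_L2 gL gi)
      have "c\<^sup>2 * norm (LINT x|lborel. f x * g k x) = norm (LINT \<xi>|lborel. fourier f \<xi> * fourier_integral (g k) (- \<xi>))"
        unfolding parseval[OF f gc gb' gi] c2 by (simp add: norm_mult norm_power)
      also have "\<dots> \<le> L2_norm (fourier f) * L2_norm (\<lambda>\<xi>. fourier_integral (g k) (- \<xi>))"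
        by (rule L2_norm_integral_mult_le[OF fourier_L2[OF f] F])
      also have "\<dots> \<le> L2_norm (fourier f) * (c * L2_norm (g k))"
        using plancherel_upper_L1_L2[OF gL gi] by (intro mult_left_mono) (auto simp: c_def L2_norm_uminus)
      finally show ?thesis .
    qed
    have "(\<lambda>k. LINT x|lborel. f x * g k x) \<longlonglongrightarrow> (LINT x|lborel. f x * cnj (T m x))"
    proof (rule integral_dominated_convergence[where w="\<lambda>x. norm (f x) * norm (complex_of_real (M * indicator (cball 0 (M + 1)) x))"])
      show "integrable lborel (\<lambda>x. norm (f x) * norm (complex_of_real (M * indicator (cball 0 (M + 1)) x)))"
        by (rule L2_norm_mult_integrable[OF f ballL])
      show "AE x in lborel. (\<lambda>k. f x * g k x) \<longlonglongrightarrow> f x * cnj (T m x)"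
        using gl by eventually_elim (intro tendsto_intros)
      show "AE x in lborel. norm (f x * g k x) \<le> norm (f x) * norm (complex_of_real (M * indicator (cball 0 (M + 1)) x))" for k
        using gb M by (intro AE_I2) (auto simp: norm_mult abs_mult intro!: mult_left_mono)
    qed measurable
    also have "(LINT x|lborel. f x * cnj (T m x)) = (LINT x|lborel. complex_of_real ((norm (T m x))\<^sup>2))"
      by (intro Bochner_Integration.integral_cong refl) (auto simp: T_def complex_norm_square simp del: of_real_power)
    also have "\<dots> = complex_of_real ((L2_norm (T m))\<^sup>2)" by (simp only: integral_complex_of_real L2_norm_square)
    finally have "(\<lambda>k. norm (LINT x|lborel. f x * g k x)) \<longlonglongrightarrow> norm (complex_of_real ((L2_norm (T m))\<^sup>2))"
      by (rule tendsto_norm)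
    then have l1: "(\<lambda>k. norm (LINT x|lborel. f x * g k x)) \<longlonglongrightarrow> (L2_norm (T m))\<^sup>2"
      by (simp only: norm_of_real abs_power2)
    have "(\<lambda>k. LINT x|lborel. (norm (g k x))\<^sup>2) \<longlonglongrightarrow> (LINT x|lborel. (norm (T m x))\<^sup>2)"
    proof (rule integral_dominated_convergence[where w="\<lambda>x. (norm (complex_of_real (M * indicator (cball 0 (M + 1)) x)))\<^sup>2"])
      show "AE x in lborel. (\<lambda>k. (norm (g k x))\<^sup>2) \<longlonglongrightarrow> (norm (T m x))\<^sup>2"
        using gl
      proof eventually_elim
        case (elim x)
        show ?case using tendsto_power[OF tendsto_norm[OF elim], of 2] by simp
      qed
      show "AE x in lborel. norm ((norm (g k x))\<^sup>2) \<le> (norm (complex_of_real (M * indicator (cball 0 (M + 1)) x)))\<^sup>2" for k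
        using gb M by (intro AE_I2) (auto simp: norm_mult abs_mult intro!: power_mono)
    qed (use ballL[THEN L2_integrable_square] in auto)
    from tendsto_real_sqrt[OF this] have l2: "(\<lambda>k. L2_norm (g k)) \<longlonglongrightarrow> L2_norm (T m)"
      by (simp add: L2_norm_def)
    have "c\<^sup>2 * (L2_norm (T m))\<^sup>2 \<le> L2_norm (fourier f) * (c * L2_norm (T m))"
      by (rule LIMSEQ_le[OF tendsto_mult_left[OF l1] tendsto_mult_left[OF tendsto_mult_left[OF l2]]]) (use bound in auto)
    then have "(c * L2_norm (T m)) * (c * L2_norm (T m)) \<le> L2_norm (fourier f) * (c * L2_norm (T m))"
      by (simp add: power2_eq_square mult_ac)
    then show ?thesis
      using c0 by (cases "L2_norm (T m) = 0") (auto simp: mult_le_cancel_right zero_less_mult_iff less_le)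
  qed
  have "L2_norm f \<le> L2_norm (fourier f) / c"
  proof (rule L2_Fatou(2)[OF TL])
    show "L2_norm (T m) \<le> L2_norm (fourier f) / c" for m using main[of m] c0 by (simp add: field_simps)
    show "AE x in lborel. (\<lambda>m. T m x) \<longlonglongrightarrow> f x"
    proof (intro AE_I2 tendsto_eventually)
      fix x
      have "\<forall>\<^sub>F m in sequentially. m \<ge> nat \<lceil>max (norm x) (norm (f x))\<rceil>" by (rule eventually_ge_at_top)
      then show "\<forall>\<^sub>F m in sequentially. T m x = f x"
      proof eventually_elim
        case (elim m)
        then have "max (norm x) (norm (f x)) \<le> real (Suc m)" by linarith
        then show ?case by (simp add: T_def)
      qed
    qed
  qed measurable
  then show ?thesis using c0 by (simp add: c_def field_simps)
qed

section \<open>Test functions\<close>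

lemma partial_deriv_eqI: "(f has_derivative f') (at x) \<Longrightarrow> partial_deriv i f x = f' (axis i 1)"
  unfolding partial_deriv_def using frechet_derivative_at by metis

lemma Ck_SucI:
  assumes "\<And>x. (f has_derivative f' x) (at x)" "\<And>i. Ck k (\<lambda>x. f' x (axis i 1))"
  shows "Ck (Suc k) f"
proof -
  have "partial_deriv i f = (\<lambda>x. f' x (axis i 1))" for i
    using partial_deriv_eqI[OF assms(1)] by auto
  then show ?thesis using assms by (auto simp: differentiable_on_def differentiable_def intro: has_derivative_at_withinI)
qed

lemma Ck_has_derivative:
  assumes "Ck (Suc k) f"
  shows "(f has_derivative frechet_derivative f (at x)) (at x)"
  using assms by (simp add: differentiable_on_def frechet_derivative_works)

lemma Ck_mono: "Ck (Suc k) f \<Longrightarrow> Ck k f"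
proof (induction k arbitrary: f)
  case 0
  then show ?case by (auto intro: differentiable_imp_continuous_on)
qed simp

lemma Ck_const: "Ck k (\<lambda>x :: real ^ 'n. c)"
proof (induction k arbitrary: c)
  case (Suc k)
  show ?case by (rule Ck_SucI[where f'="\<lambda>_ _. 0"]) (auto intro: Suc)
qed simp

lemma Ck_coordinate: "Ck k (\<lambda>x :: real ^ 'n. complex_of_real (x $ j))"
proof (induction k)
  case 0
  show ?case by (simp, intro continuous_intros)
next
  case (Suc k)
  show ?case
  proof (rule Ck_SucI)
    show "((\<lambda>x :: real ^ 'n. complex_of_real (x $ j)) has_derivative (\<lambda>h. complex_of_real (h $ j))) (at x)" for x
      by (intro bounded_linear.has_derivative[OF bounded_linear_of_real] bounded_linear.has_derivative[OF bounded_linear_vec_nth] has_derivative_ident)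
  qed (rule Ck_const)
qed

lemma Ck_add: "Ck k f \<Longrightarrow> Ck k g \<Longrightarrow> Ck k (\<lambda>x. f x + g x)"
proof (induction k arbitrary: f g)
  case 0
  then show ?case by (simp add: continuous_on_add)
next
  case (Suc k)
  show ?case
  proof (rule Ck_SucI)
    show "((\<lambda>x. f x + g x) has_derivative (\<lambda>h. frechet_derivative f (at x) h + frechet_derivative g (at x) h)) (at x)" for x
      by (intro has_derivative_add Ck_has_derivative[OF Suc.prems(1)] Ck_has_derivative[OF Suc.prems(2)])
    show "Ck k (\<lambda>x. frechet_derivative f (at x) (axis i 1) + frechet_derivative g (at x) (axis i 1))" for i
      using Suc by (simp flip: partial_deriv_def)
  qed
qed

lemma Ck_mult: "Ck k f \<Longrightarrow> Ck k g \<Longrightarrow> Ck k (\<lambda>x. f x * g x)"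
proof (induction k arbitrary: f g)
  case 0
  then show ?case by (simp add: continuous_on_mult)
next
  case (Suc k)
  show ?case
  proof (rule Ck_SucI)
    show "((\<lambda>x. f x * g x) has_derivative (\<lambda>h. f x * frechet_derivative g (at x) h + frechet_derivative f (at x) h * g x)) (at x)" for x
      by (intro has_derivative_mult Ck_has_derivative[OF Suc.prems(1)] Ck_has_derivative[OF Suc.prems(2)])
    show "Ck k (\<lambda>x. f x * frechet_derivative g (at x) (axis i 1) + frechet_derivative f (at x) (axis i 1) * g x)" for i
      using Suc Ck_mono[OF Suc.prems(1)] Ck_mono[OF Suc.prems(2)]
      by (intro Ck_add) (simp_all flip: partial_deriv_def)
  qed
qed

lemma Ck_sum: "finite I \<Longrightarrow> (\<And>i. i \<in> I \<Longrightarrow> Ck k (f i)) \<Longrightarrow> Ck k (\<lambda>x. \<Sum>i\<in>I. f i x)"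
  by (induction I rule: finite_induct) (auto intro: Ck_const Ck_add)

lemma has_derivative_translate:
  assumes "Ck (Suc k) f"
  shows "((\<lambda>x. f (x + a)) has_derivative frechet_derivative f (at (x + a))) (at x)"
proof -
  have "((\<lambda>x. x + a) has_derivative (\<lambda>h. h)) (at x)" by (auto intro!: derivative_eq_intros)
  from diff_chain_at[OF this Ck_has_derivative[OF assms]] show ?thesis by (simp add: o_def)
qed

lemma Ck_translate: "Ck k f \<Longrightarrow> Ck k (\<lambda>x. f (x + a))"
proof (induction k arbitrary: f)
  case 0
  have "continuous_on UNIV (f \<circ> (\<lambda>x. x + a))"
    using 0 by (intro continuous_on_compose continuous_intros) (auto intro: continuous_on_subset)
  then show ?case by (simp add: o_def)
next
  case (Suc k)
  show ?case
  proof (rule Ck_SucI)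
    show "((\<lambda>x. f (x + a)) has_derivative frechet_derivative f (at (x + a))) (at x)" for x
      by (rule has_derivative_translate[OF Suc.prems])
    show "Ck k (\<lambda>x. frechet_derivative f (at (x + a)) (axis i 1))" for i
      using Suc by (simp flip: partial_deriv_def)
  qed
qed

lemma partial_deriv_translate:
  assumes "Ck (Suc 0) f"
  shows "partial_deriv i (\<lambda>x. f (x + a)) = (\<lambda>x. partial_deriv i f (x + a))"
  using partial_deriv_eqI[OF has_derivative_translate[OF assms]] by (auto simp: partial_deriv_def)

lemma test_function_iff: "\<phi> \<in> test_functions \<longleftrightarrow> (\<forall>k. Ck k \<phi>) \<and> bounded {x. \<phi> x \<noteq> 0}"
  by (simp add: test_functions_def compact_closure)

lemma test_function_Ck: "\<phi> \<in> test_functions \<Longrightarrow> Ck k \<phi>"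
  by (simp add: test_function_iff)

lemma test_function_partial_deriv:
  assumes "\<phi> \<in> test_functions"
  shows "partial_deriv i \<phi> \<in> test_functions"
proof -
  have "{x. partial_deriv i \<phi> x \<noteq> 0} \<subseteq> closure {x. \<phi> x \<noteq> 0}"
  proof
    fix x assume x: "x \<in> {x. partial_deriv i \<phi> x \<noteq> 0}"
    show "x \<in> closure {x. \<phi> x \<noteq> 0}"
    proof (rule ccontr)
      assume nx: "x \<notin> closure {x. \<phi> x \<noteq> 0}"
      have "((\<lambda>_. 0) has_derivative (\<lambda>_. 0)) (at x)" by simp
      then have "(\<phi> has_derivative (\<lambda>_. 0)) (at x)"
        by (rule has_derivative_transform_within_open[where s="- closure {x. \<phi> x \<noteq> 0}"])
          (use nx closure_subset[of "{x. \<phi> x \<noteq> 0}"] in auto)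
      then have "partial_deriv i \<phi> x = 0" by (rule partial_deriv_eqI)
      then show False using x by simp
    qed
  qed
  then have "bounded {x. partial_deriv i \<phi> x \<noteq> 0}"
    using assms by (auto simp: test_function_iff intro: bounded_subset[OF bounded_closure])
  moreover have "Ck k (partial_deriv i \<phi>)" for k
    using test_function_Ck[OF assms, of "Suc k"] by simp
  ultimately show ?thesis by (simp add: test_function_iff)
qed

lemma test_function_sum:
  assumes "finite I" "\<And>i. i \<in> I \<Longrightarrow> f i \<in> test_functions"
  shows "(\<lambda>x. \<Sum>i\<in>I. f i x) \<in> test_functions"
proof -
  have "{x. (\<Sum>i\<in>I. f i x) \<noteq> 0} \<subseteq> (\<Union>i\<in>I. {x. f i x \<noteq> 0})"
    by (auto intro: ccontr dest: sum.not_neutral_contains_not_neutral)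
  then have "bounded {x. (\<Sum>i\<in>I. f i x) \<noteq> 0}"
    using assms by (intro bounded_subset[OF bounded_UN]) (auto simp: test_function_iff)
  then show ?thesis using assms by (auto simp: test_function_iff intro: Ck_sum)
qed

lemma test_function_laplacian: "\<phi> \<in> test_functions \<Longrightarrow> laplacian \<phi> \<in> test_functions"
  unfolding laplacian_def[abs_def] by (intro test_function_sum test_function_partial_deriv) auto

lemma test_function_translate:
  assumes "\<phi> \<in> test_functions"
  shows "(\<lambda>x. \<phi> (x + a)) \<in> test_functions"
proof -
  have "{x. \<phi> (x + a) \<noteq> 0} = (\<lambda>x. - a + x) ` {x. \<phi> x \<noteq> 0}"
    by (auto simp: image_iff intro!: exI[of _ "_ + a"])
  then have "bounded {x. \<phi> (x + a) \<noteq> 0}"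
    using assms bounded_translation[of "{x. \<phi> x \<noteq> 0}" "- a"] by (simp add: test_function_iff)
  then show ?thesis using assms by (auto simp: test_function_iff intro: Ck_translate)
qed

lemma laplacian_translate:
  assumes "\<phi> \<in> test_functions"
  shows "laplacian (\<lambda>x. \<phi> (x + a)) = (\<lambda>x. laplacian \<phi> (x + a))"
  unfolding laplacian_def[abs_def]
  by (simp only: partial_deriv_translate[OF test_function_Ck] test_function_partial_deriv assms)

lemma test_function_bounds:
  fixes \<phi> :: "real ^ 'n \<Rightarrow> complex"
  assumes "\<phi> \<in> test_functions"
  shows "\<exists>B\<ge>0. \<exists>R\<ge>0. \<forall>x. norm (\<phi> x) \<le> B * indicator (cball 0 R) x"
proof -
  have c: "continuous_on UNIV \<phi>" using test_function_Ck[OF assms, of 0] by simp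
  obtain R where R: "0 < R" "\<And>x. \<phi> x \<noteq> 0 \<Longrightarrow> norm x \<le> R"
    using assms by (auto simp: test_function_iff bounded_pos)
  have "compact (\<phi> ` cball 0 R)"
    by (intro compact_continuous_image continuous_on_subset[OF c]) auto
  then obtain B where B: "0 < B" "\<And>x. norm x \<le> R \<Longrightarrow> norm (\<phi> x) \<le> B"
    by (auto dest!: compact_imp_bounded simp: bounded_pos)
  have "norm (\<phi> x) \<le> B * indicator (cball 0 R) x" for x
    using B(2)[of x] R(2)[of x] by (auto simp: indicator_def)
  then show ?thesis using B(1) R(1) less_imp_le by blast
qed

lemma integrable_ball_indicator: "integrable lborel (\<lambda>x::real ^ 'n. B * indicator (cball 0 R) x :: real)"
  using emeasure_lborel_cball_finite[of 0 R] by (intro integrable_mult_right integrable_real_indicator) auto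

lemma
  fixes \<phi> :: "real ^ 'n \<Rightarrow> complex"
  assumes "\<phi> \<in> test_functions"
  shows test_function_continuous: "continuous_on UNIV \<phi>"
    and test_function_integrable: "integrable lborel \<phi>"
    and test_function_L2: "\<phi> \<in> L2"
proof -
  show c: "continuous_on UNIV \<phi>" using test_function_Ck[OF assms, of 0] by simp
  obtain B R where B: "0 \<le> B" "0 \<le> R" "\<And>x. norm (\<phi> x) \<le> B * indicator (cball 0 R) x"
    using test_function_bounds[OF assms] by blast
  show i: "integrable lborel \<phi>"
    by (rule Bochner_Integration.integrable_bound[OF integrable_ball_indicator[of B R]])
      (use B c in \<open>auto intro: borel_measurable_continuous_onI\<close>)
  have "norm (\<phi> x) \<le> B" for x
    using B(3)[of x] B(1) by (cases "x \<in> cball 0 R") auto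
  then show "\<phi> \<in> L2" by (rule bounded_integrable_L2[OF i])
qed

lemma fourier_integral_translate:
  fixes f :: "real ^ 'n \<Rightarrow> complex"
  assumes [measurable]: "f \<in> borel_measurable borel"
  shows "fourier_integral (\<lambda>x. f (x + a)) \<xi> = exp (\<i> * complex_of_real (\<xi> \<bullet> a)) * fourier_integral f \<xi>"
proof -
  have "fourier_integral (\<lambda>x. f (x + a)) \<xi>
     = (LINT x|lborel. exp (\<i> * complex_of_real (\<xi> \<bullet> a)) * (f (x + a) * exp (- \<i> * complex_of_real (\<xi> \<bullet> (x + a)))))"
    unfolding fourier_integral_def
    by (intro Bochner_Integration.integral_cong refl) (simp add: inner_add_right algebra_simps flip: exp_add)
  also have "\<dots> = exp (\<i> * complex_of_real (\<xi> \<bullet> a)) * (LINT x|lborel. f (x + a) * exp (- \<i> * complex_of_real (\<xi> \<bullet> (x + a))))"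
    by simp
  also have "(LINT x|lborel. f (x + a) * exp (- \<i> * complex_of_real (\<xi> \<bullet> (x + a)))) = fourier_integral f \<xi>"
    unfolding fourier_integral_def
    by (rule lborel_integral_translate[where f="\<lambda>x. f x * exp (- \<i> * complex_of_real (\<xi> \<bullet> x))"]) measurable
  finally show ?thesis .
qed

lemma test_function_line_derivative:
  assumes \<phi>: "\<phi> \<in> test_functions"
  shows "((\<lambda>s. \<phi> (x + s *\<^sub>R axis i 1)) has_vector_derivative partial_deriv i \<phi> (x + s *\<^sub>R axis i 1)) (at s)"
proof -
  have 1: "((\<lambda>s. x + s *\<^sub>R axis i 1) has_derivative (\<lambda>s. s *\<^sub>R axis i 1)) (at s)"
    by (auto intro!: derivative_eq_intros)
  note 2 = Ck_has_derivative[OF test_function_Ck[OF \<phi>], of "x + s *\<^sub>R axis i 1"]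
  have "linear (frechet_derivative \<phi> (at (x + s *\<^sub>R axis i 1)))" using 2 by (rule has_derivative_linear)
  then have "(\<lambda>r. frechet_derivative \<phi> (at (x + s *\<^sub>R axis i 1)) (r *\<^sub>R axis i 1))
     = (\<lambda>r. r *\<^sub>R partial_deriv i \<phi> (x + s *\<^sub>R axis i 1))"
    by (auto simp: linear_scale partial_deriv_def)
  then show ?thesis
    using diff_chain_at[OF 1 2] by (simp add: o_def has_vector_derivative_def)
qed

text \<open>
  The mean value inequality along a coordinate direction, in the form needed to dominate
  difference quotients.
\<close>

lemma test_function_difference_bound:
  fixes \<phi> :: "real ^ 'n \<Rightarrow> complex"
  assumes \<phi>: "\<phi> \<in> test_functions" and B: "\<And>x. norm (partial_deriv i \<phi> x) \<le> B" and h: "0 < h"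
  shows "norm (\<phi> (x + h *\<^sub>R axis i 1) - \<phi> x) \<le> B * h"
proof -
  note der = test_function_line_derivative[OF \<phi>, of x i]
  have "norm (\<phi> (x + h *\<^sub>R axis i 1) - \<phi> (x + 0 *\<^sub>R axis i 1)) \<le> B * h - B * 0"
  proof (rule differentiable_bound_general[where f="\<lambda>s. \<phi> (x + s *\<^sub>R axis i 1)" and \<phi>="\<lambda>s. B * s"
        and f'="\<lambda>s. partial_deriv i \<phi> (x + s *\<^sub>R axis i 1)" and \<phi>'="\<lambda>_. B"])
    show "continuous_on {0..h} (\<lambda>s. \<phi> (x + s *\<^sub>R axis i 1))"
      using der by (intro continuous_at_imp_continuous_on ballI has_vector_derivative_continuous)
    show "((*) B has_vector_derivative B) (at s)" for s
      by (auto intro!: derivative_eq_intros simp: has_real_derivative_iff_has_vector_derivative[symmetric])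
    show "continuous_on {0..h} ((*) B)" by (intro continuous_intros)
  qed (use h B der in auto)
  then show ?thesis by simp
qed

text \<open>
  Instead of integrating by parts, differentiate the translation rule in the direction of the
  coordinate: the difference quotients have a common compact support and a common bound, so the
  limit passes through the integral.
\<close>

lemma fourier_integral_partial_deriv:
  fixes \<phi> :: "real ^ 'n \<Rightarrow> complex"
  assumes \<phi>: "\<phi> \<in> test_functions"
  shows "fourier_integral (partial_deriv i \<phi>) \<xi> = \<i> * complex_of_real (\<xi> $ i) * fourier_integral \<phi> \<xi>"
proof -
  define v :: "real ^ 'n" where "v = axis i 1"
  have nv: "norm v = 1" by (simp add: v_def)
  have xv: "\<xi> \<bullet> v = \<xi> $ i" by (simp add: v_def inner_axis)
  define h where "h k = inverse (real (Suc k))" for k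
  have h: "0 < h k" "h k \<le> 1" for k by (auto simp: h_def field_simps)
  have h0: "h \<longlonglongrightarrow> 0" unfolding h_def[abs_def] by (rule LIMSEQ_inverse_real_of_nat)
  have h_at: "filterlim h (at 0) sequentially"
    using h0 h(1) by (auto simp: filterlim_at less_le)
  have d\<phi>: "partial_deriv i \<phi> \<in> test_functions" using \<phi> by (rule test_function_partial_deriv)
  obtain B R where B: "0 \<le> B" "0 \<le> R" "\<And>x. norm (partial_deriv i \<phi> x) \<le> B * indicator (cball 0 R) x"
    using test_function_bounds[OF d\<phi>] by blast
  have B': "norm (partial_deriv i \<phi> x) \<le> B" for x
    using B(3)[of x] B(1) by (cases "x \<in> cball 0 R") auto
  obtain B2 R2 where R2: "0 \<le> B2" "0 \<le> R2" "\<And>x. norm (\<phi> x) \<le> B2 * indicator (cball 0 R2) x"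
    using test_function_bounds[OF \<phi>] by blast
  have z: "\<phi> x = 0" if "norm x > R2" for x using R2(3)[of x] that by simp
  have [measurable]: "\<phi> \<in> borel_measurable borel" "partial_deriv i \<phi> \<in> borel_measurable borel"
    using \<phi> d\<phi> test_function_continuous borel_measurable_continuous_onI by blast+
  define q where "q k x = (\<phi> (x + h k *\<^sub>R v) - \<phi> x) / complex_of_real (h k)" for k x
  have qm [measurable]: "q k \<in> borel_measurable borel" for k unfolding q_def[abs_def] by measurable
  have q_le: "norm (q k x) \<le> B * indicator (cball 0 (R2 + 1)) x" for k x
  proof (cases "norm x \<le> R2 + 1")
    case True
    then show ?thesis
      using test_function_difference_bound[OF \<phi> B' h(1)[of k], of x] h(1)[of k]
      by (simp add: q_def norm_divide v_def field_simps)
  next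
    case False
    have "norm x \<le> norm (x + h k *\<^sub>R v) + norm (h k *\<^sub>R v)"
      using norm_triangle_ineq4[of "x + h k *\<^sub>R v" "h k *\<^sub>R v"] by simp
    then have "R2 < norm (x + h k *\<^sub>R v)" using False h[of k] nv by simp
    then show ?thesis using z False R2(2) by (simp add: q_def)
  qed
  have q_lim: "(\<lambda>k. q k x) \<longlonglongrightarrow> partial_deriv i \<phi> x" for x
  proof -
    have "((\<lambda>s. \<phi> (x + s *\<^sub>R v)) has_vector_derivative partial_deriv i \<phi> x) (at 0)"
      using test_function_line_derivative[OF \<phi>, of x i 0] by (simp add: v_def)
    then have "((\<lambda>s. norm (\<phi> (x + s *\<^sub>R v) - \<phi> x - s *\<^sub>R partial_deriv i \<phi> x) / norm s) \<longlongrightarrow> 0) (at 0)"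
      by (simp add: has_vector_derivative_def has_derivative_at)
    from filterlim_compose[OF this h_at]
    have "(\<lambda>k. norm (\<phi> (x + h k *\<^sub>R v) - \<phi> x - h k *\<^sub>R partial_deriv i \<phi> x) / norm (h k)) \<longlonglongrightarrow> 0" .
    also have "(\<lambda>k. norm (\<phi> (x + h k *\<^sub>R v) - \<phi> x - h k *\<^sub>R partial_deriv i \<phi> x) / norm (h k)) = (\<lambda>k. norm (q k x - partial_deriv i \<phi> x))"
    proof
      fix k
      have "q k x - partial_deriv i \<phi> x = (\<phi> (x + h k *\<^sub>R v) - \<phi> x - h k *\<^sub>R partial_deriv i \<phi> x) / complex_of_real (h k)"
        using h(1)[of k] by (simp add: q_def scaleR_conv_of_real diff_divide_distrib)
      then show "norm (\<phi> (x + h k *\<^sub>R v) - \<phi> x - h k *\<^sub>R partial_deriv i \<phi> x) / norm (h k) = norm (q k x - partial_deriv i \<phi> x)"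
        by (simp add: norm_divide)
    qed
    finally show ?thesis by (rule LIM_zero_cancel[OF tendsto_norm_zero_cancel])
  qed
  have "(\<lambda>k. fourier_integral (q k) \<xi>) \<longlonglongrightarrow> fourier_integral (partial_deriv i \<phi>) \<xi>"
    unfolding fourier_integral_def
  proof (rule integral_dominated_convergence[where w="\<lambda>x. B * indicator (cball 0 (R2 + 1)) x"])
    show "integrable lborel (\<lambda>x::real ^ 'n. B * indicator (cball 0 (R2 + 1)) x)" by (rule integrable_ball_indicator)
    show "AE x in lborel. (\<lambda>k. q k x * exp (- \<i> * complex_of_real (\<xi> \<bullet> x))) \<longlonglongrightarrow>
       partial_deriv i \<phi> x * exp (- \<i> * complex_of_real (\<xi> \<bullet> x))"
      by (intro AE_I2 tendsto_mult q_lim tendsto_const)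
    show "AE x in lborel. norm (q k x * exp (- \<i> * complex_of_real (\<xi> \<bullet> x))) \<le> B * indicator (cball 0 (R2 + 1)) x" for k
      using q_le by (intro AE_I2) (simp only: norm_mult norm_exp_i_real mult_1_right)
  qed measurable
  moreover have "fourier_integral (q k) \<xi> = (exp (\<i> * complex_of_real (h k * \<xi> $ i)) - 1) / complex_of_real (h k) * fourier_integral \<phi> \<xi>" for k
  proof -
    have i: "integrable lborel (\<lambda>x. \<phi> (x + h k *\<^sub>R v))"
      by (rule test_function_integrable[OF test_function_translate[OF \<phi>]])
    have "fourier_integral (q k) \<xi> = fourier_integral (\<lambda>x. (1 / complex_of_real (h k)) * \<phi> (x + h k *\<^sub>R v) + (- 1 / complex_of_real (h k)) * \<phi> x) \<xi>"
      by (simp add: q_def[abs_def] diff_divide_distrib)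
    also have "\<dots> = (1 / complex_of_real (h k)) * fourier_integral (\<lambda>x. \<phi> (x + h k *\<^sub>R v)) \<xi> + (- 1 / complex_of_real (h k)) * fourier_integral \<phi> \<xi>"
      by (rule fourier_integral_linear[OF i test_function_integrable[OF \<phi>]])
    finally show ?thesis
      by (simp add: fourier_integral_translate xv diff_divide_distrib left_diff_distrib)
  qed
  moreover have "(\<lambda>k. (exp (\<i> * complex_of_real (h k * \<xi> $ i)) - 1) / complex_of_real (h k) * fourier_integral \<phi> \<xi>)
      \<longlonglongrightarrow> (\<i> * complex_of_real (\<xi> $ i)) * fourier_integral \<phi> \<xi>"
  proof (intro tendsto_mult tendsto_const)
    have "((\<lambda>z. exp (\<i> * complex_of_real (\<xi> $ i) * z)) has_field_derivative \<i> * complex_of_real (\<xi> $ i)) (at 0)"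
      by (auto intro!: derivative_eq_intros)
    then have "((\<lambda>z. (exp (\<i> * complex_of_real (\<xi> $ i) * z) - 1) / z) \<longlongrightarrow> \<i> * complex_of_real (\<xi> $ i)) (at 0)"
      by (simp add: has_field_derivative_iff)
    moreover have "filterlim (\<lambda>k. complex_of_real (h k)) (at 0) sequentially"
      using tendsto_of_real[OF h0, where 'a=complex] h(1) by (auto simp: filterlim_at less_le)
    ultimately have "(\<lambda>k. (exp (\<i> * complex_of_real (\<xi> $ i) * complex_of_real (h k)) - 1) / complex_of_real (h k)) \<longlonglongrightarrow> \<i> * complex_of_real (\<xi> $ i)"
      by (rule filterlim_compose)
    then show "(\<lambda>k. (exp (\<i> * complex_of_real (h k * \<xi> $ i)) - 1) / complex_of_real (h k)) \<longlonglongrightarrow> \<i> * complex_of_real (\<xi> $ i)"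
      by (simp add: mult_ac)
  qed
  ultimately show ?thesis using LIMSEQ_unique by simp
qed

lemma fourier_integral_sum:
  fixes f :: "'i \<Rightarrow> real ^ 'n \<Rightarrow> complex"
  assumes "\<And>i. i \<in> I \<Longrightarrow> integrable lborel (f i)"
  shows "fourier_integral (\<lambda>x. \<Sum>i\<in>I. f i x) \<xi> = (\<Sum>i\<in>I. fourier_integral (f i) \<xi>)"
  unfolding fourier_integral_def sum_distrib_right
  by (intro Bochner_Integration.integral_sum fourier_integrand_integrable assms)

lemma fourier_integral_laplacian:
  fixes \<phi> :: "real ^ 'n \<Rightarrow> complex"
  assumes \<phi>: "\<phi> \<in> test_functions"
  shows "fourier_integral (laplacian \<phi>) \<xi> = - complex_of_real ((norm \<xi>)\<^sup>2) * fourier_integral \<phi> \<xi>"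
proof -
  note d = test_function_partial_deriv[OF \<phi>]
  have "fourier_integral (laplacian \<phi>) \<xi> = (\<Sum>i\<in>UNIV. fourier_integral (partial_deriv i (partial_deriv i \<phi>)) \<xi>)"
    unfolding laplacian_def[abs_def]
    by (intro fourier_integral_sum test_function_integrable test_function_partial_deriv \<phi>)
  also have "\<dots> = (\<Sum>i\<in>UNIV. - complex_of_real ((\<xi> $ i)\<^sup>2)) * fourier_integral \<phi> \<xi>"
    by (simp add: fourier_integral_partial_deriv[OF d] fourier_integral_partial_deriv[OF \<phi>] sum_distrib_left power2_eq_square algebra_simps)
  also have "(\<Sum>i\<in>UNIV. - complex_of_real ((\<xi> $ i)\<^sup>2)) = - complex_of_real ((norm \<xi>)\<^sup>2)"
    by (simp add: norm_vec_def L2_set_def sum_nonneg sum_negf)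
  finally show ?thesis .
qed


subsection \<open>Smooth bumps\<close>

text \<open>
  For \<open>p = 1\<close> this is the classical function \<open>exp (- 1 / s)\<close>, which is flat at \<open>0\<close>. Polynomials in
  \<open>1 / s\<close> are included as factors because the family is then closed under differentiation.
\<close>

definition flat :: "real poly \<Rightarrow> real \<Rightarrow> real" where
  "flat p s = (if 0 < s then poly p (1 / s) * exp (- (1 / s)) else 0)"

lemma poly_times_exp_minus_tendsto: "((\<lambda>y::real. poly q y * exp (- y)) \<longlongrightarrow> 0) at_top"
proof -
  have "((\<lambda>y::real. \<Sum>i\<le>degree q. coeff q i * (y ^ i / exp y)) \<longlongrightarrow> (\<Sum>i\<le>degree q. coeff q i * 0)) at_top"
    by (intro tendsto_intros tendsto_power_div_exp_0)
  then show ?thesis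
    by (simp add: poly_altdef sum_distrib_right exp_minus divide_inverse mult.assoc)
qed

lemma flat_tendsto_0: "(flat q \<longlongrightarrow> 0) (at 0)"
proof -
  have "((\<lambda>s. poly q (1 / s) * exp (- (1 / s))) \<longlongrightarrow> 0) (at_right 0)"
    using filterlim_compose[OF poly_times_exp_minus_tendsto[of q] filterlim_inverse_at_top_right]
    by (simp add: inverse_eq_divide)
  moreover have "\<forall>\<^sub>F s in at_right 0. poly q (1 / s) * exp (- (1 / s)) = flat q s"
    using eventually_at_right_less[of 0] by eventually_elim (simp add: flat_def)
  ultimately have "(flat q \<longlongrightarrow> 0) (at_right 0)" by (rule Lim_transform_eventually)
  moreover have "(flat q \<longlongrightarrow> 0) (at_left 0)"
    by (rule tendsto_eventually) (auto simp: flat_def eventually_at_left_field intro!: exI[of _ "-1"])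
  ultimately show ?thesis by (simp add: filterlim_at_split)
qed

lemma flat_has_derivative: "(flat p has_real_derivative flat (pCons 0 (pCons 0 (p - pderiv p))) s) (at s)"
proof -
  consider "s < 0" | "s = 0" | "0 < s" by linarith
  then show ?thesis
  proof cases
    case 1
    have "((\<lambda>_. 0) has_real_derivative 0) (at s)" by simp
    then have "(flat p has_real_derivative 0) (at s)"
      by (rule has_field_derivative_transform_within_open[where S="{..<0}"]) (use 1 in \<open>auto simp: flat_def\<close>)
    then show ?thesis using 1 by (simp add: flat_def)
  next
    case 2
    have "((\<lambda>y. (flat p y - flat p 0) / (y - 0)) \<longlongrightarrow> 0) (at 0)"
      by (rule Lim_transform_eventually[OF flat_tendsto_0[of "pCons 0 p"]])
        (auto simp: flat_def eventually_at_filter)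
    then show ?thesis using 2 by (simp add: has_field_derivative_iff flat_def)
  next
    case 3
    have "((\<lambda>s. poly p (1 / s) * exp (- (1 / s))) has_real_derivative
        poly (pderiv p) (1 / s) * (- (1 / s\<^sup>2)) * exp (- (1 / s)) + poly p (1 / s) * (exp (- (1 / s)) * (1 / s\<^sup>2))) (at s)"
    proof (rule DERIV_cong[OF DERIV_mult])
      show "((\<lambda>s. poly p (1 / s)) has_real_derivative poly (pderiv p) (1 / s) * (- (1 / s\<^sup>2))) (at s)"
        by (rule DERIV_chain2[OF poly_DERIV]) (use 3 in \<open>auto intro!: derivative_eq_intros simp: power2_eq_square\<close>)
      show "((\<lambda>s. exp (- (1 / s))) has_real_derivative exp (- (1 / s)) * (1 / s\<^sup>2)) (at s)"
        by (rule DERIV_chain2[OF DERIV_exp]) (use 3 in \<open>auto intro!: derivative_eq_intros simp: power2_eq_square\<close>)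
    qed (simp add: algebra_simps)
    then have "(flat p has_real_derivative
        poly (pderiv p) (1 / s) * (- (1 / s\<^sup>2)) * exp (- (1 / s)) + poly p (1 / s) * (exp (- (1 / s)) * (1 / s\<^sup>2))) (at s)"
      by (rule has_field_derivative_transform_within_open[where S="{0<..}"]) (use 3 in \<open>auto simp: flat_def\<close>)
    moreover have "poly (pderiv p) (1 / s) * (- (1 / s\<^sup>2)) * exp (- (1 / s)) + poly p (1 / s) * (exp (- (1 / s)) * (1 / s\<^sup>2))
        = flat (pCons 0 (pCons 0 (p - pderiv p))) s"
      using 3 by (simp add: flat_def power2_eq_square field_simps)
    ultimately show ?thesis by simp
  qed
qed

definition bump :: "real \<Rightarrow> real ^ 'n \<Rightarrow> complex" where
  "bump d x = complex_of_real (flat 1 (d\<^sup>2 - (norm x)\<^sup>2))"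

text \<open>
  A partial derivative is another member of the family, with a different polynomial, times a
  multiple of a coordinate; hence the induction over the order for all \<open>p\<close> at once.
\<close>

lemma Ck_flat_radial: "Ck k (\<lambda>x :: real ^ 'n. complex_of_real (flat p (c - x \<bullet> x)))"
proof (induction k arbitrary: p)
  case 0
  have "continuous_on UNIV (flat p)"
    by (rule DERIV_continuous_on[OF flat_has_derivative])
  then have "continuous_on UNIV (\<lambda>x :: real ^ 'n. flat p (c - x \<bullet> x))"
    by (rule continuous_on_compose2) (auto intro!: continuous_intros)
  then show ?case by (simp add: continuous_on_of_real)
next
  case (Suc k)
  define p' where "p' = pCons 0 (pCons 0 (p - pderiv p))"
  show ?case
  proof (rule Ck_SucI)
    fix x :: "real ^ 'n"
    have 1: "((\<lambda>x :: real ^ 'n. c - x \<bullet> x) has_derivative (\<lambda>h. - (2 * (x \<bullet> h)))) (at x)"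
      by (auto intro!: derivative_eq_intros simp: inner_commute)
    have 2: "(flat p has_derivative (\<lambda>r. flat p' (c - x \<bullet> x) * r)) (at (c - x \<bullet> x))"
      using flat_has_derivative[of p "c - x \<bullet> x"] by (simp add: has_field_derivative_def p'_def)
    show "((\<lambda>x :: real ^ 'n. complex_of_real (flat p (c - x \<bullet> x))) has_derivative
        (\<lambda>h. complex_of_real (flat p' (c - x \<bullet> x) * (- (2 * (x \<bullet> h)))))) (at x)"
      using diff_chain_at[OF 1 2] by (intro bounded_linear.has_derivative[OF bounded_linear_of_real]) (simp add: o_def)
  next
    fix i :: 'n
    have "Ck k (\<lambda>x :: real ^ 'n. complex_of_real (flat p' (c - x \<bullet> x)) * (- 2 * complex_of_real (x $ i)))"
      by (intro Ck_mult Suc Ck_const Ck_coordinate)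
    then show "Ck k (\<lambda>x :: real ^ 'n. complex_of_real (flat p' (c - x \<bullet> x) * (- (2 * (x \<bullet> axis i 1)))))"
      by (simp add: inner_axis)
  qed
qed

lemma flat_one_nonneg: "0 \<le> flat 1 s"
  by (simp add: flat_def)

lemma bump_eq_0_iff:
  assumes "0 < d"
  shows "bump d x = 0 \<longleftrightarrow> d \<le> norm x"
proof -
  have "bump d x = 0 \<longleftrightarrow> d\<^sup>2 \<le> (norm x)\<^sup>2" by (simp add: bump_def flat_def)
  also have "\<dots> \<longleftrightarrow> d \<le> norm x" using assms by (intro power_mono_iff) auto
  finally show ?thesis .
qed

lemma bump_test_function:
  assumes "0 < d"
  shows "(bump d :: real ^ 'n \<Rightarrow> complex) \<in> test_functions"
proof -
  have "bounded {x :: real ^ 'n. bump d x \<noteq> 0}"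
    by (rule boundedI[of _ d]) (auto simp: bump_eq_0_iff[OF assms])
  moreover have "bump d = (\<lambda>x :: real ^ 'n. complex_of_real (flat 1 (d\<^sup>2 - x \<bullet> x)))"
    by (simp add: bump_def[abs_def] power2_norm_eq_inner)
  ultimately show ?thesis by (simp add: test_function_iff Ck_flat_radial)
qed

text \<open>
  On the support of a narrow bump the phase \<open>\<xi> \<bullet> x\<close> stays below \<open>1\<close>, so its cosine is
  positive and the real part of the transform is the integral of a nonnegative function that
  does not vanish.
\<close>

lemma fourier_integral_bump_nonzero:
  fixes \<xi> :: "real ^ 'n"
  assumes d: "0 < d" "norm \<xi> * d \<le> 1"
  shows "fourier_integral (bump d) \<xi> \<noteq> 0"
proof
  assume 0: "fourier_integral (bump d) \<xi> = 0"
  define f where "f x = flat 1 (d\<^sup>2 - (norm x)\<^sup>2) * cos (\<xi> \<bullet> x)" for x :: "real ^ 'n"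
  have i: "integrable lborel (\<lambda>x. bump d x * exp (- \<i> * complex_of_real (\<xi> \<bullet> x)))"
    by (intro fourier_integrand_integrable test_function_integrable bump_test_function d)
  have f: "Re (bump d x * exp (- \<i> * complex_of_real (\<xi> \<bullet> x))) = f x" for x
    by (simp add: bump_def f_def Re_exp)
  have fi: "integrable lborel f" using integrable_Re[OF i] by (simp only: f)
  have "(LINT x|lborel. f x) = Re (fourier_integral (bump d) \<xi>)"
    unfolding fourier_integral_def f[symmetric] by (rule integral_Re[OF i])
  then have I0: "(LINT x|lborel. f x) = 0" using 0 by simp
  have pos: "0 < f x" if x: "norm x < d" for x
  proof -
    have "\<bar>\<xi> \<bullet> x\<bar> \<le> norm \<xi> * norm x" by (rule Cauchy_Schwarz_ineq2)
    also have "\<dots> \<le> norm \<xi> * d" using x by (intro mult_left_mono) auto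
    finally have "\<bar>\<xi> \<bullet> x\<bar> \<le> 1" using d(2) by simp
    then have "0 < cos (\<xi> \<bullet> x)" using pi_half_gt_zero pi_gt3 by (intro cos_gt_zero_pi) auto
    moreover have "flat 1 (d\<^sup>2 - (norm x)\<^sup>2) \<noteq> 0"
      using bump_eq_0_iff[OF d(1), of x] x by (simp add: bump_def)
    ultimately show ?thesis using flat_one_nonneg[of "d\<^sup>2 - (norm x)\<^sup>2"] by (simp add: f_def less_le)
  qed
  have zero: "f x = 0" if "d \<le> norm x" for x
    using bump_eq_0_iff[OF d(1), of x] that by (simp add: bump_def f_def)
  have "AE x in lborel. 0 \<le> f x" using pos zero by (intro AE_I2) (metis less_imp_le not_le order_refl)
  from integral_nonneg_eq_0_iff_AE[OF fi this] I0 have "AE x in lborel. f x = 0" by simp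
  then have "AE x in lborel. x \<notin> ball (0 :: real ^ 'n) d"
  proof eventually_elim
    case (elim x)
    then show ?case using pos[of x] by (cases "norm x < d") auto
  qed
  then have "ball (0 :: real ^ 'n) d \<in> null_sets lborel"
    by (subst (asm) AE_iff_null_sets[symmetric]) auto
  then have "negligible (ball (0 :: real ^ 'n) d)"
    by (simp add: negligible_iff_null_sets null_sets_completionI)
  then show False using d(1) by (simp add: open_not_negligible)
qed

section \<open>The equation on the Fourier side\<close>

text \<open>
  Translating a test function multiplies its transform by a phase. Hence the values of a
  distribution on all translates of \<open>\<phi>\<close> are, up to the factor \<open>(2 \<pi>)\<^sup>n\<close>, the Fourier integral
  of a single function, the product of the two transforms with one of them reflected.
\<close>

lemma fourier_integral_pairing:
  fixes f \<phi> :: "real ^ 'n \<Rightarrow> complex"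
  assumes f: "f \<in> L2" and \<phi>: "\<phi> \<in> test_functions"
  defines "P \<equiv> \<lambda>\<xi>. fourier f \<xi> * fourier_integral \<phi> (- \<xi>)"
  shows "integrable lborel P" "P \<in> L2"
    "fourier_integral P a = (2 * pi) ^ CARD('n) * distribution_of f (\<lambda>x. \<phi> (x + a))"
proof -
  have \<phi>i: "integrable lborel \<phi>" and \<phi>L: "\<phi> \<in> L2" using \<phi> test_function_integrable test_function_L2 by blast+
  have [measurable]: "\<phi> \<in> borel_measurable borel" using \<phi>L by (rule L2_measurable)
  show "integrable lborel P" unfolding P_def
    by (intro L2_mult_integrable L2_uminus fourier_L2 f plancherel_upper_L1_L2 \<phi>i \<phi>L)
  have "(\<lambda>\<xi>. fourier_integral \<phi> (- \<xi>) * fourier f \<xi>) \<in> L2"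
    by (rule L2_mult_bounded(1)[OF fourier_L2[OF f] _ fourier_integral_bound]) measurable
  then show "P \<in> L2" by (simp add: P_def mult.commute)
  define \<psi> where "\<psi> x = \<phi> (x + a)" for x
  have \<psi>: "\<psi> \<in> test_functions" unfolding \<psi>_def[abs_def] by (rule test_function_translate[OF \<phi>])
  obtain B R where B: "0 \<le> B" "\<And>x. norm (\<psi> x) \<le> B * indicator (cball 0 R) x"
    using test_function_bounds[OF \<psi>] by blast
  have B': "norm (\<psi> x) \<le> B" for x using B(2)[of x] B(1) by (cases "x \<in> cball 0 R") auto
  have "fourier_integral P a = (LINT \<xi>|lborel. P \<xi> * exp (- \<i> * complex_of_real (a \<bullet> \<xi>)))"
    by (rule fourier_integral_def)
  also have "\<dots> = (LINT \<xi>|lborel. fourier f \<xi> * fourier_integral \<psi> (- \<xi>))"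
    unfolding P_def \<psi>_def
    by (intro Bochner_Integration.integral_cong refl) (simp add: fourier_integral_translate inner_commute)
  also have "\<dots> = (2 * pi) ^ CARD('n) * distribution_of f \<psi>"
    unfolding distribution_of_def by (rule parseval[OF f test_function_continuous[OF \<psi>] B' test_function_integrable[OF \<psi>]])
  finally show "fourier_integral P a = (2 * pi) ^ CARD('n) * distribution_of f (\<lambda>x. \<phi> (x + a))"
    by (simp add: \<psi>_def[abs_def])
qed

lemma fourier_integral_zero_imp_AE_zero:
  fixes H :: "real ^ 'n \<Rightarrow> complex"
  assumes H: "H \<in> L2" "integrable lborel H" and 0: "\<And>a. fourier_integral H a = 0"
  shows "AE \<xi> in lborel. H \<xi> = 0"
proof -
  have "AE a in lborel. fourier H a = 0" using fourier_eq_fourier_integral[OF H] by (simp add: 0)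
  then have "L2_norm (fourier H) = L2_norm (\<lambda>a :: real ^ 'n. 0)"
    by (intro L2_norm_cong_AE[OF L2_measurable[OF fourier_L2[OF H(1)]]]) auto
  then have "sqrt ((2 * pi) ^ CARD('n)) * L2_norm H \<le> sqrt ((2 * pi) ^ CARD('n)) * 0"
    using plancherel_lower[OF H(1)] by (simp add: L2_norm_def[of "\<lambda>a. 0"])
  then have "L2_norm H \<le> 0" by (rule mult_left_le_imp_le) simp
  then have "L2_norm H = 0" using L2_norm_nonneg[of H] by simp
  then show ?thesis by (rule L2_norm_eq_0_AE[OF H(1)])
qed

text \<open>
  Test the equation with all translates of a fixed \<open>\<phi>\<close>. By Parseval's identity this says that the symbol applied to
  the transforms, times the reflected transform of \<open>\<phi>\<close>, has vanishing Fourier integral; that product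
  is in \<open>L\<^sup>1 \<inter> L\<^sup>2\<close> because the factors \<open>|\<xi>|\<^sup>2\<close> can be absorbed into the transform of \<open>\<phi>\<close>. So it
  vanishes almost everywhere, and the transform of \<open>\<phi>\<close> is divided out by using bumps of width
  \<open>1 / k\<close>, whose transforms have no zeros on the ball of radius \<open>k\<close>.
\<close>

lemma satisfies_equation_fourier:
  fixes v v1 v2 :: "real ^ 'n \<Rightarrow> complex"
  assumes v: "v \<in> L2" "v1 \<in> L2" "v2 \<in> L2" and eq: "satisfies_equation v v1 v2"
  shows "AE \<xi> in lborel. complex_of_real (1 + (norm \<xi>)\<^sup>2) * fourier v2 \<xi>
    + complex_of_real ((norm \<xi>)\<^sup>2 * (1 + (norm \<xi>)\<^sup>2)) * fourier v \<xi> + fourier v1 \<xi> = 0"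
proof -
  define S where "S \<xi> = complex_of_real (1 + (norm \<xi>)\<^sup>2) * fourier v2 \<xi>
    + complex_of_real ((norm \<xi>)\<^sup>2 * (1 + (norm \<xi>)\<^sup>2)) * fourier v \<xi> + fourier v1 \<xi>" for \<xi>
  have tested: "AE \<xi> in lborel. S \<xi> * fourier_integral \<phi> (- \<xi>) = 0" if \<phi>: "\<phi> \<in> test_functions" for \<phi>
  proof -
    note \<phi>1 = test_function_laplacian[OF \<phi>] and \<phi>2 = test_function_laplacian[OF test_function_laplacian[OF \<phi>]]
    define P where "P f \<psi> \<xi> = fourier f \<xi> * fourier_integral \<psi> (- \<xi>)" for f \<psi> :: "real ^ 'n \<Rightarrow> complex" and \<xi>
    have P: "integrable lborel (P f \<psi>)" "P f \<psi> \<in> L2"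
      "fourier_integral (P f \<psi>) a = (2 * pi) ^ CARD('n) * distribution_of f (\<lambda>x. \<psi> (x + a))"
      if "f \<in> L2" "\<psi> \<in> test_functions" for f \<psi> a
      using fourier_integral_pairing[OF that] by (simp_all add: P_def[abs_def])
    define H where "H \<xi> = P v2 \<phi> \<xi> - P v2 (laplacian \<phi>) \<xi> + P v (laplacian (laplacian \<phi>)) \<xi>
      - P v (laplacian \<phi>) \<xi> + P v1 \<phi> \<xi>" for \<xi>
    have HL: "H \<in> L2" unfolding H_def[abs_def] by (intro L2_add L2_diff P(2) v \<phi> \<phi>1 \<phi>2)
    have Hi: "integrable lborel H"
      unfolding H_def[abs_def] by (intro Bochner_Integration.integrable_add Bochner_Integration.integrable_diff P(1) v \<phi> \<phi>1 \<phi>2)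
    have "fourier_integral H a = 0" for a
    proof -
      have \<phi>a: "(\<lambda>x. \<phi> (x + a)) \<in> test_functions" by (rule test_function_translate[OF \<phi>])
      have lap: "laplacian (\<lambda>x. \<phi> (x + a)) = (\<lambda>x. laplacian \<phi> (x + a))"
        "laplacian (\<lambda>x. laplacian \<phi> (x + a)) = (\<lambda>x. laplacian (laplacian \<phi>) (x + a))"
        using laplacian_translate[OF \<phi>] laplacian_translate[OF \<phi>1] by blast+
      have "distribution_of v2 (\<lambda>x. \<phi> (x + a)) - distribution_of v2 (\<lambda>x. laplacian \<phi> (x + a))
        + distribution_of v (\<lambda>x. laplacian (laplacian \<phi>) (x + a)) - distribution_of v (\<lambda>x. laplacian \<phi> (x + a))
        + distribution_of v1 (\<lambda>x. \<phi> (x + a)) = 0"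
        using eq[unfolded satisfies_equation_def dist_laplacian_def, rule_format, OF \<phi>a] by (simp add: lap)
      moreover have "fourier_integral H a = (2 * pi) ^ CARD('n) * (distribution_of v2 (\<lambda>x. \<phi> (x + a)) - distribution_of v2 (\<lambda>x. laplacian \<phi> (x + a))
        + distribution_of v (\<lambda>x. laplacian (laplacian \<phi>) (x + a)) - distribution_of v (\<lambda>x. laplacian \<phi> (x + a))
        + distribution_of v1 (\<lambda>x. \<phi> (x + a)))"
        unfolding H_def[abs_def]
        by (simp add: fourier_integral_add fourier_integral_diff P(1) P(3) v \<phi> \<phi>1 \<phi>2 distrib_left right_diff_distrib)
      ultimately show ?thesis by simp
    qed
    from fourier_integral_zero_imp_AE_zero[OF HL Hi this]
    show ?thesis
    proof eventually_elim
      case (elim \<xi>)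
      have "H \<xi> = S \<xi> * fourier_integral \<phi> (- \<xi>)"
        unfolding H_def P_def S_def
        by (simp add: fourier_integral_laplacian[OF \<phi>1] fourier_integral_laplacian[OF \<phi>] algebra_simps power2_eq_square)
      then show ?case using elim by simp
    qed
  qed
  have "AE \<xi> in lborel. \<forall>k::nat. S \<xi> * fourier_integral (bump (1 / real (Suc k))) (- \<xi>) = 0"
    unfolding AE_all_countable by (intro allI tested bump_test_function) simp
  then show ?thesis
  proof eventually_elim
    case (elim \<xi>)
    define k where "k = nat \<lceil>norm \<xi>\<rceil>"
    have "norm \<xi> \<le> real (Suc k)" unfolding k_def by linarith
    then have "fourier_integral (bump (1 / real (Suc k))) (- \<xi>) \<noteq> 0"
      by (intro fourier_integral_bump_nonzero) (auto simp: field_simps)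
    then show ?case using elim[rule_format, of k] by (simp add: S_def)
  qed
qed

section \<open>Differentiating along curves of square-integrable functions\<close>

text \<open>
  Strong differentiability with values in \<open>L\<^sup>2\<close>, one-sided at time \<open>0\<close>, matching
  \<^const>\<open>sobolev_deriv\<close> after the Fourier transform and multiplication with a weight.
\<close>

definition L2_deriv :: "(real \<Rightarrow> real ^ 'n \<Rightarrow> complex) \<Rightarrow> (real ^ 'n \<Rightarrow> complex) \<Rightarrow> real \<Rightarrow> bool" where
  "L2_deriv p p' t \<longleftrightarrow>
     ((\<lambda>\<tau>. L2_norm (\<lambda>\<xi>. (p \<tau> \<xi> - p t \<xi>) / complex_of_real (\<tau> - t) - p' \<xi>)) \<longlongrightarrow> 0) (at t within {0..})"

lemma eventually_at_within_nonneg: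
  "\<forall>\<^sub>F \<tau> in at t within {0..}. 0 \<le> \<tau> \<and> \<tau> \<noteq> (t::real)"
  by (auto simp: eventually_at_filter)

lemma L2_deriv_quotient_L2:
  assumes "\<And>\<tau>. 0 \<le> \<tau> \<Longrightarrow> p \<tau> \<in> L2" "0 \<le> t" "0 \<le> \<tau>"
  shows "(\<lambda>\<xi>. (p \<tau> \<xi> - p t \<xi>) / complex_of_real (\<tau> - t)) \<in> L2"
  using L2_scale[OF L2_diff[OF assms(1)[OF assms(3)] assms(1)[OF assms(2)]], of "1 / complex_of_real (\<tau> - t)"] by simp

lemma L2_deriv_add:
  assumes p: "\<And>\<tau>. 0 \<le> \<tau> \<Longrightarrow> p \<tau> \<in> L2" "p' \<in> L2" "L2_deriv p p' t"
    and q: "\<And>\<tau>. 0 \<le> \<tau> \<Longrightarrow> q \<tau> \<in> L2" "q' \<in> L2" "L2_deriv q q' t" and t: "0 \<le> t"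
  shows "L2_deriv (\<lambda>\<tau> \<xi>. p \<tau> \<xi> + q \<tau> \<xi>) (\<lambda>\<xi>. p' \<xi> + q' \<xi>) t"
proof -
  define D where "D r r' \<tau> \<xi> = (r \<tau> \<xi> - r t \<xi>) / complex_of_real (\<tau> - t) - r' \<xi>"
    for r :: "real \<Rightarrow> real ^ 'a \<Rightarrow> complex" and r' \<tau> \<xi>
  have lim: "((\<lambda>\<tau>. L2_norm (D p p' \<tau>) + L2_norm (D q q' \<tau>)) \<longlongrightarrow> 0) (at t within {0..})"
    using tendsto_add[OF p(3)[unfolded L2_deriv_def] q(3)[unfolded L2_deriv_def]] by (simp add: D_def[abs_def])
  have "((\<lambda>\<tau>. L2_norm (D (\<lambda>\<tau> \<xi>. p \<tau> \<xi> + q \<tau> \<xi>) (\<lambda>\<xi>. p' \<xi> + q' \<xi>) \<tau>)) \<longlongrightarrow> 0) (at t within {0..})"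
  proof (rule Lim_null_comparison[OF _ lim])
    show "\<forall>\<^sub>F \<tau> in at t within {0..}. norm (L2_norm (D (\<lambda>\<tau> \<xi>. p \<tau> \<xi> + q \<tau> \<xi>) (\<lambda>\<xi>. p' \<xi> + q' \<xi>) \<tau>))
       \<le> L2_norm (D p p' \<tau>) + L2_norm (D q q' \<tau>)"
      using eventually_at_within_nonneg[of t]
    proof eventually_elim
      case (elim \<tau>)
      have "D p p' \<tau> \<in> L2" unfolding D_def[abs_def]
        by (rule L2_diff[OF L2_deriv_quotient_L2[OF p(1) t] p(2)]) (use elim in auto)
      moreover have "D q q' \<tau> \<in> L2" unfolding D_def[abs_def]
        by (rule L2_diff[OF L2_deriv_quotient_L2[OF q(1) t] q(2)]) (use elim in auto)
      ultimately have "L2_norm (\<lambda>\<xi>. D p p' \<tau> \<xi> + D q q' \<tau> \<xi>) \<le> L2_norm (D p p' \<tau>) + L2_norm (D q q' \<tau>)"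
        by (rule L2_norm_triangle)
      then show ?case by (simp add: D_def[abs_def] add_divide_distrib diff_divide_distrib algebra_simps)
    qed
  qed
  then show ?thesis by (simp add: L2_deriv_def D_def[abs_def])
qed

text \<open>
  With the difference quotient \<open>Q\<close> one has \<open>|p(\<tau>)|\<^sup>2 - |p(t)|\<^sup>2 = 2 (\<tau> - t) Re (Q cnj p(t)) + (\<tau> - t)\<^sup>2 |Q|\<^sup>2\<close>
  pointwise. Since \<open>Q\<close> converges in norm, the first term has the expected limit after division by
  \<open>\<tau> - t\<close> and the second one disappears.
\<close>

lemma L2_norm_square_has_derivative:
  assumes p: "\<And>\<tau>. 0 \<le> \<tau> \<Longrightarrow> p \<tau> \<in> L2" and p': "p' \<in> L2" and d: "L2_deriv p p' t" and t: "0 \<le> t"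
  shows "((\<lambda>\<tau>. (L2_norm (p \<tau>))\<^sup>2) has_real_derivative 2 * Re (LINT \<xi>|lborel. p' \<xi> * cnj (p t \<xi>))) (at t within {0..})"
proof -
  define q where "q \<tau> \<xi> = (p \<tau> \<xi> - p t \<xi>) / complex_of_real (\<tau> - t)" for \<tau> \<xi>
  \<comment> \<open>At negative times nothing is known about \<open>p\<close>; a default value keeps every \<open>Q \<tau>\<close> in \<open>L\<^sup>2\<close>.\<close>
  define Q where "Q \<tau> = (if 0 \<le> \<tau> then q \<tau> else p')" for \<tau>
  have QL: "Q \<tau> \<in> L2" for \<tau>
    unfolding Q_def q_def[abs_def] using L2_deriv_quotient_L2[OF p t] p' by auto
  have ev: "\<forall>\<^sub>F \<tau> in at t within {0..}. 0 \<le> \<tau> \<and> \<tau> \<noteq> t" by (rule eventually_at_within_nonneg)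
  have Qlim: "((\<lambda>\<tau>. L2_norm (\<lambda>\<xi>. Q \<tau> \<xi> - p' \<xi>)) \<longlongrightarrow> 0) (at t within {0..})"
  proof (rule Lim_transform_eventually[OF d[unfolded L2_deriv_def]])
    show "\<forall>\<^sub>F \<tau> in at t within {0..}. L2_norm (\<lambda>\<xi>. (p \<tau> \<xi> - p t \<xi>) / complex_of_real (\<tau> - t) - p' \<xi>) = L2_norm (\<lambda>\<xi>. Q \<tau> \<xi> - p' \<xi>)"
      using ev by eventually_elim (simp add: Q_def q_def)
  qed
  have cp: "(\<lambda>\<xi>. cnj (p t \<xi>)) \<in> L2" by (rule L2_cnj[OF p[OF t]])
  have lim1: "((\<lambda>\<tau>. LINT \<xi>|lborel. Q \<tau> \<xi> * cnj (p t \<xi>)) \<longlongrightarrow> (LINT \<xi>|lborel. p' \<xi> * cnj (p t \<xi>))) (at t within {0..})"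
    by (rule L2_pairing_tendsto[OF QL p' cp Qlim])
  have lim2: "((\<lambda>\<tau>. (\<tau> - t) * (L2_norm (Q \<tau>))\<^sup>2) \<longlongrightarrow> 0) (at t within {0..})"
  proof (rule Lim_null_comparison)
    show "\<forall>\<^sub>F \<tau> in at t within {0..}. norm ((\<tau> - t) * (L2_norm (Q \<tau>))\<^sup>2) \<le> \<bar>\<tau> - t\<bar> * (L2_norm (\<lambda>\<xi>. Q \<tau> \<xi> - p' \<xi>) + L2_norm p')\<^sup>2"
    proof (intro always_eventually allI)
      fix \<tau>
      have "L2_norm (Q \<tau>) \<le> L2_norm (\<lambda>\<xi>. Q \<tau> \<xi> - p' \<xi>) + L2_norm p'"
        using L2_norm_triangle[OF L2_diff[OF QL p'] p', of \<tau>] by simp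
      then show "norm ((\<tau> - t) * (L2_norm (Q \<tau>))\<^sup>2) \<le> \<bar>\<tau> - t\<bar> * (L2_norm (\<lambda>\<xi>. Q \<tau> \<xi> - p' \<xi>) + L2_norm p')\<^sup>2"
        by (auto simp: abs_mult intro!: mult_left_mono power_mono)
    qed
    have "((\<lambda>\<tau>. \<bar>\<tau> - t\<bar> * (L2_norm (\<lambda>\<xi>. Q \<tau> \<xi> - p' \<xi>) + L2_norm p')\<^sup>2) \<longlongrightarrow> \<bar>t - t\<bar> * (0 + L2_norm p')\<^sup>2) (at t within {0..})"
      by (intro tendsto_intros Qlim)
    then show "((\<lambda>\<tau>. \<bar>\<tau> - t\<bar> * (L2_norm (\<lambda>\<xi>. Q \<tau> \<xi> - p' \<xi>) + L2_norm p')\<^sup>2) \<longlongrightarrow> 0) (at t within {0..})" by simp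
  qed
  have "((\<lambda>\<tau>. 2 * Re (LINT \<xi>|lborel. Q \<tau> \<xi> * cnj (p t \<xi>)) + (\<tau> - t) * (L2_norm (Q \<tau>))\<^sup>2) \<longlongrightarrow> 2 * Re (LINT \<xi>|lborel. p' \<xi> * cnj (p t \<xi>)) + 0) (at t within {0..})"
    by (intro tendsto_add tendsto_mult_left tendsto_Re lim1 lim2)
  moreover have "\<forall>\<^sub>F \<tau> in at t within {0..}. 2 * Re (LINT \<xi>|lborel. Q \<tau> \<xi> * cnj (p t \<xi>)) + (\<tau> - t) * (L2_norm (Q \<tau>))\<^sup>2
      = ((L2_norm (p \<tau>))\<^sup>2 - (L2_norm (p t))\<^sup>2) / (\<tau> - t)"
    using ev
  proof eventually_elim
    case (elim \<tau>)
    define h where "h = \<tau> - t"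
    have h: "h \<noteq> 0" using elim by (simp add: h_def)
    have pt: "p \<tau> \<xi> = p t \<xi> + complex_of_real h * Q \<tau> \<xi>" for \<xi>
      using elim h by (simp add: Q_def q_def h_def)
    have "(norm (p \<tau> \<xi>))\<^sup>2 = (norm (p t \<xi>))\<^sup>2 + ((2 * h) * Re (Q \<tau> \<xi> * cnj (p t \<xi>)) + h\<^sup>2 * (norm (Q \<tau> \<xi>))\<^sup>2)" for \<xi>
      unfolding pt cmod_power2 by (simp add: power2_eq_square algebra_simps)
    then have "(L2_norm (p \<tau>))\<^sup>2 = (LINT \<xi>|lborel. (norm (p t \<xi>))\<^sup>2 + ((2 * h) * Re (Q \<tau> \<xi> * cnj (p t \<xi>)) + h\<^sup>2 * (norm (Q \<tau> \<xi>))\<^sup>2))"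
      by (simp add: L2_norm_square)
    also have "\<dots> = (L2_norm (p t))\<^sup>2 + ((LINT \<xi>|lborel. (2 * h) * Re (Q \<tau> \<xi> * cnj (p t \<xi>))) + (LINT \<xi>|lborel. h\<^sup>2 * (norm (Q \<tau> \<xi>))\<^sup>2))"
      unfolding L2_norm_square
      by (subst Bochner_Integration.integral_add Bochner_Integration.integral_add;
        (intro Bochner_Integration.integrable_add integrable_mult_right integrable_Re L2_mult_integrable L2_integrable_square QL cp p t)?)+ simp
    also have "\<dots> = (L2_norm (p t))\<^sup>2 + ((2 * h) * Re (LINT \<xi>|lborel. Q \<tau> \<xi> * cnj (p t \<xi>)) + h\<^sup>2 * (L2_norm (Q \<tau>))\<^sup>2)"
      using integral_Re[OF L2_mult_integrable[OF QL cp], of \<tau>] by (simp only: integral_mult_right_zero L2_norm_square)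
    finally have "(L2_norm (p \<tau>))\<^sup>2 - (L2_norm (p t))\<^sup>2 = (2 * Re (LINT \<xi>|lborel. Q \<tau> \<xi> * cnj (p t \<xi>)) + h * (L2_norm (Q \<tau>))\<^sup>2) * h"
      by (simp add: algebra_simps power2_eq_square)
    then show ?case using h by (simp add: h_def[symmetric])
  qed
  ultimately have "((\<lambda>\<tau>. ((L2_norm (p \<tau>))\<^sup>2 - (L2_norm (p t))\<^sup>2) / (\<tau> - t)) \<longlongrightarrow> 2 * Re (LINT \<xi>|lborel. p' \<xi> * cnj (p t \<xi>))) (at t within {0..})"
    by (simp add: Lim_transform_eventually)
  then show ?thesis by (simp add: has_field_derivative_iff)
qed

lemma sobolev_imp_L2: "f \<in> sobolev s \<Longrightarrow> f \<in> L2"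
  by (simp add: sobolev_def)

lemma sobolev_1_multiplier:
  fixes f :: "real ^ 'n \<Rightarrow> complex"
  assumes f: "f \<in> sobolev 1" and [measurable]: "m \<in> borel_measurable borel"
    and m: "\<And>\<xi>. (norm (m \<xi>))\<^sup>2 \<le> C * (1 + (norm \<xi>)\<^sup>2)"
  shows "(\<lambda>\<xi>. m \<xi> * fourier f \<xi>) \<in> L2" "L2_norm (\<lambda>\<xi>. m \<xi> * fourier f \<xi>) \<le> sqrt C * sobolev_norm 1 f"
proof -
  have C: "0 \<le> C"
    using order_trans[OF zero_le_power2 m[of 0]] by simp
  define J where "J \<xi> = complex_of_real (sqrt (1 + (norm \<xi>)\<^sup>2)) * fourier f \<xi>" for \<xi>
  have [measurable]: "fourier f \<in> borel_measurable borel"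
    by (intro L2_measurable fourier_L2 sobolev_imp_L2[OF f])
  have Jsq: "(norm (J \<xi>))\<^sup>2 = (1 + (norm \<xi>)\<^sup>2) powr 1 * (norm (fourier f \<xi>))\<^sup>2" for \<xi>
    by (simp add: J_def norm_mult power_mult_distrib add_nonneg_nonneg)
  have "J \<in> borel_measurable borel" unfolding J_def[abs_def] by measurable
  then have J: "J \<in> L2" using f by (simp add: L2_def Jsq sobolev_def)
  have Jn: "L2_norm J = sobolev_norm 1 f" by (simp add: L2_norm_def Jsq sobolev_norm_def)
  have "norm (m \<xi> * fourier f \<xi>) \<le> sqrt C * norm (J \<xi>)" for \<xi>
  proof -
    have "norm (m \<xi>) \<le> sqrt (C * (1 + (norm \<xi>)\<^sup>2))" using m by (rule real_le_rsqrt)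
    then have "norm (m \<xi>) * norm (fourier f \<xi>) \<le> sqrt (C * (1 + (norm \<xi>)\<^sup>2)) * norm (fourier f \<xi>)"
      by (rule mult_right_mono) simp
    then show ?thesis by (simp add: J_def norm_mult real_sqrt_mult mult.assoc)
  qed
  then have dom: "AE \<xi> in lborel. norm (m \<xi> * fourier f \<xi>) \<le> sqrt C * norm (J \<xi>)" by simp
  have meas: "(\<lambda>\<xi>. m \<xi> * fourier f \<xi>) \<in> borel_measurable borel" by measurable
  show "(\<lambda>\<xi>. m \<xi> * fourier f \<xi>) \<in> L2" "L2_norm (\<lambda>\<xi>. m \<xi> * fourier f \<xi>) \<le> sqrt C * sobolev_norm 1 f"
    using L2_dominated[OF J meas dom] C by (simp_all add: Jn)
qed

text \<open>
  A Fourier multiplier of growth at most \<open>(1 + |\<xi>|\<^sup>2)\<^sup>1\<^sup>/\<^sup>2\<close> turns differentiability in \<open>H\<^sup>1\<close> into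
  differentiability in \<open>L\<^sup>2\<close>. The transform is linear only up to null sets, so the difference
  quotients on both sides agree almost everywhere.
\<close>

lemma sobolev_deriv_multiplier:
  fixes u w :: "real \<Rightarrow> real ^ 'n \<Rightarrow> complex"
  assumes d: "sobolev_deriv 1 u w" and [measurable]: "m \<in> borel_measurable borel"
    and m: "\<And>\<xi>. (norm (m \<xi>))\<^sup>2 \<le> C * (1 + (norm \<xi>)\<^sup>2)" and t: "0 \<le> t"
  shows "L2_deriv (\<lambda>\<tau> \<xi>. m \<xi> * fourier (u \<tau>) \<xi>) (\<lambda>\<xi>. m \<xi> * fourier (w t) \<xi>) t"
proof -
  have u: "u \<tau> \<in> sobolev 1" if "0 \<le> \<tau>" for \<tau> using d that by (simp add: sobolev_deriv_def)
  have w: "w t \<in> sobolev 1" using d t by (simp add: sobolev_deriv_def)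
  have lim: "((\<lambda>\<tau>. sqrt C * sobolev_norm 1 (\<lambda>x. (u \<tau> x - u t x) / complex_of_real (\<tau> - t) - w t x)) \<longlongrightarrow> sqrt C * 0) (at t within {0..})"
    using d t by (intro tendsto_mult_left) (simp add: sobolev_deriv_def)
  show ?thesis unfolding L2_deriv_def
  proof (rule Lim_null_comparison[OF _ lim[unfolded mult_zero_right]])
    show "\<forall>\<^sub>F \<tau> in at t within {0..}. norm (L2_norm (\<lambda>\<xi>. (m \<xi> * fourier (u \<tau>) \<xi> - m \<xi> * fourier (u t) \<xi>) / complex_of_real (\<tau> - t) - m \<xi> * fourier (w t) \<xi>))
        \<le> sqrt C * sobolev_norm 1 (\<lambda>x. (u \<tau> x - u t x) / complex_of_real (\<tau> - t) - w t x)"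
      using eventually_at_within_nonneg[of t]
    proof eventually_elim
      case (elim \<tau>)
      define c where "c = 1 / complex_of_real (\<tau> - t)"
      define g where "g x = (u \<tau> x - u t x) / complex_of_real (\<tau> - t) - w t x" for x
      have U: "u \<tau> \<in> L2" "u t \<in> L2" "w t \<in> L2" using u w elim t by (auto intro: sobolev_imp_L2)
      have g: "g = (\<lambda>x. 1 * (c * u \<tau> x + (- c) * u t x) + (- 1) * w t x)"
        by (simp add: g_def[abs_def] c_def diff_divide_distrib)
      have U12: "(\<lambda>x. c * u \<tau> x + (- c) * u t x) \<in> L2" by (intro L2_add L2_scale U)
      have AE: "AE \<xi> in lborel. fourier g \<xi> = c * (fourier (u \<tau>) \<xi> - fourier (u t) \<xi>) - fourier (w t) \<xi>"
        using fourier_linear[OF U12 U(3), of 1 "-1"] fourier_linear[OF U(1,2), of c "-c"]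
        unfolding g
      proof eventually_elim
        case (elim \<xi>)
        show ?case unfolding elim(1) elim(2) by (simp add: algebra_simps)
      qed
      have gL: "g \<in> L2" unfolding g by (intro L2_add L2_scale U)
      have FL: "fourier g \<in> L2" "fourier (u \<tau>) \<in> L2" "fourier (u t) \<in> L2" "fourier (w t) \<in> L2"
        by (intro fourier_L2 gL U)+
      note [measurable] = FL[THEN L2_measurable]
      define m0 where "m0 \<xi> = complex_of_real (sqrt (1 + (norm \<xi>)\<^sup>2))" for \<xi> :: "real ^ 'n"
      have m0_meas [measurable]: "m0 \<in> borel_measurable borel" unfolding m0_def[abs_def] by measurable
      have m0: "(norm (m0 \<xi>))\<^sup>2 = 1 + (norm \<xi>)\<^sup>2" for \<xi> by (simp add: m0_def)
      have P: "(\<lambda>\<xi>. m0 \<xi> * fourier f \<xi>) \<in> L2" if "f \<in> sobolev 1" for f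
        by (rule sobolev_1_multiplier(1)[OF that m0_meas, of 1]) (simp add: m0)
      have "(\<lambda>\<xi>. c * (m0 \<xi> * fourier (u \<tau>) \<xi> - m0 \<xi> * fourier (u t) \<xi>) - m0 \<xi> * fourier (w t) \<xi>) \<in> L2"
        using elim t by (intro L2_diff L2_scale P u w) auto
      then have "(\<lambda>\<xi>. m0 \<xi> * fourier g \<xi>) \<in> L2"
      proof (rule L2_dominated(1)[where C=1])
        show "AE \<xi> in lborel. norm (m0 \<xi> * fourier g \<xi>)
          \<le> 1 * norm (c * (m0 \<xi> * fourier (u \<tau>) \<xi> - m0 \<xi> * fourier (u t) \<xi>) - m0 \<xi> * fourier (w t) \<xi>)"
          using AE
        proof eventually_elim
          case (elim \<xi>)
          have "m0 \<xi> * fourier g \<xi> = c * (m0 \<xi> * fourier (u \<tau>) \<xi> - m0 \<xi> * fourier (u t) \<xi>) - m0 \<xi> * fourier (w t) \<xi>"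
            unfolding elim by (simp add: right_diff_distrib mult_ac)
          then show ?case by simp
        qed
      qed simp_all
      then have "integrable lborel (\<lambda>\<xi>. (1 + (norm \<xi>)\<^sup>2) powr 1 * (norm (fourier g \<xi>))\<^sup>2)"
        using L2_integrable_square by (fastforce simp: norm_mult power_mult_distrib m0 add_nonneg_nonneg)
      then have gS: "g \<in> sobolev 1" using gL by (simp add: sobolev_def)
      have "L2_norm (\<lambda>\<xi>. (m \<xi> * fourier (u \<tau>) \<xi> - m \<xi> * fourier (u t) \<xi>) / complex_of_real (\<tau> - t) - m \<xi> * fourier (w t) \<xi>)
          = L2_norm (\<lambda>\<xi>. m \<xi> * fourier g \<xi>)"
      proof (rule L2_norm_cong_AE)
        show "AE \<xi> in lborel. (m \<xi> * fourier (u \<tau>) \<xi> - m \<xi> * fourier (u t) \<xi>) / complex_of_real (\<tau> - t) - m \<xi> * fourier (w t) \<xi> = m \<xi> * fourier g \<xi>"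
          using AE
        proof eventually_elim
          case (elim \<xi>)
          show ?case unfolding elim by (simp add: c_def diff_divide_distrib right_diff_distrib)
        qed
      qed measurable
      then show ?case
        using sobolev_1_multiplier(2)[OF gS _ m] by (simp add: g_def[abs_def])
    qed
  qed
qed

section \<open>Energy decay\<close>

text \<open>
  On the Fourier side the equation reads \<open>v'' + a v' + |\<xi>|\<^sup>2 v = 0\<close> with the friction coefficient
  \<open>a = damping \<xi>\<close>, which is small at high frequencies.
\<close>

definition damping :: "real ^ 'n \<Rightarrow> real" where
  "damping \<xi> = 1 / (1 + (norm \<xi>)\<^sup>2)"

text \<open>
  Comparable to \<open>|\<xi>|\<^sup>2\<close> for small and to \<open>1 / |\<xi>|\<^sup>2\<close> for large frequencies: the diffusion of the
  low modes and the loss of regularity of the high ones.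
\<close>

definition decay_rate :: "real ^ 'n \<Rightarrow> real" where
  "decay_rate \<xi> = (norm \<xi>)\<^sup>2 * (damping \<xi>)\<^sup>2 / 2"

text \<open>
  The physical energy \<open>|v'|\<^sup>2 + |\<xi>|\<^sup>2 |v|\<^sup>2\<close> of \<open>y = v\<close>, \<open>x = v'\<close> is only dissipated through \<open>v'\<close>. Adding
  \<open>a Re (v' cnj v) + a\<^sup>2 |v|\<^sup>2 / 2\<close> repairs this; the sum is written here as a sum of squares.
\<close>

definition energy :: "real ^ 'n \<Rightarrow> complex \<Rightarrow> complex \<Rightarrow> real" where
  "energy \<xi> y x = (norm (x + complex_of_real (damping \<xi> / 2) * y))\<^sup>2
     + ((norm \<xi>)\<^sup>2 + (damping \<xi>)\<^sup>2 / 4) * (norm y)\<^sup>2"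

lemma damping_measurable [measurable]: "damping \<in> borel_measurable borel"
  unfolding damping_def[abs_def] by measurable

lemma decay_rate_measurable [measurable]: "decay_rate \<in> borel_measurable borel"
  unfolding decay_rate_def[abs_def] by measurable

lemma energy_measurable [measurable]:
  assumes [measurable]: "f \<in> borel_measurable borel" "g \<in> borel_measurable borel"
  shows "(\<lambda>\<xi>. energy \<xi> (f \<xi>) (g \<xi>)) \<in> borel_measurable borel"
  unfolding energy_def[abs_def] by measurable

lemma damping_bounds: "0 < damping \<xi>" "damping \<xi> \<le> 1" "(norm \<xi>)\<^sup>2 * damping \<xi> \<le> 1"
    "(1 + (norm \<xi>)\<^sup>2) * damping \<xi> = 1"
proof -
  have "0 < 1 + (norm \<xi>)\<^sup>2" by (simp add: add_pos_nonneg)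
  then show "0 < damping \<xi>" "damping \<xi> \<le> 1" "(norm \<xi>)\<^sup>2 * damping \<xi> \<le> 1" "(1 + (norm \<xi>)\<^sup>2) * damping \<xi> = 1"
    by (simp_all add: damping_def)
qed

lemma energy_expand:
  "energy \<xi> y x = (norm x)\<^sup>2 + damping \<xi> * Re (x * cnj y) + ((norm \<xi>)\<^sup>2 + (damping \<xi>)\<^sup>2 / 2) * (norm y)\<^sup>2"
  unfolding energy_def cmod_power2 by (simp add: power2_eq_square algebra_simps)

lemma energy_upper: "energy \<xi> y x \<le> 3 / 2 * (norm x)\<^sup>2 + ((norm \<xi>)\<^sup>2 + (damping \<xi>)\<^sup>2) * (norm y)\<^sup>2"
proof -
  have "0 \<le> (norm (x - complex_of_real (damping \<xi>) * y))\<^sup>2" by simp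
  also have "\<dots> = (norm x)\<^sup>2 - 2 * (damping \<xi> * Re (x * cnj y)) + (damping \<xi>)\<^sup>2 * (norm y)\<^sup>2"
    unfolding cmod_power2 by (simp add: power2_eq_square algebra_simps)
  finally show ?thesis unfolding energy_expand by (simp add: algebra_simps)
qed

lemma energy_lower: "(1 + (norm \<xi>)\<^sup>2) / 32 * (norm y)\<^sup>2 \<le> energy \<xi> y x"
proof -
  have "(1 + (norm \<xi>)\<^sup>2) / 32 \<le> (norm \<xi>)\<^sup>2 + (damping \<xi>)\<^sup>2 / 4"
  proof (cases "(norm \<xi>)\<^sup>2 \<le> 1")
    case True
    then have "1 / 2 \<le> damping \<xi>" unfolding damping_def by (intro divide_left_mono) (auto simp: add_pos_nonneg)
    then have "(1 / 2)\<^sup>2 \<le> (damping \<xi>)\<^sup>2" by (intro power_mono) auto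
    then have d: "1 / 4 \<le> (damping \<xi>)\<^sup>2" by (simp add: power2_eq_square)
    have "(1 + r) / 32 \<le> r + d / 4" if "1 / 4 \<le> d" "0 \<le> r" for r d :: real
      using that by (simp add: field_simps)
    then show ?thesis using d zero_le_power2 by blast
  next
    case False
    have "(1 + r) / 32 \<le> r + d / 4" if "1 < r" "0 \<le> d" for r d :: real
      using that by (simp add: field_simps)
    then show ?thesis using False zero_le_power2[of "damping \<xi>"] by (meson not_le)
  qed
  then have "(1 + (norm \<xi>)\<^sup>2) / 32 * (norm y)\<^sup>2 \<le> ((norm \<xi>)\<^sup>2 + (damping \<xi>)\<^sup>2 / 4) * (norm y)\<^sup>2"
    by (intro mult_right_mono) auto
  also have "\<dots> \<le> energy \<xi> y x" by (simp add: energy_def)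
  finally show ?thesis .
qed

lemma energy_initial: "energy \<xi> y x \<le> 3 / 2 * ((norm x)\<^sup>2 + (1 + (norm \<xi>)\<^sup>2) * (norm y)\<^sup>2)"
proof -
  have "(damping \<xi>)\<^sup>2 \<le> 1" using damping_bounds[of \<xi>] by (simp add: power_le_one)
  then have "((norm \<xi>)\<^sup>2 + (damping \<xi>)\<^sup>2) * (norm y)\<^sup>2 \<le> (1 + (norm \<xi>)\<^sup>2) * (norm y)\<^sup>2"
    by (intro mult_right_mono) auto
  moreover have "0 \<le> (1 + (norm \<xi>)\<^sup>2) * (norm y)\<^sup>2" by simp
  ultimately show ?thesis using energy_upper[of \<xi> y x] by argo
qed

text \<open>
  The left side is the time derivative of the energy. The mixed terms cancel and it equals
  \<open>- a (|x|\<^sup>2 + |\<xi>|\<^sup>2 |y|\<^sup>2)\<close>, which is compared with the upper bound of the energy using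
  \<open>a \<le> 1\<close> and \<open>|\<xi>|\<^sup>2 a \<le> 1\<close>.
\<close>

lemma energy_dissipation:
  fixes x y z :: complex
  assumes z: "z = - complex_of_real (damping \<xi>) * x - complex_of_real ((norm \<xi>)\<^sup>2) * y"
  shows "2 * Re ((z + complex_of_real (damping \<xi> / 2) * x) * cnj (x + complex_of_real (damping \<xi> / 2) * y))
    + 2 * (((norm \<xi>)\<^sup>2 + (damping \<xi>)\<^sup>2 / 4) * Re (x * cnj y)) \<le> - decay_rate \<xi> * energy \<xi> y x"
proof -
  define a r where "a = damping \<xi>" and "r = (norm \<xi>)\<^sup>2"
  have a: "0 < a" "a \<le> 1" "r * a \<le> 1" and r: "0 \<le> r"
    using damping_bounds[of \<xi>] by (auto simp: a_def r_def)
  define k where "k = r * a\<^sup>2 / 2"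
  have k: "k = decay_rate \<xi>" by (simp add: k_def a_def r_def decay_rate_def)
  have k0: "0 \<le> k" using r by (simp add: k_def)
  have "2 * Re ((z + complex_of_real (a / 2) * x) * cnj (x + complex_of_real (a / 2) * y))
      + 2 * ((r + a\<^sup>2 / 4) * Re (x * cnj y)) = - (a * (norm x)\<^sup>2 + (a * r) * (norm y)\<^sup>2)"
    unfolding z a_def[symmetric] r_def[symmetric] cmod_power2 by (simp add: power2_eq_square field_simps)
  moreover have "k * energy \<xi> y x \<le> a * (norm x)\<^sup>2 + (a * r) * (norm y)\<^sup>2"
  proof -
    have "k * energy \<xi> y x \<le> k * (3 / 2 * (norm x)\<^sup>2 + (r + a\<^sup>2) * (norm y)\<^sup>2)"
      using energy_upper[of \<xi> y x] k0 by (intro mult_left_mono) (auto simp: a_def r_def)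
    also have "\<dots> = (k * (3 / 2)) * (norm x)\<^sup>2 + (k * (r + a\<^sup>2)) * (norm y)\<^sup>2" by (simp add: algebra_simps)
    also have "\<dots> \<le> a * (norm x)\<^sup>2 + (a * r) * (norm y)\<^sup>2"
    proof (intro add_mono mult_right_mono)
      have "(r * a) * a \<le> 1 * a" using a by (intro mult_right_mono) auto
      then have "k * 2 \<le> a" by (simp add: k_def power2_eq_square mult_ac)
      then show "k * (3 / 2) \<le> a" using k0 by simp
      have "a * a\<^sup>2 \<le> 1 * 1" using a by (intro mult_mono power_le_one) auto
      then have "r * a + a * a\<^sup>2 \<le> 2" using a by simp
      then have "(a * r / 2) * (r * a + a * a\<^sup>2) \<le> (a * r / 2) * 2" using a r by (intro mult_left_mono) auto
      then show "k * (r + a\<^sup>2) \<le> a * r" by (simp add: k_def power2_eq_square algebra_simps)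
    qed auto
    finally show ?thesis .
  qed
  ultimately show ?thesis by (simp add: a_def[symmetric] r_def[symmetric] k)
qed

text \<open>
  For a fixed time the transform is determined only up to a null set of frequencies, so the
  differential inequality cannot be integrated in time frequency by frequency. It holds for the energy
  contained in a set of frequencies, and a common lower bound \<open>c\<close> of the rate on that set gives
  Gronwall's inequality with constant \<open>c\<close>.
\<close>

lemma energy_decay_on_set:
  fixes u ut utt :: "real \<Rightarrow> real ^ 'n \<Rightarrow> complex"
  assumes d1: "sobolev_deriv 1 u ut" and d2: "sobolev_deriv 1 ut utt"
    and eq: "\<forall>t>0. satisfies_equation (u t) (ut t) (utt t)"
    and A [measurable]: "A \<in> sets borel" and c: "\<forall>\<xi>\<in>A. c \<le> decay_rate \<xi>" and T: "0 \<le> T"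
  defines "en \<equiv> \<lambda>t \<xi>. indicator A \<xi> * energy \<xi> (fourier (u t) \<xi>) (fourier (ut t) \<xi>)"
  shows "\<And>t. 0 \<le> t \<Longrightarrow> integrable lborel (en t)"
    and "(LINT \<xi>|lborel. en T \<xi>) \<le> exp (- c * T) * (LINT \<xi>|lborel. en 0 \<xi>)"
proof -
  have S: "u t \<in> sobolev 1" "ut t \<in> sobolev 1" "utt t \<in> sobolev 1" if "0 \<le> t" for t
    using d1 d2 that by (auto simp: sobolev_deriv_def)
  define a where "a \<xi> = complex_of_real (damping \<xi> / 2)" for \<xi> :: "real ^ 'n"
  define m where "m \<xi> = complex_of_real (sqrt ((norm \<xi>)\<^sup>2 + (damping \<xi>)\<^sup>2 / 4))" for \<xi> :: "real ^ 'n"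
  define X where "X \<xi> = (indicator A \<xi> :: complex)" for \<xi>
  have Xm: "X \<in> borel_measurable borel" unfolding X_def[abs_def] by measurable
  have Xam: "(\<lambda>\<xi>. X \<xi> * a \<xi>) \<in> borel_measurable borel" unfolding X_def[abs_def] a_def[abs_def] by measurable
  have Xmm: "(\<lambda>\<xi>. X \<xi> * m \<xi>) \<in> borel_measurable borel" unfolding X_def[abs_def] m_def[abs_def] by measurable
  have m2: "(norm (m \<xi>))\<^sup>2 = (norm \<xi>)\<^sup>2 + (damping \<xi>)\<^sup>2 / 4" for \<xi>
    by (simp add: m_def)
  have d2le: "(damping \<xi>)\<^sup>2 \<le> 1" for \<xi> :: "real ^ 'n" using damping_bounds[of \<xi>] by (simp add: power_le_one)
  have X2: "(norm (X \<xi>))\<^sup>2 \<le> 1" for \<xi> by (simp add: X_def indicator_def)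
  have bX: "(norm (X \<xi>))\<^sup>2 \<le> 1 * (1 + (norm \<xi>)\<^sup>2)" for \<xi>
    by (rule order_trans[OF X2]) simp
  have bXa: "(norm (X \<xi> * a \<xi>))\<^sup>2 \<le> 1 * (1 + (norm \<xi>)\<^sup>2)" for \<xi>
  proof -
    have "(norm (X \<xi> * a \<xi>))\<^sup>2 \<le> 1 * ((damping \<xi>)\<^sup>2 / 4)"
      unfolding norm_mult power_mult_distrib a_def by (intro mult_mono X2) (auto simp: power_divide)
    also have "\<dots> \<le> 1 * (1 + (norm \<xi>)\<^sup>2)"
      using d2le[of \<xi>] zero_le_power2[of "norm \<xi>"] unfolding mult_1_left by linarith
    finally show ?thesis .
  qed
  have bXm: "(norm (X \<xi> * m \<xi>))\<^sup>2 \<le> 1 * (1 + (norm \<xi>)\<^sup>2)" for \<xi>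
  proof -
    have "(norm (X \<xi> * m \<xi>))\<^sup>2 \<le> 1 * ((norm \<xi>)\<^sup>2 + (damping \<xi>)\<^sup>2 / 4)"
      unfolding norm_mult power_mult_distrib m2 by (intro mult_mono X2) auto
    also have "\<dots> \<le> 1 * (1 + (norm \<xi>)\<^sup>2)"
      using d2le[of \<xi>] zero_le_power2[of "norm \<xi>"] unfolding mult_1_left by linarith
    finally show ?thesis .
  qed
  define p where "p t \<xi> = X \<xi> * fourier (ut t) \<xi> + X \<xi> * a \<xi> * fourier (u t) \<xi>" for t \<xi>
  define q where "q t \<xi> = X \<xi> * m \<xi> * fourier (u t) \<xi>" for t \<xi>
  define p' where "p' t \<xi> = X \<xi> * fourier (utt t) \<xi> + X \<xi> * a \<xi> * fourier (ut t) \<xi>" for t \<xi>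
  define q' where "q' t \<xi> = X \<xi> * m \<xi> * fourier (ut t) \<xi>" for t \<xi>
  note mult_L2 = sobolev_1_multiplier(1)[OF _ Xm bX] sobolev_1_multiplier(1)[OF _ Xam bXa] sobolev_1_multiplier(1)[OF _ Xmm bXm]
  have pL: "p t \<in> L2" if "0 \<le> t" for t
    unfolding p_def[abs_def] by (rule L2_add[OF mult_L2(1)[OF S(2)[OF that]] mult_L2(2)[OF S(1)[OF that]]])
  have qL: "q t \<in> L2" if "0 \<le> t" for t
    unfolding q_def[abs_def] by (rule mult_L2(3)[OF S(1)[OF that]])
  have p'L: "p' t \<in> L2" if "0 \<le> t" for t
    unfolding p'_def[abs_def] by (rule L2_add[OF mult_L2(1)[OF S(3)[OF that]] mult_L2(2)[OF S(2)[OF that]]])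
  have q'L: "q' t \<in> L2" if "0 \<le> t" for t
    unfolding q'_def[abs_def] by (rule mult_L2(3)[OF S(2)[OF that]])
  have dp: "L2_deriv p (p' t) t" if "0 \<le> t" for t
    unfolding p_def[abs_def] p'_def[abs_def]
    by (rule L2_deriv_add[OF mult_L2(1)[OF S(2)] mult_L2(1)[OF S(3)[OF that]] sobolev_deriv_multiplier[OF d2 Xm bX that]
          mult_L2(2)[OF S(1)] mult_L2(2)[OF S(2)[OF that]] sobolev_deriv_multiplier[OF d1 Xam bXa that] that])
  have dq: "L2_deriv q (q' t) t" if "0 \<le> t" for t
    unfolding q_def[abs_def] q'_def[abs_def]
    by (rule sobolev_deriv_multiplier[OF d1 Xmm bXm that])
  have en_eq: "en t \<xi> = (norm (p t \<xi>))\<^sup>2 + (norm (q t \<xi>))\<^sup>2" for t \<xi>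
    by (simp add: en_def energy_def p_def q_def X_def a_def norm_mult power_mult_distrib m2 indicator_def)
  show en_int: "integrable lborel (en t)" if "0 \<le> t" for t
    unfolding en_eq[abs_def] using pL[OF that] qL[OF that]
    by (intro Bochner_Integration.integrable_add L2_integrable_square)
  define F where "F t = (L2_norm (p t))\<^sup>2 + (L2_norm (q t))\<^sup>2" for t
  have F_en: "F t = (LINT \<xi>|lborel. en t \<xi>)" if "0 \<le> t" for t
    unfolding en_eq F_def L2_norm_square using pL[OF that] qL[OF that]
    by (intro Bochner_Integration.integral_add[symmetric] L2_integrable_square)
  define F' where "F' t = 2 * Re (LINT \<xi>|lborel. p' t \<xi> * cnj (p t \<xi>)) + 2 * Re (LINT \<xi>|lborel. q' t \<xi> * cnj (q t \<xi>))" for t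
  have dF: "(F has_real_derivative F' t) (at t within {0..})" if "0 \<le> t" for t
    unfolding F_def[abs_def] F'_def
    by (intro DERIV_add L2_norm_square_has_derivative pL qL p'L q'L dp dq that)
  have F'_le: "F' t \<le> - c * F t" if t: "0 < t" for t
  proof -
    have t0: "0 \<le> t" using t by simp
    have i1: "integrable lborel (\<lambda>\<xi>. p' t \<xi> * cnj (p t \<xi>))" and i2: "integrable lborel (\<lambda>\<xi>. q' t \<xi> * cnj (q t \<xi>))"
      by (intro L2_mult_integrable L2_cnj p'L q'L pL qL t0)+
    have "AE \<xi> in lborel. 2 * Re (p' t \<xi> * cnj (p t \<xi>)) + 2 * Re (q' t \<xi> * cnj (q t \<xi>)) \<le> - c * en t \<xi>"
      using satisfies_equation_fourier[OF S(1)[OF t0, THEN sobolev_imp_L2] S(2)[OF t0, THEN sobolev_imp_L2] S(3)[OF t0, THEN sobolev_imp_L2] eq[rule_format, OF t]]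
    proof eventually_elim
      case (elim \<xi>)
      show ?case
      proof (cases "\<xi> \<in> A")
        case False
        then show ?thesis by (simp add: p'_def q'_def en_def X_def)
      next
        case True
        define x y z where "x = fourier (ut t) \<xi>" and "y = fourier (u t) \<xi>" and "z = fourier (utt t) \<xi>"
        define s where "s = complex_of_real (1 + (norm \<xi>)\<^sup>2)"
        have sd: "complex_of_real (damping \<xi>) * s = 1"
          using damping_bounds(4)[of \<xi>] unfolding s_def of_real_mult[symmetric] by (simp only: mult.commute of_real_1)
        have "s * z + complex_of_real ((norm \<xi>)\<^sup>2) * s * y + x = 0"
          using elim by (simp add: x_def y_def z_def s_def)
        then have "complex_of_real (damping \<xi>) * (s * z + complex_of_real ((norm \<xi>)\<^sup>2) * s * y + x) = 0" by simp
        then have "(complex_of_real (damping \<xi>) * s) * z + complex_of_real ((norm \<xi>)\<^sup>2) * (complex_of_real (damping \<xi>) * s) * y + complex_of_real (damping \<xi>) * x = 0"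
          by (simp only: distrib_left mult_ac)
        then have "z + complex_of_real ((norm \<xi>)\<^sup>2) * y + complex_of_real (damping \<xi>) * x = 0"
          by (simp only: sd mult_1_left mult_1_right)
        then have z: "z = - complex_of_real (damping \<xi>) * x - complex_of_real ((norm \<xi>)\<^sup>2) * y"
          by algebra
        have mm: "Re (m \<xi> * x * cnj (m \<xi> * y)) = ((norm \<xi>)\<^sup>2 + (damping \<xi>)\<^sup>2 / 4) * Re (x * cnj y)"
        proof -
          have "m \<xi> * x * cnj (m \<xi> * y) = complex_of_real ((norm (m \<xi>))\<^sup>2) * (x * cnj y)"
            unfolding complex_norm_square complex_cnj_mult by (simp only: mult_ac)
          moreover have "Re (complex_of_real b * w) = b * Re w" for b w by simp
          ultimately show ?thesis by (simp only: m2)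
        qed
        have "2 * Re (p' t \<xi> * cnj (p t \<xi>)) + 2 * Re (q' t \<xi> * cnj (q t \<xi>)) \<le> - decay_rate \<xi> * energy \<xi> y x"
          using energy_dissipation[OF z] True
          by (simp only: p_def p'_def q_def q'_def X_def indicator_simps mult_1_left mm x_def[symmetric] y_def[symmetric] z_def[symmetric] a_def)
        also have "\<dots> \<le> - c * energy \<xi> y x"
          using c[rule_format, OF True] by (intro mult_right_mono) (auto simp: energy_def)
        finally show ?thesis using True by (simp add: en_def x_def y_def)
      qed
    qed
    then have "(LINT \<xi>|lborel. 2 * Re (p' t \<xi> * cnj (p t \<xi>)) + 2 * Re (q' t \<xi> * cnj (q t \<xi>))) \<le> (LINT \<xi>|lborel. - c * en t \<xi>)"
      by (intro integral_mono_AE Bochner_Integration.integrable_add integrable_mult_right integrable_Re i1 i2 en_int[OF t0])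
    also have "(LINT \<xi>|lborel. - c * en t \<xi>) = - c * F t"
      unfolding F_en[OF t0] by (rule integral_mult_right_zero)
    also have "(LINT \<xi>|lborel. 2 * Re (p' t \<xi> * cnj (p t \<xi>)) + 2 * Re (q' t \<xi> * cnj (q t \<xi>))) = F' t"
      unfolding F'_def integral_Re[OF i1, symmetric] integral_Re[OF i2, symmetric] integral_mult_right_zero[symmetric]
      by (intro Bochner_Integration.integral_add integrable_mult_right integrable_Re i1 i2)
    finally show ?thesis .
  qed
  define g where "g t = exp (c * t) * F t" for t
  have "g T \<le> g 0"
  proof (rule DERIV_nonpos_imp_decreasing_open[OF T])
    have dg: "(g has_real_derivative exp (c * t) * c * F t + exp (c * t) * F' t) (at t within {0..})" if "0 \<le> t" for t
      unfolding g_def[abs_def] by (auto intro!: derivative_eq_intros dF[OF that])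
    show "continuous_on {0..T} g"
      unfolding continuous_on_eq_continuous_within
      by (intro ballI continuous_within_subset[OF DERIV_continuous[OF dg]]) auto
    show "\<exists>y. (g has_real_derivative y) (at t) \<and> y \<le> 0" if "0 < t" "t < T" for t
    proof (intro exI conjI)
      have "at t within {0..} = at t" using that by (intro at_within_interior) simp
      then show "(g has_real_derivative exp (c * t) * c * F t + exp (c * t) * F' t) (at t)"
        using dg[of t] that by simp
      have "exp (c * t) * F' t \<le> exp (c * t) * (- c * F t)" by (intro mult_left_mono F'_le that) auto
      then show "exp (c * t) * c * F t + exp (c * t) * F' t \<le> 0" by (simp add: algebra_simps)
    qed
  qed
  then have "exp (c * T) * F T \<le> F 0" by (simp add: g_def)
  then have "exp (- c * T) * (exp (c * T) * F T) \<le> exp (- c * T) * F 0" by (intro mult_left_mono) auto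
  then have "F T \<le> exp (- c * T) * F 0" by (simp add: mult.assoc[symmetric] exp_add[symmetric])
  then show "(LINT \<xi>|lborel. en T \<xi>) \<le> exp (- c * T) * (LINT \<xi>|lborel. en 0 \<xi>)"
    using F_en T by simp
qed

text \<open>
  For a given \<open>c\<close>, the frequencies of rate at least \<open>c\<close> at which the energy decays more slowly than
  \<open>exp (- c * T)\<close> form a null set, by the estimate applied to exactly this set. The union of these null
  sets over rational \<open>c\<close> is still null, and outside it \<open>c\<close> can be moved up to the rate itself.
\<close>

lemma energy_decay:
  fixes u ut utt :: "real \<Rightarrow> real ^ 'n \<Rightarrow> complex"
  assumes d1: "sobolev_deriv 1 u ut" and d2: "sobolev_deriv 1 ut utt"
    and eq: "\<forall>t>0. satisfies_equation (u t) (ut t) (utt t)" and T: "0 \<le> T"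
  shows "AE \<xi> in lborel. energy \<xi> (fourier (u T) \<xi>) (fourier (ut T) \<xi>)
    \<le> exp (- decay_rate \<xi> * T) * energy \<xi> (fourier (u 0) \<xi>) (fourier (ut 0) \<xi>)"
proof -
  define e where "e t \<xi> = energy \<xi> (fourier (u t) \<xi>) (fourier (ut t) \<xi>)" for t \<xi>
  have em [measurable]: "e t \<in> borel_measurable borel" if "0 \<le> t" for t
    unfolding e_def[abs_def] using d1 that
    by (intro energy_measurable L2_measurable fourier_L2) (auto simp: sobolev_deriv_def intro: sobolev_imp_L2)
  have [measurable]: "e T \<in> borel_measurable borel" "e 0 \<in> borel_measurable borel" using em T by auto
  have each: "AE \<xi> in lborel. c \<le> decay_rate \<xi> \<longrightarrow> e T \<xi> \<le> exp (- c * T) * e 0 \<xi>" for c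
  proof -
    define A where "A = {\<xi> :: real ^ 'n. c \<le> decay_rate \<xi> \<and> exp (- c * T) * e 0 \<xi> < e T \<xi>}"
    have Am [measurable]: "A \<in> sets borel" unfolding A_def by measurable
    have cA: "\<forall>\<xi>\<in>A. c \<le> decay_rate \<xi>" by (simp add: A_def)
    note dec = energy_decay_on_set[OF d1 d2 eq Am cA T, folded e_def]
    define D where "D \<xi> = indicator A \<xi> * e T \<xi> - exp (- c * T) * (indicator A \<xi> * e 0 \<xi>)" for \<xi>
    have Di: "integrable lborel D" unfolding D_def[abs_def]
      using dec(1)[OF T] dec(1)[of 0] by auto
    have D0: "0 \<le> D \<xi>" for \<xi> by (simp add: D_def A_def indicator_def)
    have "(LINT \<xi>|lborel. D \<xi>) = (LINT \<xi>|lborel. indicator A \<xi> * e T \<xi>) - exp (- c * T) * (LINT \<xi>|lborel. indicator A \<xi> * e 0 \<xi>)"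
      unfolding D_def using dec(1)[OF T] dec(1)[of 0] by (subst Bochner_Integration.integral_diff) auto
    also have "\<dots> \<le> 0" using dec(2) by simp
    finally have "(LINT \<xi>|lborel. D \<xi>) = 0" using D0 by (intro antisym integral_nonneg) auto
    then have "AE \<xi> in lborel. D \<xi> = 0"
      using integral_nonneg_eq_0_iff_AE[OF Di] D0 by auto
    then show ?thesis
    proof eventually_elim
      case (elim \<xi>)
      have "\<xi> \<notin> A"
      proof
        assume "\<xi> \<in> A"
        then have "0 < D \<xi>" by (simp add: D_def) (simp add: A_def)
        then show False using elim by simp
      qed
      then show ?case by (auto simp: A_def not_less)
    qed
  qed
  have "AE \<xi> in lborel. \<forall>c\<in>\<rat>. c \<le> decay_rate \<xi> \<longrightarrow> e T \<xi> \<le> exp (- c * T) * e 0 \<xi>"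
    unfolding AE_ball_countable[OF countable_rat] using each by blast
  then have "AE \<xi> in lborel. e T \<xi> \<le> exp (- decay_rate \<xi> * T) * e 0 \<xi>"
  proof eventually_elim
    case (elim \<xi>)
    show ?case
    proof (rule ccontr)
      assume n: "\<not> e T \<xi> \<le> exp (- decay_rate \<xi> * T) * e 0 \<xi>"
      have "((\<lambda>c. exp (- c * T) * e 0 \<xi>) \<longlongrightarrow> exp (- decay_rate \<xi> * T) * e 0 \<xi>) (at_left (decay_rate \<xi>))"
        by (intro tendsto_intros)
      then have "\<forall>\<^sub>F c in at_left (decay_rate \<xi>). exp (- c * T) * e 0 \<xi> < e T \<xi>"
        using n by (intro order_tendstoD(2)) auto
      then obtain b where b: "b < decay_rate \<xi>" "\<And>c. b < c \<Longrightarrow> c < decay_rate \<xi> \<Longrightarrow> exp (- c * T) * e 0 \<xi> < e T \<xi>"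
        by (auto simp: eventually_at_left[of "decay_rate \<xi> - 1"])
      obtain c where "c \<in> \<rat>" "b < c" "c < decay_rate \<xi>" using Rats_dense_in_real[OF b(1)] by auto
      then show False using elim b(2)[of c] by force
    qed
  qed
  then show ?thesis by (simp add: e_def)
qed

section \<open>The decay estimate\<close>

lemma powr_times_exp_bound:
  fixes m s :: real
  assumes "0 < m" "0 < s"
  shows "exp (- s / 4) \<le> (4 * m) powr m * s powr (- m)"
proof -
  have "ln (s / (4 * m)) \<le> s / (4 * m) - 1" using assms by (intro ln_le_minus_one) simp
  then have "m * ln (s / (4 * m)) \<le> m * (s / (4 * m) - 1)" using assms by (intro mult_left_mono) auto
  also have "\<dots> \<le> s / 4" using assms by (simp add: field_simps)
  finally have "m * ln s - m * ln (4 * m) \<le> s / 4" using assms by (simp add: ln_div right_diff_distrib)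
  then have "exp (- s / 4) \<le> exp (m * ln (4 * m) + (- m) * ln s)" by simp
  also have "\<dots> = (4 * m) powr m * s powr (- m)" using assms unfolding powr_def exp_add by simp
  finally show ?thesis .
qed

text \<open>
  The rate is at least \<open>1 / (4 (1 + |\<xi>|\<^sup>2))\<close>, and any power of \<open>T / (1 + |\<xi>|\<^sup>2)\<close> is absorbed by the
  exponential. So time decay of order \<open>m\<close> is paid for by \<open>m\<close> powers of \<open>1 + |\<xi>|\<^sup>2\<close>.
\<close>

lemma high_frequency_decay:
  fixes \<xi> :: "real ^ 'n"
  assumes r: "1 \<le> (norm \<xi>)\<^sup>2" and T: "0 < T" and m: "0 < m"
  shows "exp (- decay_rate \<xi> * T) \<le> (4 * m) powr m * T powr (- m) * (1 + (norm \<xi>)\<^sup>2) powr m"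
proof -
  define s where "s = T / (1 + (norm \<xi>)\<^sup>2)"
  have p: "0 < 1 + (norm \<xi>)\<^sup>2" by (simp add: add_pos_nonneg)
  have s: "0 < s" using T p by (simp add: s_def)
  have "1 / 4 * damping \<xi> \<le> decay_rate \<xi>"
  proof -
    have "1 + (norm \<xi>)\<^sup>2 \<le> 2 * (norm \<xi>)\<^sup>2" using r by simp
    then have "damping \<xi> * damping \<xi> * (1 + (norm \<xi>)\<^sup>2) \<le> damping \<xi> * damping \<xi> * (2 * (norm \<xi>)\<^sup>2)"
      using damping_bounds(1)[of \<xi>] by (intro mult_left_mono) auto
    moreover have "damping \<xi> * damping \<xi> * (1 + (norm \<xi>)\<^sup>2) = damping \<xi>"
      using damping_bounds(4)[of \<xi>] by (simp only: mult.assoc mult.commute[of "damping \<xi>" "1 + _"] mult_1_right)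
    ultimately have "damping \<xi> \<le> damping \<xi> * damping \<xi> * (2 * (norm \<xi>)\<^sup>2)" by (simp only:)
    then show ?thesis by (simp add: decay_rate_def power2_eq_square mult_ac)
  qed
  then have "(1 / 4 * damping \<xi>) * T \<le> decay_rate \<xi> * T" using T by (intro mult_right_mono) auto
  moreover have "(1 / 4 * damping \<xi>) * T = s / 4" using p by (simp add: damping_def s_def)
  ultimately have "exp (- decay_rate \<xi> * T) \<le> exp (- s / 4)" by simp
  also have "\<dots> \<le> (4 * m) powr m * s powr (- m)" by (rule powr_times_exp_bound[OF m s])
  also have "s powr (- m) = T powr (- m) * (1 + (norm \<xi>)\<^sup>2) powr m"
    using T p by (simp add: s_def powr_divide powr_minus field_simps)
  finally show ?thesis by (simp add: mult.assoc)
qed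

lemma low_frequency_decay:
  fixes \<xi> :: "real ^ 'n"
  assumes r: "(norm \<xi>)\<^sup>2 \<le> 1" and T: "0 \<le> T"
  shows "exp (- decay_rate \<xi> * T) \<le> gauss_weight (T / 4) \<xi>"
proof -
  have "1 / 2 \<le> damping \<xi>" using r unfolding damping_def by (intro divide_left_mono) (auto simp: add_pos_nonneg)
  then have "(1 / 2)\<^sup>2 \<le> (damping \<xi>)\<^sup>2" by (intro power_mono) auto
  then have "(norm \<xi>)\<^sup>2 * (1 / 4) \<le> (norm \<xi>)\<^sup>2 * (damping \<xi>)\<^sup>2" by (intro mult_left_mono) (auto simp: power2_eq_square)
  then have "(norm \<xi>)\<^sup>2 / 8 * T \<le> decay_rate \<xi> * T" using T unfolding decay_rate_def by (intro mult_right_mono) auto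
  then show ?thesis by (simp add: gauss_weight_def field_simps)
qed

lemma fourier_le_L11_norm:
  fixes f :: "real ^ 'n \<Rightarrow> complex"
  assumes "f \<in> L2" "f \<in> L11"
  shows "AE \<xi> in lborel. norm (fourier f \<xi>) \<le> L11_norm f"
proof -
  have f: "integrable lborel f" "integrable lborel (\<lambda>x. (1 + norm x) * norm (f x))" using assms(2) by (auto simp: L11_def)
  have "(LINT x|lborel. norm (f x)) \<le> L11_norm f"
    unfolding L11_norm_def using f by (intro integral_mono) (auto simp: algebra_simps)
  then have "norm (fourier_integral f \<xi>) \<le> L11_norm f" for \<xi>
    using fourier_integral_bound[of f \<xi>] by linarith
  then show ?thesis using fourier_eq_fourier_integral[OF assms(1) f(1)] by auto
qed

text \<open>
  At low frequencies the transforms of the data are bounded by their \<open>L\<^sup>1\<close> norms and the Gaussian in \<open>\<xi>\<close>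
  provides the decay after integration. At high frequencies order \<open>l + 1\<close> of decay costs exactly
  the regularity \<open>H\<^sup>l\<^sup>+\<^sup>1\<close> of \<open>u\<^sub>0\<close> and, one order being gained from the denominator, \<open>H\<^sup>l\<close> of \<open>u\<^sub>1\<close>.
\<close>

lemma fourier_solution_bound:
  fixes u\<^sub>0 u\<^sub>1 :: "real ^ 'n \<Rightarrow> complex"
  assumes u0: "u\<^sub>0 \<in> L2" "u\<^sub>0 \<in> L11" and u1: "u\<^sub>1 \<in> L2" "u\<^sub>1 \<in> L11"
    and sol: "solves_cauchy_problem u\<^sub>0 u\<^sub>1 u" and T: "0 < T" and l: "0 < l + 1"
  shows "u T \<in> L2"
    and "AE \<xi> in lborel. (norm (fourier (u T) \<xi>))\<^sup>2 \<le>
      48 * ((L11_norm u\<^sub>1)\<^sup>2 + (L11_norm u\<^sub>0)\<^sup>2) * gauss_weight (T / 4) \<xi>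
      + 48 * ((4 * (l + 1)) powr (l + 1) * T powr (- (l + 1))) *
        ((1 + (norm \<xi>)\<^sup>2) powr l * (norm (fourier u\<^sub>1 \<xi>))\<^sup>2 + (1 + (norm \<xi>)\<^sup>2) powr (l + 1) * (norm (fourier u\<^sub>0 \<xi>))\<^sup>2)"
proof -
  obtain ut utt where d1: "sobolev_deriv 1 u ut" and d2: "sobolev_deriv 1 ut utt"
    and eq: "\<forall>t>0. satisfies_equation (u t) (ut t) (utt t)"
    and i0: "AE x in lborel. u 0 x = u\<^sub>0 x" and i1: "AE x in lborel. ut 0 x = u\<^sub>1 x"
    using sol unfolding solves_cauchy_problem_def by blast
  have L: "u t \<in> L2" "ut t \<in> L2" if "0 \<le> t" for t
    using d1 that by (auto simp: sobolev_deriv_def intro: sobolev_imp_L2)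
  show "u T \<in> L2" using L T by simp
  have f0: "fourier (u 0) = fourier u\<^sub>0" and f1: "fourier (ut 0) = fourier u\<^sub>1"
    using L[of 0] u0 u1 i0 i1 by (auto intro!: fourier_cong_AE L2_measurable)
  have T0: "0 \<le> T" using T by simp
  show "AE \<xi> in lborel. (norm (fourier (u T) \<xi>))\<^sup>2 \<le>
      48 * ((L11_norm u\<^sub>1)\<^sup>2 + (L11_norm u\<^sub>0)\<^sup>2) * gauss_weight (T / 4) \<xi>
      + 48 * ((4 * (l + 1)) powr (l + 1) * T powr (- (l + 1))) *
        ((1 + (norm \<xi>)\<^sup>2) powr l * (norm (fourier u\<^sub>1 \<xi>))\<^sup>2 + (1 + (norm \<xi>)\<^sup>2) powr (l + 1) * (norm (fourier u\<^sub>0 \<xi>))\<^sup>2)"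
    (is "AE \<xi> in lborel. _ \<le> ?low \<xi> + ?high \<xi>")
    using energy_decay[OF d1 d2 eq T0] fourier_le_L11_norm[OF u0] fourier_le_L11_norm[OF u1]
  proof eventually_elim
    case (elim \<xi>)
    define r where "r = 1 + (norm \<xi>)\<^sup>2"
    have r: "1 \<le> r" by (simp add: r_def)
    define E where "E = exp (- decay_rate \<xi> * T)"
    have E0: "0 \<le> E" by (simp add: E_def)
    define y0 y1 y where "y0 = (norm (fourier u\<^sub>0 \<xi>))\<^sup>2" and "y1 = (norm (fourier u\<^sub>1 \<xi>))\<^sup>2"
      and "y = (norm (fourier (u T) \<xi>))\<^sup>2"
    have y: "0 \<le> y0" "0 \<le> y1" by (simp_all add: y0_def y1_def)
    \<comment> \<open>The constant is \<open>48 = 32 * 3 / 2\<close>, from the lower and the upper bound of the energy.\<close>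
    have "r / 32 * y \<le> energy \<xi> (fourier (u T) \<xi>) (fourier (ut T) \<xi>)"
      unfolding r_def y_def by (rule energy_lower)
    also have "\<dots> \<le> E * energy \<xi> (fourier u\<^sub>0 \<xi>) (fourier u\<^sub>1 \<xi>)" using elim(1) by (simp add: E_def f0 f1)
    also have "\<dots> \<le> E * (3 / 2 * (y1 + r * y0))"
      unfolding r_def y0_def y1_def by (intro mult_left_mono energy_initial E0)
    finally have "32 / r * (r / 32 * y) \<le> 32 / r * (E * (3 / 2 * (y1 + r * y0)))"
      using r by (intro mult_left_mono) auto
    moreover have "32 / r * (r / 32 * y) = y" "32 / r * (E * (3 / 2 * (y1 + r * y0))) = 48 * (E * (y1 / r + y0))"
      using r by (simp_all add: field_simps)
    ultimately have main: "y \<le> 48 * (E * (y1 / r + y0))" by (simp only:)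
    have low0: "0 \<le> ?low \<xi>" by simp
    have high0: "0 \<le> ?high \<xi>" by simp
    show ?case
    proof (cases "(norm \<xi>)\<^sup>2 \<le> 1")
      case True
      have "y1 / r \<le> y1" using r y by (simp add: divide_le_eq mult_right_le_one_le mult_le_cancel_left1)
      moreover have "y1 \<le> (L11_norm u\<^sub>1)\<^sup>2" "y0 \<le> (L11_norm u\<^sub>0)\<^sup>2"
        unfolding y0_def y1_def using elim by (auto intro!: power_mono)
      ultimately have "y1 / r + y0 \<le> (L11_norm u\<^sub>1)\<^sup>2 + (L11_norm u\<^sub>0)\<^sup>2" by linarith
      then have "E * (y1 / r + y0) \<le> gauss_weight (T / 4) \<xi> * ((L11_norm u\<^sub>1)\<^sup>2 + (L11_norm u\<^sub>0)\<^sup>2)"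
        using low_frequency_decay[OF True T0] y r by (intro mult_mono) (auto simp: E_def)
      then have "48 * (E * (y1 / r + y0)) \<le> 48 * (gauss_weight (T / 4) \<xi> * ((L11_norm u\<^sub>1)\<^sup>2 + (L11_norm u\<^sub>0)\<^sup>2))"
        by (rule mult_left_mono) simp
      also have "\<dots> = ?low \<xi>" by (simp only: mult_ac)
      finally have "y \<le> ?low \<xi>" using main by (rule order_trans[rotated])
      then show ?thesis unfolding y_def by (rule add_increasing2[OF high0])
    next
      case False
      have "E \<le> (4 * (l + 1)) powr (l + 1) * T powr (- (l + 1)) * r powr (l + 1)"
        unfolding E_def r_def using False T l by (intro high_frequency_decay) auto
      then have "E * (y1 / r + y0) \<le> ((4 * (l + 1)) powr (l + 1) * T powr (- (l + 1)) * r powr (l + 1)) * (y1 / r + y0)"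
        using y r by (intro mult_right_mono) auto
      also have "\<dots> = (4 * (l + 1)) powr (l + 1) * T powr (- (l + 1)) * (r powr (l + 1) * (y1 / r + y0))"
        by (simp only: mult.assoc)
      also have "r powr (l + 1) * (y1 / r + y0) = r powr l * y1 + r powr (l + 1) * y0"
        using r by (simp add: powr_add field_simps)
      finally have "y \<le> ?high \<xi>" using main by (simp add: r_def y0_def y1_def mult.assoc)
      then show ?thesis unfolding y_def by (rule add_increasing[OF low0])
    qed
  qed
qed

lemma sobolev_norm_square: "(sobolev_norm s f)\<^sup>2 = (LINT \<xi>|lborel. (1 + (norm \<xi>)\<^sup>2) powr s * (norm (fourier f \<xi>))\<^sup>2)"
  by (simp add: sobolev_norm_def)

theorem theorem5p2:
  fixes l :: real
  assumes "CARD('n::finite) \<le> 5 \<Longrightarrow> l \<ge> 2"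
    and "CARD('n) \<ge> 6 \<Longrightarrow> l \<ge> real CARD('n) / 2 - 1"
  shows "\<exists>C>0. \<forall>(u\<^sub>0 :: real ^ 'n \<Rightarrow> complex) u\<^sub>1 u.
    u\<^sub>0 \<in> sobolev (l + 1) \<inter> L11 \<longrightarrow> u\<^sub>1 \<in> sobolev l \<inter> L11 \<longrightarrow>
    u \<in> X2 \<longrightarrow> solves_cauchy_problem u\<^sub>0 u\<^sub>1 u \<longrightarrow>
    (\<forall>t\<ge>1. L2_norm (u t) \<le> C * I0 l u\<^sub>0 u\<^sub>1 * t powr (- real CARD('n) / 4))"
proof -
  define n where "n = real CARD('n)"
  \<comment> \<open>The high frequencies decay like \<open>t powr (- (l + 1))\<close> in the square of the norm, the low ones like
    \<open>t powr (- n / 2)\<close>; the regularity assumption makes the latter the slower one.\<close>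
  have l: "n / 2 \<le> l + 1" "0 < l + 1"
    using assms zero_less_card_finite[where 'a='n] by (cases "CARD('n) \<le> 5"; simp add: n_def; linarith)+
  define K1 where "K1 = 48 * sqrt (8 * pi) ^ CARD('n)"
  define K2 where "K2 = 48 * (4 * (l + 1)) powr (l + 1)"
  define K where "K = K1 + K2"
  have K: "0 < K1" "0 < K2" using l by (simp_all add: K1_def K2_def)
  then have K0: "0 < K" by (simp add: K_def)
  show ?thesis
  proof (intro exI[of _ "sqrt K"] conjI allI impI)
    show "0 < sqrt K" using K0 by simp
  next
    fix u\<^sub>0 u\<^sub>1 :: "real ^ 'n \<Rightarrow> complex" and u and t :: real
    assume u0: "u\<^sub>0 \<in> sobolev (l + 1) \<inter> L11" and u1: "u\<^sub>1 \<in> sobolev l \<inter> L11"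
      and sol: "solves_cauchy_problem u\<^sub>0 u\<^sub>1 u" and t: "1 \<le> t"
    define N0 N1 S0 S1 where "N0 = L11_norm u\<^sub>0" and "N1 = L11_norm u\<^sub>1"
      and "S0 = sobolev_norm (l + 1) u\<^sub>0" and "S1 = sobolev_norm l u\<^sub>1"
    have nn: "0 \<le> N0" "0 \<le> N1" "0 \<le> S0" "0 \<le> S1"
      by (auto simp: N0_def N1_def S0_def S1_def L11_norm_def sobolev_norm_def intro!: integral_nonneg)
    have I0: "I0 l u\<^sub>0 u\<^sub>1 = S1 + S0 + N1 + N0" by (simp add: I0_def N0_def N1_def S0_def S1_def)
    have t0: "0 < t" using t by simp
    have L: "u\<^sub>0 \<in> L2" "u\<^sub>0 \<in> L11" "u\<^sub>1 \<in> L2" "u\<^sub>1 \<in> L11" using u0 u1 by (auto intro: sobolev_imp_L2)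
    note B = fourier_solution_bound[OF L sol t0 l(2)]
    let ?g = "\<lambda>\<xi>. 48 * (N1\<^sup>2 + N0\<^sup>2) * gauss_weight (t / 4) \<xi>
      + 48 * ((4 * (l + 1)) powr (l + 1) * t powr (- (l + 1))) *
        ((1 + (norm \<xi>)\<^sup>2) powr l * (norm (fourier u\<^sub>1 \<xi>))\<^sup>2 + (1 + (norm \<xi>)\<^sup>2) powr (l + 1) * (norm (fourier u\<^sub>0 \<xi>))\<^sup>2)"
    have Ig: "integrable lborel (gauss_weight (t / 4) :: real ^ 'n \<Rightarrow> real)"
      using t0 by (intro gauss_weight_integrable) simp
    have Is: "integrable lborel (\<lambda>\<xi>. (1 + (norm \<xi>)\<^sup>2) powr l * (norm (fourier u\<^sub>1 \<xi>))\<^sup>2)"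
      "integrable lborel (\<lambda>\<xi>. (1 + (norm \<xi>)\<^sup>2) powr (l + 1) * (norm (fourier u\<^sub>0 \<xi>))\<^sup>2)"
      using u0 u1 by (auto simp: sobolev_def)
    have I: "integrable lborel ?g"
      by (intro Bochner_Integration.integrable_add integrable_mult_right Ig Is)
    have "(L2_norm (fourier (u t)))\<^sup>2 \<le> (LINT \<xi>|lborel. ?g \<xi>)"
      unfolding L2_norm_square using B(2)[folded N0_def N1_def]
      by (intro integral_mono_AE L2_integrable_square fourier_L2 B(1) I)
    also have "\<dots> = 48 * (N1\<^sup>2 + N0\<^sup>2) * sqrt (2 * pi / (t / 4)) ^ CARD('n)
       + 48 * ((4 * (l + 1)) powr (l + 1) * t powr (- (l + 1))) * (S1\<^sup>2 + S0\<^sup>2)"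
    proof -
      have G: "(LINT \<xi>|lborel. gauss_weight (t / 4) (\<xi> :: real ^ 'n)) = sqrt (2 * pi / (t / 4)) ^ CARD('n)"
        using gauss_weight_integral[of "t / 4", where 'a="real ^ 'n"] t0 by simp
      show ?thesis
        unfolding S0_def S1_def sobolev_norm_square G[symmetric] integral_mult_right_zero[symmetric]
          Bochner_Integration.integral_add[OF Is, symmetric]
        by (intro Bochner_Integration.integral_add Bochner_Integration.integrable_add integrable_mult_right Ig Is)
    qed
    also have "\<dots> \<le> K1 * t powr (- n / 2) * (N1\<^sup>2 + N0\<^sup>2) + K2 * t powr (- n / 2) * (S1\<^sup>2 + S0\<^sup>2)"
    proof (intro add_mono)
      have "sqrt (2 * pi / (t / 4)) ^ CARD('n) = sqrt (8 * pi) ^ CARD('n) * t powr (- n / 2)"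
      proof -
        have "sqrt (2 * pi / (t / 4)) = sqrt (8 * pi) * t powr (- 1 / 2)"
          using t0 by (simp add: real_sqrt_divide powr_minus powr_half_sqrt field_simps)
        then show ?thesis using t0 by (simp add: power_mult_distrib n_def powr_power)
      qed
      then have "48 * (N1\<^sup>2 + N0\<^sup>2) * sqrt (2 * pi / (t / 4)) ^ CARD('n) = K1 * t powr (- n / 2) * (N1\<^sup>2 + N0\<^sup>2)"
        by (simp only: K1_def mult_ac)
      then show "48 * (N1\<^sup>2 + N0\<^sup>2) * sqrt (2 * pi / (t / 4)) ^ CARD('n) \<le> K1 * t powr (- n / 2) * (N1\<^sup>2 + N0\<^sup>2)"
        by (rule eq_refl)
      have "t powr (- (l + 1)) \<le> t powr (- n / 2)" using t l by (intro powr_mono) auto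
      then have "K2 * t powr (- (l + 1)) * (S1\<^sup>2 + S0\<^sup>2) \<le> K2 * t powr (- n / 2) * (S1\<^sup>2 + S0\<^sup>2)"
        using K by (intro mult_right_mono mult_left_mono) auto
      then show "48 * ((4 * (l + 1)) powr (l + 1) * t powr (- (l + 1))) * (S1\<^sup>2 + S0\<^sup>2) \<le> K2 * t powr (- n / 2) * (S1\<^sup>2 + S0\<^sup>2)"
        by (simp add: K2_def mult.assoc)
    qed
    also have "\<dots> \<le> K * t powr (- n / 2) * (N1\<^sup>2 + N0\<^sup>2) + K * t powr (- n / 2) * (S1\<^sup>2 + S0\<^sup>2)"
      using K by (intro add_mono mult_right_mono) (auto simp: K_def)
    also have "\<dots> = K * t powr (- n / 2) * (N1\<^sup>2 + N0\<^sup>2 + S1\<^sup>2 + S0\<^sup>2)" by (simp add: algebra_simps)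
    also have "\<dots> \<le> K * t powr (- n / 2) * (S1 + S0 + N1 + N0)\<^sup>2"
    proof (intro mult_left_mono)
      have "0 \<le> S1 * S0" "0 \<le> S1 * N1" "0 \<le> S1 * N0" "0 \<le> S0 * N1" "0 \<le> S0 * N0" "0 \<le> N1 * N0" using nn by auto
      then show "N1\<^sup>2 + N0\<^sup>2 + S1\<^sup>2 + S0\<^sup>2 \<le> (S1 + S0 + N1 + N0)\<^sup>2" by (simp add: power2_eq_square algebra_simps)
    qed (use K0 in auto)
    also have "\<dots> = (sqrt K * I0 l u\<^sub>0 u\<^sub>1 * t powr (- n / 4))\<^sup>2"
    proof -
      have "(t powr (- n / 4))\<^sup>2 = t powr (- n / 2)" using t0 by (simp add: powr_power)
      then show ?thesis using K0 by (simp add: I0 power_mult_distrib mult_ac)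
    qed
    finally have "L2_norm (fourier (u t)) \<le> sqrt K * I0 l u\<^sub>0 u\<^sub>1 * t powr (- n / 4)"
      by (rule power2_le_imp_le) (use K0 nn in \<open>simp add: I0\<close>)
    moreover have "L2_norm (u t) \<le> L2_norm (fourier (u t))"
    proof -
      have "1 \<le> (2 * pi) ^ CARD('n)" using pi_gt3 by (intro one_le_power) simp
      then have "1 \<le> sqrt ((2 * pi) ^ CARD('n))" by simp
      then have "1 * L2_norm (u t) \<le> sqrt ((2 * pi) ^ CARD('n)) * L2_norm (u t)" by (intro mult_right_mono) auto
      then show ?thesis using plancherel_lower[OF B(1)] by simp
    qed
    ultimately show "L2_norm (u t) \<le> sqrt K * I0 l u\<^sub>0 u\<^sub>1 * t powr (- real CARD('n) / 4)" by (simp add: n_def)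
  qed
qed

end
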